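(* Let $\Omega\subseteq\mathbb{R}^n$, $n\ge 2$, be a domain with exterior cusps, and let $u$ be the unique function in $W^{1,2}_0(\Omega)$ with $\Delta u=-1$ in $\Omega$. If $n\ge 3$, then for every $\beta\in(0,1)$ there holds $$\int_\Omega u(x)^{-\beta}\,dx\le C(\Omega,\beta)<+\infty.\qquad( * )$$ The same is true in the two-dimensional setting provided $0<\beta\le 1/2$. Finally, in the case when $n=2$ and $\beta\in(1/2,1)$, $( * )$ holds if and only if the finiteness condition $$\int_0^\eta\mathcal{F}(\tau)^{1-2\beta}\,d\tau<+\infty$$ holds for every boundary cusp, where $\mathcal{F}$ and $\eta$ are the function and the number associated with the cusp.
   Context: A domain with exterior cusps is a bounded open set $\Omega\subseteq\mathbb{R}^n$ with a piecewise $C^2$ boundary exhibiting finitely many exterior cusps; that is, $\partial\Omega$ is of class $C^2$ (locally, up to a rigid motion, the graph of a $C^2$ function with $\Omega$ lying on one side) except at finitely many points, each of which is an exterior cusp. By definition $x_0\in\partial\Omega$ is an exterior cusp if, after a rigid transformation of space which maps $x_0$ into the origin, there exist two small numbers $\varepsilon,\eta>0$ along with a function $\mathcal{F}\in C^2([0,\eta])$ with $\mathcal{F}(0)=0$, $\mathcal{F}>0$ on $(0,\eta]$ and $\mathcal{F}'(0)=0$, such that $\{x\in\Omega:\,x_n\le\eta\}$ coincides with the cuspidal set $\{x=(x',x_n)\in\mathbb{R}^{n-1}\times\mathbb{R}:\ 0<x_n\le\eta,\ |x'|<\varepsilon\mathcal{F}(x_n)\}$. *)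

theory Defs
  imports "HOL-Analysis.Analysis"
begin

text \<open>
  Sets such as the cuspidal set are described in coordinates \<open>x = (x', x\<^sub>n)\<close>, so n-dimensional
  space is rendered as the Euclidean space \<open>'a \<times> real\<close> with \<open>'a\<close> an arbitrary Euclidean space
  of dimension \<open>n - 1\<close>; thus \<open>n = DIM('a \<times> real) \<ge> 2\<close>, and all such \<open>n\<close> occur. The norm on the
  product type is the Euclidean one.
\<close>

section \<open>Functions of class \<open>C\<^sup>k\<close>\<close>

definition partial :: "'b::euclidean_space \<Rightarrow> ('b \<Rightarrow> real) \<Rightarrow> 'b \<Rightarrow> real" where
  "partial b f = (\<lambda>x. frechet_derivative f (at x) b)"

text \<open>Class \<open>C\<^sup>k\<close> on an open set; \<open>S\<close> has to be open, because \<open>partial\<close> differentiates in the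
  whole space.\<close>

primrec Ck_on :: "nat \<Rightarrow> 'b::euclidean_space set \<Rightarrow> ('b \<Rightarrow> real) \<Rightarrow> bool" where
  "Ck_on 0 S f \<longleftrightarrow> continuous_on S f"
| "Ck_on (Suc k) S f \<longleftrightarrow> f differentiable_on S \<and> (\<forall>b\<in>Basis. Ck_on k S (partial b f))"

text \<open>Class \<open>C\<^sup>2\<close> on the closed interval \<open>[0, \<eta>]\<close>, with one-sided derivatives at the end points.\<close>

definition C2_on_closed :: "real \<Rightarrow> (real \<Rightarrow> real) \<Rightarrow> bool" where
  "C2_on_closed \<eta> F \<longleftrightarrow>
     (\<exists>F' F''. (\<forall>t\<in>{0..\<eta>}. (F has_real_derivative F' t) (at t within {0..\<eta>}) \<and>
                           (F' has_real_derivative F'' t) (at t within {0..\<eta>})) \<and>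
               continuous_on {0..\<eta>} F'')"

section \<open>Domains with exterior cusps\<close>

text \<open>A rigid transformation sending \<open>p\<close> to the origin has the form \<open>x \<mapsto> A (x - p)\<close> with \<open>A\<close>
  orthogonal.\<close>

definition C2_boundary_at :: "('a::euclidean_space \<times> real) set \<Rightarrow> 'a \<times> real \<Rightarrow> bool" where
  "C2_boundary_at \<Omega> p \<longleftrightarrow>
     (\<exists>(A :: 'a \<times> real \<Rightarrow> 'a \<times> real) \<phi> r h. 
        orthogonal_transformation A \<and> 0 < r \<and> 0 < h \<and> Ck_on 2 (ball 0 r) \<phi> \<and>
        (\<forall>x' t. norm x' < r \<and> \<bar>t\<bar> < h \<longrightarrow>
           ((x', t) \<in> (\<lambda>x. A (x - p)) ` frontier \<Omega> \<longleftrightarrow> t = \<phi> x') \<and>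
           ((x', t) \<in> (\<lambda>x. A (x - p)) ` \<Omega> \<longleftrightarrow> \<phi> x' < t)))"

text \<open>\<open>cusp_profile \<Omega> p \<eta> F\<close>: the boundary point \<open>p\<close> is an exterior cusp of \<open>\<Omega>\<close> with associated
  number \<open>\<eta>\<close> and associated function \<open>F\<close>.\<close>

definition cusp_profile ::
    "('a::euclidean_space \<times> real) set \<Rightarrow> 'a \<times> real \<Rightarrow> real \<Rightarrow> (real \<Rightarrow> real) \<Rightarrow> bool" where
  "cusp_profile \<Omega> p \<eta> F \<longleftrightarrow>
     p \<in> frontier \<Omega> \<and> 0 < \<eta> \<and> C2_on_closed \<eta> F \<and> F 0 = 0 \<and> (\<forall>t\<in>{0<..\<eta>}. 0 < F t) \<and>
     (F has_real_derivative 0) (at 0 within {0..\<eta>}) \<and>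
     (\<exists>(A :: 'a \<times> real \<Rightarrow> 'a \<times> real) \<epsilon>. orthogonal_transformation A \<and> 0 < \<epsilon> \<and>
        {y \<in> (\<lambda>x. A (x - p)) ` \<Omega>. snd y \<le> \<eta>} =
        {(x', t). 0 < t \<and> t \<le> \<eta> \<and> norm x' < \<epsilon> * F t})"

definition exterior_cusps :: "('a::euclidean_space \<times> real) set \<Rightarrow> ('a \<times> real) set" where
  "exterior_cusps \<Omega> = {p. \<exists>\<eta> F. cusp_profile \<Omega> p \<eta> F}"

definition domain_with_exterior_cusps :: "('a::euclidean_space \<times> real) set \<Rightarrow> bool" where
  "domain_with_exterior_cusps \<Omega> \<longleftrightarrow>
     bounded \<Omega> \<and> open \<Omega> \<and>
     (\<exists>S. finite S \<and> S \<subseteq> exterior_cusps \<Omega> \<and> (\<forall>p\<in>frontier \<Omega> - S. C2_boundary_at \<Omega> p))"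

section \<open>Sobolev spaces and the torsion function\<close>

definition test_functions :: "'b::euclidean_space set \<Rightarrow> ('b \<Rightarrow> real) set" where
  "test_functions \<Omega> = {\<phi>. (\<forall>k. Ck_on k UNIV \<phi>) \<and>
     compact (closure {x. \<phi> x \<noteq> 0}) \<and> closure {x. \<phi> x \<noteq> 0} \<subseteq> \<Omega>}"

definition gradient :: "('b::euclidean_space \<Rightarrow> real) \<Rightarrow> 'b \<Rightarrow> 'b" where
  "gradient f x = (\<Sum>b\<in>Basis. partial b f x *\<^sub>R b)"

definition laplacian :: "('b::euclidean_space \<Rightarrow> real) \<Rightarrow> 'b \<Rightarrow> real" where
  "laplacian f x = (\<Sum>b\<in>Basis. partial b (partial b f) x)"

definition L2_on :: "'b::euclidean_space set \<Rightarrow> ('b \<Rightarrow> 'c::euclidean_space) \<Rightarrow> bool" where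
  "L2_on \<Omega> f \<longleftrightarrow> f \<in> borel_measurable (lebesgue_on \<Omega>) \<and>
     integrable (lebesgue_on \<Omega>) (\<lambda>x. (norm (f x))\<^sup>2)"

definition weak_gradient :: "'b::euclidean_space set \<Rightarrow> ('b \<Rightarrow> real) \<Rightarrow> ('b \<Rightarrow> 'b) \<Rightarrow> bool" where
  "weak_gradient \<Omega> u G \<longleftrightarrow>
     (\<forall>\<phi>\<in>test_functions \<Omega>. \<forall>b\<in>Basis.
        (\<integral>x. u x * partial b \<phi> x \<partial>lebesgue_on \<Omega>) = - (\<integral>x. (G x \<bullet> b) * \<phi> x \<partial>lebesgue_on \<Omega>))"

text \<open>The closure of the test functions in \<open>W\<^sup>1\<^sup>,\<^sup>2\<close>. Functions are representatives: only their
  values on \<open>\<Omega>\<close>, up to null sets, matter.\<close>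

definition W12_0 :: "'b::euclidean_space set \<Rightarrow> ('b \<Rightarrow> real) set" where
  "W12_0 \<Omega> = {u. L2_on \<Omega> u \<and>
     (\<exists>G. L2_on \<Omega> G \<and> weak_gradient \<Omega> u G \<and>
        (\<exists>\<psi> :: nat \<Rightarrow> 'b \<Rightarrow> real. (\<forall>k. \<psi> k \<in> test_functions \<Omega>) \<and>
           (\<lambda>k. (\<integral>x. (u x - \<psi> k x)\<^sup>2 \<partial>lebesgue_on \<Omega>) +
                (\<integral>x. (norm (G x - gradient (\<psi> k) x))\<^sup>2 \<partial>lebesgue_on \<Omega>)) \<longlonglongrightarrow> 0))}"

text \<open>\<open>u \<in> W\<^sub>0\<^sup>1\<^sup>,\<^sup>2(\<Omega>)\<close> with \<open>\<Delta>u = -1\<close> in \<open>\<Omega>\<close> in the sense of distributions.\<close>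

definition torsion_function :: "'b::euclidean_space set \<Rightarrow> ('b \<Rightarrow> real) \<Rightarrow> bool" where
  "torsion_function \<Omega> u \<longleftrightarrow> u \<in> W12_0 \<Omega> \<and>
     (\<forall>\<phi>\<in>test_functions \<Omega>.
        (\<integral>x. u x * laplacian \<phi> x \<partial>lebesgue_on \<Omega>) = - (\<integral>x. \<phi> x \<partial>lebesgue_on \<Omega>))"

text \<open>The integral of \<open>u\<close> to the power \<open>-\<beta>\<close>. Since \<open>powr\<close> takes conventional finite values at
  arguments that are not positive, the integrand is set to \<open>\<infinity>\<close> there; finiteness therefore
  includes that \<open>u > 0\<close> almost everywhere in \<open>\<Omega>\<close>.\<close>

definition neg_power_integral ::
    "'b::euclidean_space set \<Rightarrow> ('b \<Rightarrow> real) \<Rightarrow> real \<Rightarrow> ennreal" where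
  "neg_power_integral \<Omega> u \<beta> =
     (\<integral>\<^sup>+x\<in>\<Omega>. (if 0 < u x then ennreal (u x powr (- \<beta>)) else \<infinity>) \<partial>lebesgue)"

end

theory Submission
  imports Defs
begin

text \<open>
  Let \<open>u\<close> be the torsion function. Testing the equation for \<open>u - S\<close> with a smooth truncation of \<open>\<psi> - S\<close>,
  \<open>\<psi>\<close> a test function close to \<open>u\<close>, shows that \<open>u\<close> lies above \<open>C\<^sup>2\<close> functions of compact support with
  Laplacian at least \<open>-1\<close>, and below nonnegative ones with Laplacian at most \<open>-1\<close>. Positive parts and
  minima of barriers are smoothed by a convex function, so local barriers can be glued.

  A paraboloid bounds \<open>u\<close> from below near an interior point. Near a \<open>C\<^sup>2\<close> boundary point \<open>u\<close> is at
  least a multiple of the height above the boundary, whose power \<open>-\<beta>\<close> is integrable as \<open>\<beta> < 1\<close>. In a cusp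
  \<open>c (\<epsilon>\<^sup>2 F\<^sup>2 - \<bar>x'\<bar>\<^sup>2) \<le> u \<le> C F\<^sup>2\<close> near the tip, so the integral of \<open>u\<close> to the power \<open>-\<beta>\<close> over the
  slice at height \<open>t\<close> is comparable to \<open>F(t)\<close> to the power \<open>n - 1 - 2\<beta>\<close>. The exponent is nonnegative for
  \<open>n \<ge> 3\<close> or \<open>\<beta> \<le> 1/2\<close> and equals \<open>1 - 2\<beta>\<close> in the plane; compactness of the closure of \<open>\<Omega>\<close> does the rest.
\<close>

section \<open>Flat functions and the smoothed positive part\<close>

text \<open>Neither regularity nor pointwise values of \<open>u\<close> are available:
  \<open>W12_0\<close> gives a representative up to null sets, so every bound is an
  almost-everywhere comparison with an explicit function. Membership in \<open>W12_0\<close> also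
  replaces boundary values: a truncation of \<open>\<psi> - S\<close> has compact support in
  \<open>\<Omega>\<close> once \<open>S\<close> has the right sign off a compact set. This
  truncation is only C^1, whereas the equation is tested with C^\<infinity> functions; hence the
  mollification. The barriers in a cusp come from its slices: on an (n-1)-ball of radius R the
  function (R^2 - |x'|^2) / (2 (n-1)) has Laplacian -1, and here R = \<epsilon> F(t) varies with the
  height. From below a small factor absorbs the height derivatives. From above they must themselves
  be small, and F(0) = F'(0) = 0 makes (F^2)'' = 2 F'^2 + 2 F F'' vanish at the tip. As a cusp is
  described only up to the height \<eta>, barriers are local and have to be closed at an artificial
  top: a lower one is driven to zero there, an upper one is made to exceed a global bound for
  \<open>u\<close>.\<close>

definition flat :: "int \<Rightarrow> real \<Rightarrow> real" where
  "flat m t = (if 0 < t then exp (- 1 / t) * t powi m else 0)"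

lemma flat_nonneg: "0 \<le> flat m t"
  by (simp add: flat_def)

lemma flat_pos: "0 < t \<Longrightarrow> 0 < flat m t"
  by (simp add: flat_def)

lemma flat_le0 [simp]: "t \<le> 0 \<Longrightarrow> flat m t = 0"
  by (simp add: flat_def)

text \<open>The substitution x = 1/t turns the claim into x^k / exp x \<rightarrow> 0. For 0 < t < 1
  every integer power t^m is at most t^(-|m|), which reduces all \<open>m\<close> to a natural
  exponent \<open>k\<close>.\<close>

lemma flat_tendsto_0: "(flat m \<longlongrightarrow> 0) (at 0)"
proof -
  have neg: "(flat m \<longlongrightarrow> 0) (at_left 0)"
    by (rule tendsto_eventually) (auto simp: eventually_at_left_field intro!: exI[of _ "-1"])
  define k where "k = nat \<bar>m\<bar>"
  have "((\<lambda>x::real. x ^ k / exp x) \<longlongrightarrow> 0) at_top"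
    by (rule tendsto_power_div_exp_0)
  then have *: "((\<lambda>x::real. (inverse x) ^ k / exp (inverse x)) \<longlongrightarrow> 0) (at_right 0)"
    by (simp add: filterlim_at_right_to_top)
  have "(flat m \<longlongrightarrow> 0) (at_right 0)"
  proof (rule tendsto_sandwich[OF _ _ tendsto_const *])
    show "\<forall>\<^sub>F t in at_right 0. 0 \<le> flat m t"
      by (simp add: flat_nonneg)
    have "flat m t \<le> inverse t ^ k / exp (inverse t)" if t: "0 < t" "t < 1" for t :: real
    proof -
      have "t powi m \<le> t powi (- int k)"
        using t unfolding k_def by (intro power_int_decreasing) auto
      also have "\<dots> = inverse t ^ k"
        by (simp add: power_int_minus power_inverse)
      finally have "t powi m \<le> inverse t ^ k" .
      moreover have "exp (- 1 / t) = 1 / exp (inverse t)"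
        by (simp add: exp_minus inverse_eq_divide minus_divide_left [symmetric])
      ultimately show ?thesis using t
        by (simp add: flat_def divide_right_mono)
    qed
    then show "\<forall>\<^sub>F t in at_right 0. flat m t \<le> inverse t ^ k / exp (inverse t)"
      unfolding eventually_at_right_field by (intro exI[of _ 1]) auto
  qed
  with neg show ?thesis
    by (simp add: filterlim_at_split)
qed

lemma flat_deriv:
  "(flat m has_real_derivative flat (m - 2) t + of_int m * flat (m - 1) t) (at t)"
proof (cases t "0 :: real" rule: linorder_cases)
  case less
  have "(flat m has_real_derivative 0) (at t)"
    by (rule has_field_derivative_transform_within_open[of "\<lambda>_. 0" _ _ "{..<0}"]) (use less in auto)
  then show ?thesis using less by simp
next
  case equal
  \<comment> \<open>At the origin the difference quotient is again a member of the family, with the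
    exponent lowered by one.\<close>
  have "((\<lambda>h. (flat m h - flat m 0) / (h - 0)) \<longlongrightarrow> 0) (at 0)"
  proof (rule Lim_transform_eventually[OF flat_tendsto_0[of "m - 1"]])
    show "\<forall>\<^sub>F h in at 0. flat (m - 1) h = (flat m h - flat m 0) / (h - 0)"
      by (auto simp: flat_def power_int_diff eventually_at_filter)
  qed
  then show ?thesis
    unfolding equal by (simp add: has_field_derivative_iff)
next
  case greater
  have "((\<lambda>t. exp (- 1 / t) * t powi m) has_real_derivative
          exp (- 1 / t) * (1 / t\<^sup>2) * t powi m + exp (- 1 / t) * (of_int m * t powi (m - 1))) (at t)"
    using greater by (auto intro!: derivative_eq_intros simp: power2_eq_square field_simps)
  also have "exp (- 1 / t) * (1 / t\<^sup>2) * t powi m + exp (- 1 / t) * (of_int m * t powi (m - 1)) =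
      flat (m - 2) t + of_int m * flat (m - 1) t"
    using greater by (simp add: flat_def power_int_diff)
  finally show ?thesis
    by (rule has_field_derivative_transform_within_open[of _ _ _ "{0<..}"])
      (use greater in \<open>auto simp: flat_def\<close>)
qed

lemma continuous_on_flat [continuous_intros]:
  assumes "continuous_on S f" shows "continuous_on S (\<lambda>x. flat m (f x))"
proof -
  have "continuous_on UNIV (flat m)"
    by (meson DERIV_isCont flat_deriv continuous_at_imp_continuous_on)
  then show ?thesis
    using assms continuous_on_compose2 by blast
qed

text \<open>\<open>flat (-2)\<close> is the derivative of \<open>flat 0\<close>. With x = 1/t the
  bound reads x^2 \<le> exp x, the square of x \<le> exp (x/2), which follows from 1 + y \<le> exp y
  at y = x/2 - 1 and 2 \<le> exp 1.\<close>

lemma flat0_deriv_le1: "flat (-2) t \<le> 1"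
proof (cases "0 < t")
  case True
  define x where "x = 1 / t"
  have x: "x > 0" using True by (simp add: x_def)
  have "x \<le> exp (x / 2)"
  proof -
    have "x / 2 \<le> exp (x / 2 - 1)"
      using exp_ge_add_one_self[of "x / 2 - 1"] by simp
    moreover have "2 * exp (x / 2 - 1) \<le> exp 1 * exp (x / 2 - 1)"
      using exp_ge_add_one_self[of 1] by (intro mult_right_mono) auto
    ultimately show ?thesis by (simp flip: exp_add)
  qed
  then have "x\<^sup>2 \<le> exp (x / 2) ^ 2"
    using x by (intro power_mono) auto
  also have "\<dots> = exp x"
    by (simp flip: exp_double)
  finally have "exp (- x) * x\<^sup>2 \<le> 1"
    by (simp add: exp_minus field_simps)
  moreover have "flat (-2) t = exp (- x) * x\<^sup>2"
    using True by (simp add: flat_def x_def power_int_minus field_simps)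
  ultimately show ?thesis by simp
qed simp

lemma flat0_lipschitz: "\<bar>flat 0 a - flat 0 b\<bar> \<le> \<bar>a - b\<bar>"
proof -
  have "norm (flat 0 a - flat 0 b) \<le> 1 * norm (a - b)"
  proof (rule field_differentiable_bound[where S = UNIV])
    show "\<And>z. z \<in> UNIV \<Longrightarrow> (flat 0 has_field_derivative flat (-2) z) (at z within UNIV)"
      using flat_deriv[of 0] by simp
    show "\<And>z. z \<in> UNIV \<Longrightarrow> norm (flat (-2) z) \<le> 1"
      using flat0_deriv_le1 flat_nonneg by simp
  qed auto
  then show ?thesis by simp
qed

text \<open>For small \<open>d\<close> this is a convex \<open>C\<^sup>\<infinity>\<close> approximation from below of the positive part.\<close>

definition ppart :: "real \<Rightarrow> real \<Rightarrow> real" where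
  "ppart d s = d * flat 1 (s / d)"

definition ppart' :: "real \<Rightarrow> real \<Rightarrow> real" where
  "ppart' d s = flat (-1) (s / d) + flat 0 (s / d)"

definition ppart'' :: "real \<Rightarrow> real \<Rightarrow> real" where
  "ppart'' d s = flat (-3) (s / d) / d"

lemma ppart_deriv: 
  assumes "0 < d" shows "(ppart d has_real_derivative ppart' d s) (at s)"
proof -
  have "((\<lambda>s. d * flat 1 (s / d)) has_real_derivative d * ((flat (1 - 2) (s / d) + of_int 1 * flat (1 - 1) (s / d)) * (1 / d))) (at s)"
    by (intro DERIV_cmult DERIV_chain2[OF flat_deriv]) (use assms in \<open>auto intro!: derivative_eq_intros\<close>)
  then show ?thesis
    using assms by (simp add: ppart_def[abs_def] ppart'_def)
qed

text \<open>The two terms in \<open>flat (-2)\<close> cancel and the single nonnegative term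
  \<open>flat (-3)\<close> remains; this is the convexity of \<open>ppart d\<close>.\<close>

lemma ppart'_deriv: 
  assumes "0 < d" shows "(ppart' d has_real_derivative ppart'' d s) (at s)"
proof -
  have "((\<lambda>s. flat (-1) (s / d) + flat 0 (s / d)) has_real_derivative 
     ((flat (-1 - 2) (s / d) + of_int (-1) * flat (-1 - 1) (s / d)) * (1 / d)) +
     ((flat (0 - 2) (s / d) + of_int 0 * flat (0 - 1) (s / d)) * (1 / d))) (at s)"
    by (intro DERIV_add DERIV_chain2[OF flat_deriv]) (use assms in \<open>auto intro!: derivative_eq_intros\<close>)
  then show ?thesis
    using assms by (simp add: ppart'_def[abs_def] ppart''_def diff_divide_distrib)
qed

lemma ppart''_nonneg: "0 < d \<Longrightarrow> 0 \<le> ppart'' d s"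
  by (simp add: ppart''_def flat_nonneg)

lemma ppart'_nonneg: "0 \<le> ppart' d s"
  by (simp add: ppart'_def flat_nonneg)

lemma ppart_nonneg: "0 < d \<Longrightarrow> 0 \<le> ppart d s"
  by (simp add: ppart_def flat_nonneg)

text \<open>A slope in [0, 1] together with convexity preserves the bound -1 from below on the
  Laplacian when a barrier is truncated. With x = d/s the claim is (1 + x) exp (-x) \<le> 1.\<close>

lemma ppart'_le1: "0 < d \<Longrightarrow> ppart' d s \<le> 1"
proof (cases "0 < s")
  case True
  assume d: "0 < d"
  define x where "x = d / s"
  have "1 + x \<le> exp x" by (rule exp_ge_add_one_self)
  then have "exp (- x) * (x + 1) \<le> 1"
    by (simp add: exp_minus field_simps)
  then show ?thesis using True d
    by (simp add: ppart'_def flat_def x_def power_int_minus field_simps)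
qed (simp add: ppart'_def divide_nonpos_pos)

lemma ppart_eq_0 [simp]: "0 < d \<Longrightarrow> s \<le> 0 \<Longrightarrow> ppart d s = 0"
  and ppart'_eq_0 [simp]: "0 < d \<Longrightarrow> s \<le> 0 \<Longrightarrow> ppart' d s = 0"
  and ppart''_eq_0 [simp]: "0 < d \<Longrightarrow> s \<le> 0 \<Longrightarrow> ppart'' d s = 0"
  by (simp_all add: ppart_def ppart'_def ppart''_def divide_nonpos_pos)

lemma ppart_pos_eq: "0 < d \<Longrightarrow> 0 < s \<Longrightarrow> ppart d s = s * exp (- d / s)"
  by (simp add: ppart_def flat_def)

lemma ppart_le: "0 < d \<Longrightarrow> ppart d s \<le> max s 0"
  by (cases "0 < s") (auto simp: ppart_pos_eq)

lemma ppart_tendsto: 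
  "((\<lambda>k. ppart (1 / real (Suc k)) s) \<longlonglongrightarrow> max s 0)"
proof (cases "0 < s")
  case True
  have "(\<lambda>k. s * exp (- (1 / real (Suc k)) / s)) \<longlonglongrightarrow> s * exp (- 0 / s)"
    by (intro tendsto_intros LIMSEQ_inverse_real_of_nat[unfolded inverse_eq_divide]) (use True in auto)
  then show ?thesis using True by (simp add: ppart_pos_eq)
qed simp

lemma continuous_on_ppart [continuous_intros]:
  "continuous_on S f \<Longrightarrow> continuous_on S (\<lambda>x. ppart d (f x))"
  "continuous_on S f \<Longrightarrow> continuous_on S (\<lambda>x. ppart' d (f x))"
  "continuous_on S f \<Longrightarrow> continuous_on S (\<lambda>x. ppart'' d (f x))"
  by (cases "d = 0"; auto simp: ppart_def ppart'_def ppart''_def intro!: continuous_intros)+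

section \<open>Integration by parts\<close>

text \<open>The gradient is an argument so that each closure rule also computes it, instead of
  evaluating \<open>frechet_derivative\<close> anew after every operation.\<close>

definition c1_on :: "'b::euclidean_space set \<Rightarrow> ('b \<Rightarrow> real) \<Rightarrow> ('b \<Rightarrow> 'b) \<Rightarrow> bool" where
  "c1_on U f g \<longleftrightarrow> (\<forall>x\<in>U. (f has_derivative (\<lambda>h. g x \<bullet> h)) (at x)) \<and> continuous_on U g"

lemma c1_onD: "c1_on U f g \<Longrightarrow> x \<in> U \<Longrightarrow> (f has_derivative (\<lambda>h. g x \<bullet> h)) (at x)"
  by (simp add: c1_on_def)

lemma c1_on_continuous: "c1_on U f g \<Longrightarrow> continuous_on U f"
  by (meson c1_on_def continuous_at_imp_continuous_on has_derivative_continuous)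

lemma c1_on_continuous_grad: "c1_on U f g \<Longrightarrow> continuous_on U g"
  by (simp add: c1_on_def)

lemma c1_on_subset: "c1_on U f g \<Longrightarrow> V \<subseteq> U \<Longrightarrow> c1_on V f g"
  unfolding c1_on_def using continuous_on_subset by blast

lemma c1_on_mult:
  assumes "c1_on U f g" "c1_on U f' g'"
  shows "c1_on U (\<lambda>x. f x * f' x) (\<lambda>x. f x *\<^sub>R g' x + f' x *\<^sub>R g x)"
  unfolding c1_on_def
proof (intro conjI ballI)
  fix x assume x: "x \<in> U"
  show "((\<lambda>x. f x * f' x) has_derivative (\<lambda>h. (f x *\<^sub>R g' x + f' x *\<^sub>R g x) \<bullet> h)) (at x)"
    by (rule has_derivative_eq_rhs[OF has_derivative_mult[OF c1_onD[OF assms(1) x] c1_onD[OF assms(2) x]]])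
      (auto simp: inner_add_left)
qed (intro continuous_intros c1_on_continuous[OF assms(1)] c1_on_continuous[OF assms(2)]
      c1_on_continuous_grad[OF assms(1)] c1_on_continuous_grad[OF assms(2)])

lemma c1_on_compose_real:
  assumes "c1_on U f g" "\<And>x. x \<in> U \<Longrightarrow> (\<theta> has_real_derivative \<theta>' (f x)) (at (f x))" 
    "continuous_on (f ` U) \<theta>'"
  shows "c1_on U (\<lambda>x. \<theta> (f x)) (\<lambda>x. \<theta>' (f x) *\<^sub>R g x)"
  unfolding c1_on_def
proof (intro conjI ballI)
  fix x assume x: "x \<in> U"
  have "((\<lambda>x. \<theta> (f x)) has_derivative (\<lambda>h. \<theta>' (f x) * (g x \<bullet> h))) (at x)"
    using has_derivative_compose[OF c1_onD[OF assms(1) x] assms(2)[OF x, unfolded has_field_derivative_def]]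
    by (simp add: mult_ac)
  then show "((\<lambda>x. \<theta> (f x)) has_derivative (\<lambda>h. (\<theta>' (f x) *\<^sub>R g x) \<bullet> h)) (at x)"
    by simp
qed (intro continuous_intros c1_on_continuous_grad[OF assms(1)] 
      continuous_on_compose2[OF assms(3) c1_on_continuous[OF assms(1)]] subset_refl)

lemma c1_on_diff:
  assumes "c1_on U f g" "c1_on U f' g'"
  shows "c1_on U (\<lambda>x. f x - f' x) (\<lambda>x. g x - g' x)"
  using assms unfolding c1_on_def
  by (auto intro!: continuous_intros has_derivative_eq_rhs[OF has_derivative_diff] simp: inner_diff_left)

lemma c1_on_cmult:
  assumes "c1_on U f g"
  shows "c1_on U (\<lambda>x. c * f x) (\<lambda>x. c *\<^sub>R g x)"
  using assms unfolding c1_on_def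
  by (auto intro!: continuous_intros has_derivative_eq_rhs[OF has_derivative_mult_right])

text \<open>The open sets \<open>U\<close> and \<open>\<Omega> - C\<close> cover
  \<open>\<Omega>\<close>, and the extension by zero is C^1 on each. \<open>C\<close> is closed
  relative to \<open>\<Omega>\<close> only, because in the cusp it reaches up to the boundary of
  \<open>\<Omega>\<close>.\<close>

lemma c1_on_glue:
  assumes f: "c1_on U f g" and U: "open U" "U \<subseteq> \<Omega>" and C: "open (\<Omega> - C)" "C \<subseteq> U"
    and z: "\<And>x. x \<in> U - C \<Longrightarrow> f x = 0 \<and> g x = 0"
  shows "c1_on \<Omega> (\<lambda>x. if x \<in> U then f x else 0) (\<lambda>x. if x \<in> U then g x else 0)"
proof -
  let ?f = "\<lambda>x. if x \<in> U then f x else 0" and ?g = "\<lambda>x. if x \<in> U then g x else 0"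
  have 0: "(?f has_derivative (\<lambda>h. 0)) (at x)" if "x \<in> \<Omega> - C" for x
    by (rule has_derivative_transform_within_open[OF _ C(1) that, of "\<lambda>_. 0"]) (use z in auto)
  have 1: "(?f has_derivative (\<lambda>h. g x \<bullet> h)) (at x)" if "x \<in> U" for x
    by (rule has_derivative_transform_within_open[OF c1_onD[OF f that] U(1) that]) auto
  show ?thesis unfolding c1_on_def
  proof (intro conjI ballI)
    fix x assume "x \<in> \<Omega>" 
    then show "(?f has_derivative (\<lambda>h. ?g x \<bullet> h)) (at x)"
      using 1[of x] 0[of x] C by (cases "x \<in> U") auto
  next
    have "continuous_on (U \<union> (\<Omega> - C)) ?g"
    proof (rule continuous_on_open_Un[OF U(1) C(1)])
      show "continuous_on U ?g"
        using c1_on_continuous_grad[OF f] by (rule continuous_on_eq) auto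
      show "continuous_on (\<Omega> - C) ?g"
        by (rule continuous_on_eq[of _ "\<lambda>_. 0"]) (use z in auto)
    qed
    moreover have "U \<union> (\<Omega> - C) = \<Omega>" using U C by auto
    ultimately show "continuous_on \<Omega> ?g" by simp
  qed
qed

lemma c1_on_grad_zero:
  assumes f: "c1_on U f g" and V: "open V" "V \<subseteq> U" and z: "\<And>x. x \<in> V \<Longrightarrow> f x = 0" and x: "x \<in> V"
  shows "g x = 0"
proof -
  have "(f has_derivative (\<lambda>h. 0)) (at x)"
    by (rule has_derivative_transform_within_open[OF _ V(1) x, of "\<lambda>_. 0"]) (use z in auto)
  then have "(\<lambda>h. g x \<bullet> h) = (\<lambda>h. 0)"
    using has_derivative_unique c1_onD[OF f] V(2) x by blast
  then show ?thesis by (metis inner_eq_zero_iff)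
qed

lemma c1_on_extend_zero:
  assumes f: "c1_on U f g" and U: "open U" and K: "closed K" "K \<subseteq> U"
    and z: "\<And>x. x \<in> U - K \<Longrightarrow> f x = 0"
  shows "c1_on UNIV (\<lambda>x. if x \<in> U then f x else 0) (\<lambda>x. if x \<in> U then g x else 0)"
proof (rule c1_on_glue[OF f U subset_UNIV _ K(2)])
  show "f x = 0 \<and> g x = 0" if "x \<in> U - K" for x
    using z[OF that] c1_on_grad_zero[OF f open_Diff[OF U K(1)] Diff_subset z that] by simp
qed (use open_Diff[OF open_UNIV K(1)] in simp)

lemma c1_on_UNIV_grad_zero:
  "c1_on UNIV f g \<Longrightarrow> closed K \<Longrightarrow> (\<And>x. x \<notin> K \<Longrightarrow> f x = 0) \<Longrightarrow> x \<notin> K \<Longrightarrow> g x = 0"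
  by (rule c1_on_grad_zero[of UNIV f g "- K"]) auto

section \<open>Vanishing integrals of derivatives and the Poincare inequality\<close>

lemma integrable_continuous_compact_support:
  fixes f :: "'b::euclidean_space \<Rightarrow> 'c::euclidean_space"
  assumes "continuous_on UNIV f" "compact K" "\<And>x. x \<notin> K \<Longrightarrow> f x = 0"
  shows "integrable lborel f"
proof -
  have "integrable lborel (\<lambda>x. indicator K x *\<^sub>R f x)"
    using assms by (intro borel_integrable_compact) (auto intro: continuous_on_subset)
  also have "(\<lambda>x. indicator K x *\<^sub>R f x) = f"
    using assms(3) by (auto simp: indicator_def)
  finally show ?thesis .
qed

text \<open>Difference quotients of \<open>f\<close> integrate to zero by translation invariance.\<close>

lemma integral_directional_derivative_zero:
  fixes f :: "'b::euclidean_space \<Rightarrow> real"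
  assumes f: "c1_on UNIV f g" and K: "compact K" and z: "\<And>x. x \<notin> K \<Longrightarrow> f x = 0"
  shows "(\<integral>x. g x \<bullet> b \<partial>lborel) = 0"
proof -
  have cf: "continuous_on UNIV f" by (rule c1_on_continuous[OF f])
  have cg: "continuous_on UNIV g" by (rule c1_on_continuous_grad[OF f])
  have gz: "g x = 0" if "x \<notin> K" for x
    using c1_on_UNIV_grad_zero[OF f compact_imp_closed[OF K] z that] .
  obtain R where R: "\<And>x. x \<in> K \<Longrightarrow> norm x \<le> R"
    using compact_imp_bounded[OF K] by (auto simp: bounded_iff)
  obtain M where M: "M \<ge> 0" "\<And>x. norm (g x) \<le> M"
  proof -
    have "compact (g ` K)" using K cg by (intro compact_continuous_image) (auto intro: continuous_on_subset)
    then obtain M where M: "\<And>x. x \<in> K \<Longrightarrow> norm (g x) \<le> M"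
      using compact_imp_bounded by (force simp: bounded_iff)
    show ?thesis
      by (rule that[of "\<bar>M\<bar>"]) (use M gz in \<open>auto, metis abs_ge_self norm_zero abs_ge_zero order_trans\<close>)
  qed
  have lip: "\<bar>f y - f x\<bar> \<le> M * norm (y - x)" for x y
  proof -
    have "norm (f y - f x) \<le> M * norm (y - x)"
    proof (rule differentiable_bound[where S = UNIV])
      show "\<And>x. x \<in> UNIV \<Longrightarrow> (f has_derivative (\<lambda>h. g x \<bullet> h)) (at x within UNIV)"
        using c1_onD[OF f] by simp
      show "\<And>x. x \<in> UNIV \<Longrightarrow> onorm (\<lambda>h. g x \<bullet> h) \<le> M"
        by (rule onorm_le) (metis Cauchy_Schwarz_ineq2 M(2) mult_right_mono norm_ge_zero order_trans real_norm_def)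
    qed auto
    then show ?thesis by simp
  qed
  define s where "s k x = (f (x + (1 / real (Suc k)) *\<^sub>R b) - f x) * real (Suc k)" for k x
  have int_f: "integrable lborel f"
    by (rule integrable_continuous_compact_support[OF cf K z])
  have bf: "f \<in> borel_measurable borel"
    by (rule borel_measurable_continuous_onI[OF cf])
  have s0: "(\<integral>x. s k x \<partial>lborel) = 0" for k
  proof -
    let ?c = "(1 / real (Suc k)) *\<^sub>R b"
    have eq: "(\<integral>x. f (x + ?c) \<partial>lborel) = (\<integral>x. f x \<partial>lborel)"
      using integral_distr[of "(+) ?c" lborel borel f] lborel_distr_plus[of ?c] bf
      by (simp add: add.commute)
    have "integrable lborel (\<lambda>x. f (x + ?c))"
      using integrable_distr_eq[of "(+) ?c" lborel borel f] lborel_distr_plus[of ?c] bf int_f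
      by (simp add: add.commute)
    then show ?thesis
      unfolding s_def using int_f eq by simp
  qed
  \<comment> \<open>The Lipschitz bound controls the quotients by \<open>M * norm b\<close>, and
    shifts of length at most \<open>norm b\<close> keep all supports in one ball; this gives the
    dominating function.\<close>
  have "(\<lambda>k. \<integral>x. s k x \<partial>lborel) \<longlonglongrightarrow> (\<integral>x. g x \<bullet> b \<partial>lborel)"
  proof (rule integral_dominated_convergence[where w = "\<lambda>x. indicator (cball 0 (R + norm b)) x *\<^sub>R (M * norm b)"])
    show "(\<lambda>x. g x \<bullet> b) \<in> borel_measurable lborel"
      by (simp, intro borel_measurable_continuous_onI continuous_intros cg)
    show "s k \<in> borel_measurable lborel" for k
      unfolding s_def using bf by measurable
    show "integrable lborel (\<lambda>x. indicator (cball 0 (R + norm b)) x *\<^sub>R (M * norm b))"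
      by (rule borel_integrable_compact) auto
    show "AE x in lborel. (\<lambda>k. s k x) \<longlonglongrightarrow> g x \<bullet> b"
    proof (rule AE_I2)
      fix x
      have "((\<lambda>t. f (x + t *\<^sub>R b)) has_derivative (\<lambda>t. g (x + 0 *\<^sub>R b) \<bullet> (t *\<^sub>R b))) (at 0)"
        by (rule has_derivative_compose[where f = "\<lambda>t. x + t *\<^sub>R b" and g = f])
          (auto intro!: derivative_eq_intros c1_onD[OF f])
      then have "((\<lambda>t. f (x + t *\<^sub>R b)) has_real_derivative (g x \<bullet> b)) (at 0)"
        by (simp add: has_field_derivative_def mult_commute_abs)
      then have *: "((\<lambda>t. (f (x + t *\<^sub>R b) - f x) / t) \<longlongrightarrow> g x \<bullet> b) (at 0)"
        by (simp add: has_field_derivative_iff)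
      have "filterlim (\<lambda>k. 1 / real (Suc k)) (at 0) sequentially"
        unfolding filterlim_at using LIMSEQ_inverse_real_of_nat by (auto simp: inverse_eq_divide)
      from filterlim_compose[OF * this] show "(\<lambda>k. s k x) \<longlonglongrightarrow> g x \<bullet> b"
        by (simp add: s_def)
    qed
    show "AE x in lborel. norm (s k x) \<le> indicator (cball 0 (R + norm b)) x *\<^sub>R (M * norm b)" for k
    proof (rule AE_I2)
      fix x
      let ?c = "(1 / real (Suc k)) *\<^sub>R b"
      have nc: "norm ?c = norm b / real (Suc k)" by simp
      have cb: "norm ?c \<le> norm b" unfolding nc
        using mult_left_mono[of 1 "real (Suc k)" "norm b"] by (simp add: divide_le_eq)
      show "norm (s k x) \<le> indicator (cball 0 (R + norm b)) x *\<^sub>R (M * norm b)"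
      proof (cases "x \<in> cball 0 (R + norm b)")
        case True
        have "\<bar>f (x + ?c) - f x\<bar> \<le> M * norm ?c" using lip[of "x + ?c" x] by simp
        then have "\<bar>f (x + ?c) - f x\<bar> * real (Suc k) \<le> M * norm ?c * real (Suc k)"
          by (rule mult_right_mono) simp
        also have "\<dots> = M * norm b" unfolding nc by simp
        finally show ?thesis using True by (simp add: s_def abs_mult)
      next
        case False
        then have "x \<notin> K" using R[of x] norm_ge_zero[of b] by (auto simp del: norm_ge_zero)
        moreover have "x + ?c \<notin> K"
        proof
          assume "x + ?c \<in> K"
          then have "norm (x + ?c) \<le> R" by (rule R)
          moreover have "norm x \<le> norm (x + ?c) + norm ?c"
            by (metis add_diff_cancel norm_triangle_ineq4)
          ultimately show False using False cb by auto
        qed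
        ultimately show ?thesis using z False by (simp add: s_def)
      qed
    qed
  qed
  then show ?thesis
    unfolding s0 by (simp add: LIMSEQ_const_iff)
qed

text \<open>The derivative of (x \<bullet> b) f^2 in a single coordinate direction b integrates to
  zero, so \<integral> f^2 = - 2 \<integral> (x \<bullet> b) f (g \<bullet> b). Since |x \<bullet>
  b| \<le> R on the support, Young's inequality bounds the right side by half of the left side plus
  2 R^2 \<integral> |g|^2, whence the constant 4 R^2.\<close>

lemma poincare_c1:
  fixes f :: "'b::euclidean_space \<Rightarrow> real"
  assumes f: "c1_on UNIV f g" and K: "compact K" "\<And>x. x \<in> K \<Longrightarrow> norm x \<le> R" 
    and z: "\<And>x. x \<notin> K \<Longrightarrow> f x = 0"
  shows "(\<integral>x. (f x)\<^sup>2 \<partial>lborel) \<le> 4 * R\<^sup>2 * (\<integral>x. (norm (g x))\<^sup>2 \<partial>lborel)"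
proof -
  obtain b :: 'b where b: "b \<in> Basis" using nonempty_Basis by blast
  have cf: "continuous_on UNIV f" by (rule c1_on_continuous[OF f])
  have cg: "continuous_on UNIV g" by (rule c1_on_continuous_grad[OF f])
  have gz: "g x = 0" if "x \<notin> K" for x
    using c1_on_UNIV_grad_zero[OF f compact_imp_closed[OF K(1)] z that] .
  have c1x: "c1_on UNIV (\<lambda>x. x \<bullet> b) (\<lambda>_. b)"
    by (auto simp: c1_on_def inner_commute intro!: derivative_eq_intros)
  note F = c1_on_mult[OF c1x c1_on_mult[OF f f]]
  have "0 = (\<integral>x. ((x \<bullet> b) *\<^sub>R (f x *\<^sub>R g x + f x *\<^sub>R g x) + (f x * f x) *\<^sub>R b) \<bullet> b \<partial>lborel)"
    by (rule integral_directional_derivative_zero[OF F K(1), symmetric]) (simp add: z)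
  also have "\<dots> = (\<integral>x. (f x)\<^sup>2 + 2 * (x \<bullet> b) * f x * (g x \<bullet> b) \<partial>lborel)"
    using b by (intro Bochner_Integration.integral_cong) (auto simp: inner_add_left power2_eq_square algebra_simps)
  also have "\<dots> = (\<integral>x. (f x)\<^sup>2 \<partial>lborel) + (\<integral>x. 2 * (x \<bullet> b) * f x * (g x \<bullet> b) \<partial>lborel)"
    by (intro Bochner_Integration.integral_add integrable_continuous_compact_support[OF _ K(1)] continuous_intros cf cg) (auto simp: z)
  finally have 1: "(\<integral>x. (f x)\<^sup>2 \<partial>lborel) = - (\<integral>x. 2 * (x \<bullet> b) * f x * (g x \<bullet> b) \<partial>lborel)" by simp
  also have "\<dots> = (\<integral>x. - (2 * (x \<bullet> b) * f x * (g x \<bullet> b)) \<partial>lborel)" by simp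
  also have "\<dots> \<le> (\<integral>x. (f x)\<^sup>2 / 2 + 2 * R\<^sup>2 * (norm (g x))\<^sup>2 \<partial>lborel)"
  proof (rule integral_mono)
    fix x
    show "- (2 * (x \<bullet> b) * f x * (g x \<bullet> b)) \<le> (f x)\<^sup>2 / 2 + 2 * R\<^sup>2 * (norm (g x))\<^sup>2"
    proof (cases "x \<in> K")
      case True
      have "\<bar>x \<bullet> b\<bar> \<le> R" using K(2)[OF True] Basis_le_norm[OF b, of x] by linarith
      moreover have "\<bar>g x \<bullet> b\<bar> \<le> norm (g x)" by (rule Basis_le_norm[OF b])
      ultimately have "\<bar>x \<bullet> b\<bar> * \<bar>g x \<bullet> b\<bar> \<le> R * norm (g x)"
        by (intro mult_mono) auto
      then have "((x \<bullet> b) * (g x \<bullet> b))\<^sup>2 \<le> (R * norm (g x))\<^sup>2"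
        by (metis abs_ge_zero abs_mult power2_abs power_mono)
      moreover have "0 \<le> (f x / 2 + (x \<bullet> b) * (g x \<bullet> b))\<^sup>2" by simp
      ultimately show ?thesis by (simp add: power2_sum power_mult_distrib field_simps)
    qed (simp add: z gz)
  qed (intro integrable_continuous_compact_support[OF _ K(1)] continuous_intros cf cg; auto simp: z gz)+
  also have "\<dots> = (\<integral>x. (f x)\<^sup>2 \<partial>lborel) / 2 + 2 * R\<^sup>2 * (\<integral>x. (norm (g x))\<^sup>2 \<partial>lborel)"
  proof -
    have "integrable lborel (\<lambda>x. (f x)\<^sup>2)" "integrable lborel (\<lambda>x. (norm (g x))\<^sup>2)"
      by (intro integrable_continuous_compact_support[OF _ K(1)] continuous_intros cf cg; auto simp: z gz)+
    then show ?thesis by simp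
  qed
  finally show ?thesis by simp
qed

section \<open>Mollification\<close>

lemma partial_eq: "(f has_derivative D) (at x) \<Longrightarrow> partial b f x = D b"
  by (drule frechet_derivative_at) (simp add: partial_def)

lemma Ck_on_differentiable: "Ck_on (Suc k) S f \<Longrightarrow> open S \<Longrightarrow> x \<in> S \<Longrightarrow> f differentiable (at x)"
  by (auto simp: differentiable_on_def) (metis at_within_open)

lemma Ck_on_frechet: "Ck_on (Suc k) S f \<Longrightarrow> open S \<Longrightarrow> x \<in> S \<Longrightarrow> 
    (f has_derivative frechet_derivative f (at x)) (at x)"
  using Ck_on_differentiable frechet_derivative_works by blast

lemma has_derivative_gradient:
  assumes "f differentiable (at x)" shows "(f has_derivative (\<lambda>h. gradient f x \<bullet> h)) (at x)"
proof -
  let ?D = "frechet_derivative f (at x)"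
  have D: "(f has_derivative ?D) (at x)"
    using assms frechet_derivative_works by blast
  have "?D h = gradient f x \<bullet> h" for h
  proof -
    interpret D: linear ?D using D by (rule has_derivative_linear)
    have "?D h = ?D (\<Sum>b\<in>Basis. (h \<bullet> b) *\<^sub>R b)" by (simp add: euclidean_representation)
    also have "\<dots> = (\<Sum>b\<in>Basis. (h \<bullet> b) * ?D b)" by (simp add: D.sum D.scale)
    also have "\<dots> = gradient f x \<bullet> h"
      by (simp add: gradient_def partial_def inner_sum_left inner_commute[of h] mult.commute)
    finally show ?thesis .
  qed
  then have "?D = (\<lambda>h. gradient f x \<bullet> h)" by blast
  with D show ?thesis by simp
qed

lemma Ck_on_le: "Ck_on (Suc k) S f \<Longrightarrow> Ck_on k S f"
  by (induction k arbitrary: f) (auto intro: differentiable_imp_continuous_on)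

lemma Ck_on_1_c1:
  assumes "Ck_on (Suc 0) S f" "open S" shows "c1_on S f (gradient f)"
  unfolding c1_on_def
proof (intro conjI ballI)
  fix x assume "x \<in> S"
  then show "(f has_derivative (\<lambda>h. gradient f x \<bullet> h)) (at x)"
    using Ck_on_differentiable[OF assms] has_derivative_gradient by blast
next
  show "continuous_on S (gradient f)"
    using assms unfolding gradient_def[abs_def] by (auto intro!: continuous_intros)
qed

lemma gradient_eq: "(f has_derivative (\<lambda>h. v \<bullet> h)) (at x) \<Longrightarrow> gradient f x = v"
  by (simp add: gradient_def partial_eq euclidean_representation)

lemma Ck_on_const [simp]: "Ck_on k UNIV (\<lambda>_. c)"
proof (induction k arbitrary: c)
  case (Suc k)
  have "partial b (\<lambda>_. c) = (\<lambda>_. 0)" for b :: 'a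
    by (intro ext) (auto intro!: partial_eq[where D = "\<lambda>_. 0"])
  with Suc show ?case by simp
qed simp

lemma Ck_on_inner [simp]: "Ck_on k UNIV (\<lambda>x. x \<bullet> b)"
proof (cases k)
  case (Suc k)
  have "partial i (\<lambda>x. x \<bullet> b) = (\<lambda>_. i \<bullet> b)" for i :: 'a
    by (intro ext partial_eq[where D = "\<lambda>h. h \<bullet> b"]) (auto intro!: derivative_eq_intros)
  then show ?thesis by (auto simp: Suc differentiable_on_def intro!: derivative_intros)
qed (auto intro!: continuous_intros)

lemma Ck_on_UNIV_cong: "(\<And>x. f x = g x) \<Longrightarrow> Ck_on k UNIV f = Ck_on k UNIV g"
  by (metis ext)

lemma Ck_on_add:
  "Ck_on k UNIV f \<Longrightarrow> Ck_on k UNIV g \<Longrightarrow> Ck_on k UNIV (\<lambda>x. f x + g x)"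
proof (induction k arbitrary: f g)
  case (Suc k)
  have "partial b (\<lambda>x. f x + g x) = (\<lambda>x. partial b f x + partial b g x)" for b
    unfolding partial_def
    by (intro ext partial_eq[unfolded partial_def] has_derivative_add
          Ck_on_frechet[OF Suc.prems(1)] Ck_on_frechet[OF Suc.prems(2)]) auto
  with Suc show ?case by (auto intro: differentiable_on_add)
qed (auto intro: continuous_intros)

lemma Ck_on_mult:
  "Ck_on k UNIV f \<Longrightarrow> Ck_on k UNIV g \<Longrightarrow> Ck_on k UNIV (\<lambda>x. f x * g x)"
proof (induction k arbitrary: f g)
  case (Suc k)
  have "partial b (\<lambda>x. f x * g x) = (\<lambda>x. f x * partial b g x + partial b f x * g x)" for b
    unfolding partial_def
    by (intro ext partial_eq[unfolded partial_def] has_derivative_mult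
          Ck_on_frechet[OF Suc.prems(1)] Ck_on_frechet[OF Suc.prems(2)]) auto
  moreover have "Ck_on k UNIV f" "Ck_on k UNIV g"
    using Suc.prems by (auto intro: Ck_on_le)
  ultimately show ?case using Suc by (auto intro!: Ck_on_add intro: differentiable_on_mult)
qed (auto intro: continuous_intros)

lemma Ck_on_sum:
  "finite I \<Longrightarrow> (\<And>i. i \<in> I \<Longrightarrow> Ck_on k UNIV (f i)) \<Longrightarrow> Ck_on k UNIV (\<lambda>x. \<Sum>i\<in>I. f i x)"
  by (induction I rule: finite_induct) (auto intro: Ck_on_add)

text \<open>The exponent varies in the induction, since a derivative replaces \<open>flat m\<close>
  by \<open>flat (m - 2)\<close> and \<open>flat (m - 1)\<close>.\<close>

lemma Ck_on_flat:
  "Ck_on k UNIV q \<Longrightarrow> Ck_on k UNIV (\<lambda>x. flat m (q x))"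
proof (induction k arbitrary: m)
  case (Suc k)
  have D: "((\<lambda>x. flat m (q x)) has_derivative 
      (\<lambda>h. (flat (m - 2) (q x) + of_int m * flat (m - 1) (q x)) * frechet_derivative q (at x) h)) (at x)" for x
    using has_derivative_compose[OF Ck_on_frechet[OF Suc.prems] flat_deriv[of m, unfolded has_field_derivative_def]]
    by simp
  have "partial b (\<lambda>x. flat m (q x)) = 
      (\<lambda>x. (flat (m - 2) (q x) + of_int m * flat (m - 1) (q x)) * partial b q x)" for b
    using partial_eq[OF D] by (simp add: fun_eq_iff partial_def[of b q])
  moreover have "Ck_on k UNIV q" using Suc.prems by (rule Ck_on_le)
  ultimately show ?case using Suc
    by (auto intro!: Ck_on_mult Ck_on_add differentiableI[OF D] simp: differentiable_on_def)
qed (auto intro: continuous_intros)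

section \<open>Smooth kernels and convolution\<close>

definition bump :: "real \<Rightarrow> 'b::euclidean_space \<Rightarrow> real" where
  "bump r x = flat 0 (r\<^sup>2 - x \<bullet> x)"

text \<open>The kernel depends on \<open>x \<bullet> x\<close> and not on the norm, hence on a
  polynomial in the coordinates, and is smooth at the origin too.\<close>

lemma Ck_on_bump: "Ck_on k UNIV (bump r)"
proof -
  have "Ck_on k UNIV (\<lambda>x :: 'a. (r\<^sup>2 + (- 1) * (\<Sum>b\<in>Basis. (x \<bullet> b) * (x \<bullet> b))))"
    by (intro Ck_on_add Ck_on_mult Ck_on_sum) auto
  also have "?this \<longleftrightarrow> Ck_on k UNIV (\<lambda>x :: 'a. r\<^sup>2 - x \<bullet> x)"
    by (rule Ck_on_UNIV_cong) (simp add: euclidean_inner[symmetric])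
  finally show ?thesis
    unfolding bump_def[abs_def] by (rule Ck_on_flat)
qed

lemma bump_nonneg: "0 \<le> bump r x" by (simp add: bump_def flat_nonneg)

lemma bump_eq_0: "0 < r \<Longrightarrow> r \<le> norm x \<Longrightarrow> bump r x = 0"
  by (simp add: bump_def power_mono flip: power2_norm_eq_inner)

lemma continuous_on_bump [continuous_intros]: 
  "continuous_on S f \<Longrightarrow> continuous_on S (\<lambda>x. bump r (f x))"
  unfolding bump_def by (intro continuous_intros)

lemma integrable_bump: "0 < r \<Longrightarrow> integrable lborel (bump r :: 'b::euclidean_space \<Rightarrow> real)"
  by (rule integrable_continuous_compact_support[of _ "cball 0 r"])
    (auto intro!: continuous_intros bump_eq_0)

lemma integral_bump_pos:
  assumes "0 < r" shows "0 < (\<integral>x. bump r x \<partial>(lborel :: 'b::euclidean_space measure))"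
proof -
  have "0 \<le> (\<integral>x. bump r (x::'b) \<partial>lborel)" by (simp add: bump_nonneg)
  moreover have "(\<integral>x. bump r (x::'b) \<partial>lborel) \<noteq> 0"
  proof
    assume "(\<integral>x. bump r (x::'b) \<partial>lborel) = 0"
    then have "AE x in lborel. bump r (x::'b) = 0"
      using integral_nonneg_eq_0_iff_AE[OF integrable_bump[where 'b = 'b, OF assms]] by (simp add: bump_nonneg)
    then have "AE x in lborel. x \<notin> ball (0::'b) r"
    proof (rule AE_mp, intro AE_I2 impI)
      fix x :: 'b assume "bump r x = 0"
      have "\<not> norm x < r"
      proof
        assume "norm x < r"
        then have "x \<bullet> x < r\<^sup>2" by (metis norm_ge_zero power2_norm_eq_inner power_strict_mono zero_less_numeral)
        then have "0 < bump r x" by (simp add: bump_def flat_pos)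
        with \<open>bump r x = 0\<close> show False by simp
      qed
      then show "x \<notin> ball 0 r" by simp
    qed
    then have "emeasure lborel (ball (0::'b) r) = 0"
      by (subst (asm) AE_iff_measurable[where N = "ball 0 r"]) auto
    moreover have "measure lborel (ball (0::'b) r) > 0" using assms by (rule content_ball_pos)
    ultimately show False by (simp add: measure_def)
  qed
  ultimately show ?thesis by linarith
qed

lemma integral_bump_shift: "(\<integral>y. bump r (x - y) \<partial>(lborel :: 'b::euclidean_space measure)) = (\<integral>y. bump r y \<partial>(lborel :: 'b measure))"
proof -
  have [measurable]: "(bump r :: 'b \<Rightarrow> real) \<in> borel_measurable borel"
    by (intro borel_measurable_continuous_onI continuous_intros)
  have "(\<integral>y. bump r (y::'b) \<partial>lborel) = (\<integral>y. bump r (y::'b) \<partial>distr lborel borel ((+) (- x)))"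
    by (simp only: lborel_distr_plus)
  also have "\<dots> = (\<integral>y. bump r (- x + y) \<partial>lborel)"
    by (subst integral_distr) auto
  also have "\<dots> = (\<integral>y. bump r (x - y) \<partial>lborel)"
    by (intro Bochner_Integration.integral_cong) (auto simp: bump_def inner_diff_left inner_diff_right inner_add_left inner_add_right inner_commute algebra_simps)
  finally show ?thesis by simp
qed

text \<open>Uniform continuity on a ball of radius R + 1 suffices: for points closer than 1, either
  both lie in that ball or both values are zero.\<close>

lemma uniformly_continuous_compact_support:
  fixes f :: "'b::euclidean_space \<Rightarrow> 'c::euclidean_space"
  assumes f: "continuous_on UNIV f" and K: "compact K" "\<And>x. x \<notin> K \<Longrightarrow> f x = 0" and e: "0 < e"
  obtains d where "0 < d" "\<And>x y. norm (x - y) < d \<Longrightarrow> norm (f x - f y) \<le> e"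
proof -
  obtain R where R: "\<And>x. x \<in> K \<Longrightarrow> norm x \<le> R"
    using compact_imp_bounded[OF K(1)] by (auto simp: bounded_iff)
  have "uniformly_continuous_on (cball 0 (R + 1)) f"
    by (rule compact_uniformly_continuous) (use f in \<open>auto intro: continuous_on_subset\<close>)
  then obtain d where d: "0 < d" "\<And>x y. x \<in> cball 0 (R + 1) \<Longrightarrow> y \<in> cball 0 (R + 1) \<Longrightarrow> dist y x < d \<Longrightarrow> dist (f y) (f x) < e"
    unfolding uniformly_continuous_on_def using e by metis
  show ?thesis
  proof (rule that[of "min d 1"])
    fix x y :: 'b assume xy: "norm (x - y) < min d 1"
    show "norm (f x - f y) \<le> e"
    proof (cases "x \<in> K \<or> y \<in> K")
      case True
      have "norm x \<le> norm y + norm (x - y)" by (metis add.commute diff_add_cancel norm_triangle_ineq)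
      moreover have "norm y \<le> norm x + norm (x - y)" by (metis norm_minus_commute add.commute diff_add_cancel norm_triangle_ineq)
      ultimately have "norm x \<le> R + 1" "norm y \<le> R + 1"
        using True R[of x] R[of y] xy by auto
      then show ?thesis using d(2)[of y x] xy by (simp add: dist_norm)
    next
      case False
      then show ?thesis using K(2)[of x] K(2)[of y] e by simp
    qed
  qed (use d in auto)
qed

text \<open>The error is an average of \<open>f y - f x\<close> over points closer than
  \<open>r\<close> to \<open>x\<close>. Values are vectors because the estimate serves a function
  and its gradient alike.\<close>

lemma mollify_approx:
  fixes f :: "'b::euclidean_space \<Rightarrow> 'c::euclidean_space"
  assumes f: "continuous_on UNIV f" and r: "0 < r"
    and e: "\<And>y. norm (y - x) < r \<Longrightarrow> norm (f y - f x) \<le> e"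
  shows "norm ((\<integral>y. bump r (x - y) *\<^sub>R f y \<partial>lborel) /\<^sub>R (\<integral>y. bump r y \<partial>(lborel :: 'b measure)) - f x) \<le> e"
proof -
  let ?N = "\<integral>y. bump r y \<partial>(lborel :: 'b measure)"
  have N: "0 < ?N" by (rule integral_bump_pos[OF r])
  have z: "bump r (x - y) = 0" if "y \<notin> cball x r" for y
    using that by (intro bump_eq_0 r) (auto simp: dist_norm)
  have i1: "integrable lborel (\<lambda>y. bump r (x - y) *\<^sub>R f y)"
    by (rule integrable_continuous_compact_support[of _ "cball x r"])
      (auto intro!: continuous_intros f simp del: mem_cball simp: z)
  have i2: "integrable lborel (\<lambda>y. bump r (x - y) *\<^sub>R f x)"
    by (rule integrable_continuous_compact_support[of _ "cball x r"])
      (auto intro!: continuous_intros simp del: mem_cball simp: z)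
  have i3: "integrable lborel (\<lambda>y. bump r (x - y))"
    by (rule integrable_continuous_compact_support[of _ "cball x r"])
      (auto intro!: continuous_intros simp del: mem_cball simp: z)
  have e0: "0 \<le> e" using e[of x] r by simp
  have "(\<integral>y. bump r (x - y) *\<^sub>R f y \<partial>lborel) - ?N *\<^sub>R f x = (\<integral>y. bump r (x - y) *\<^sub>R (f y - f x) \<partial>lborel)"
    using i1 i2 i3 by (simp add: scaleR_diff_right integral_bump_shift)
  also have "norm \<dots> \<le> (\<integral>y. norm (bump r (x - y) *\<^sub>R (f y - f x)) \<partial>lborel)"
    by (rule integral_norm_bound)
  also have "\<dots> \<le> (\<integral>y. bump r (x - y) * e \<partial>lborel)"
  proof (rule integral_mono)
    show "integrable lborel (\<lambda>y. norm (bump r (x - y) *\<^sub>R (f y - f x)))"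
      using i1 i2 by (auto simp: scaleR_diff_right)
    show "integrable lborel (\<lambda>y. bump r (x - y) * e)" using i3 by simp
    fix y
    show "norm (bump r (x - y) *\<^sub>R (f y - f x)) \<le> bump r (x - y) * e"
    proof (cases "norm (y - x) < r")
      case True
      then show ?thesis using e[OF True] by (auto simp: bump_nonneg intro: mult_left_mono)
    next
      case False
      then have "bump r (x - y) = 0" by (intro bump_eq_0 r) (simp add: norm_minus_commute)
      then show ?thesis by simp
    qed
  qed
  also have "\<dots> = ?N * e" by (simp add: integral_bump_shift)
  finally have le: "norm ((\<integral>y. bump r (x - y) *\<^sub>R f y \<partial>lborel) - ?N *\<^sub>R f x) \<le> ?N * e" .
  have "(\<integral>y. bump r (x - y) *\<^sub>R f y \<partial>lborel) /\<^sub>R ?N - f x = ((\<integral>y. bump r (x - y) *\<^sub>R f y \<partial>lborel) - ?N *\<^sub>R f x) /\<^sub>R ?N"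
    using N by (simp add: scaleR_diff_right)
  then have "norm ((\<integral>y. bump r (x - y) *\<^sub>R f y \<partial>lborel) /\<^sub>R ?N - f x) = norm ((\<integral>y. bump r (x - y) *\<^sub>R f y \<partial>lborel) - ?N *\<^sub>R f x) / ?N"
    using N by (simp add: divide_inverse mult.commute)
  also have "\<dots> \<le> e" using le N by (simp add: divide_le_eq mult.commute)
  finally show ?thesis .
qed

definition conv :: "('b::euclidean_space \<Rightarrow> real) \<Rightarrow> ('b \<Rightarrow> real) \<Rightarrow> 'b \<Rightarrow> real" where
  "conv f k x = (\<integral>y. f y * k (x - y) \<partial>lborel)"

text \<open>The derivative falls on the kernel, so continuity of \<open>f\<close> is enough. Compact
  support confines the integral to a fixed box, where differentiation under the integral sign
  applies.\<close>

lemma conv_has_derivative: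
  assumes f: "continuous_on UNIV f" and K: "compact K" "\<And>x. x \<notin> K \<Longrightarrow> f x = 0" and k: "c1_on UNIV k k'"
  obtains D where "(conv f k has_derivative D) (at x)" "\<And>b. D b = conv f (\<lambda>z. k' z \<bullet> b) x"
proof -
  obtain c where c: "K \<subseteq> cbox (- c) c"
    using bounded_subset_cbox_symmetric[OF compact_imp_bounded[OF K(1)]] by blast
  have ck: "continuous_on UNIV k" by (rule c1_on_continuous[OF k])
  have ck': "continuous_on UNIV k'" by (rule c1_on_continuous_grad[OF k])
  have eq: "conv f \<kappa> x = integral (cbox (- c) c) (\<lambda>y. f y * \<kappa> (x - y))" 
    if \<kappa>: "continuous_on UNIV \<kappa>" for \<kappa> x
  proof -
    have "continuous_on UNIV (\<lambda>y. f y * \<kappa> (x - y))"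
      by (intro continuous_intros f continuous_on_compose2[OF \<kappa>]) auto
    then have "integrable lborel (\<lambda>y. f y * \<kappa> (x - y))"
      by (rule integrable_continuous_compact_support[OF _ K(1)]) (simp add: K(2))
    then have "conv f \<kappa> x = integral UNIV (\<lambda>y. f y * \<kappa> (x - y))"
      unfolding conv_def by (rule integral_lborel[symmetric])
    also have "(\<lambda>y. f y * \<kappa> (x - y)) = (\<lambda>y. if y \<in> cbox (- c) c then f y * \<kappa> (x - y) else 0)"
      using c K(2) by (auto simp: fun_eq_iff)
    also have "integral UNIV \<dots> = integral (cbox (- c) c) (\<lambda>y. f y * \<kappa> (x - y))"
      by (rule integral_restrict_UNIV)
    finally show ?thesis .
  qed
  let ?B = "\<lambda>x y. f y *\<^sub>R blinfun_inner_right (k' (x - y))"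
  have D: "((\<lambda>x. integral (cbox (- c) c) (\<lambda>y. f y * k (x - y))) has_derivative 
      integral (cbox (- c) c) (?B x)) (at x within UNIV)"
  proof (rule leibniz_rule)
    fix x t
    have "((\<lambda>x. k (x - t)) has_derivative (\<lambda>h. k' (x - t) \<bullet> h)) (at x)"
      by (rule has_derivative_compose[where g = k and f = "\<lambda>x. x - t"]) 
        (auto intro!: derivative_eq_intros c1_onD[OF k])
    then show "((\<lambda>x. f t * k (x - t)) has_derivative blinfun_apply (?B x t)) (at x within UNIV)"
      by (intro has_derivative_eq_rhs[OF has_derivative_mult_right]) 
        (auto simp: blinfun.scaleR_left)
  next
    show "(\<lambda>y. f y * k (x - y)) integrable_on cbox (- c) c" for x
      by (intro integrable_continuous continuous_intros continuous_on_subset[OF f]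
            continuous_on_compose2[OF ck]) auto
  next
    show "continuous_on (UNIV \<times> cbox (- c) c) (\<lambda>(x, t). ?B x t)"
      unfolding split_beta
      by (intro continuous_intros continuous_on_compose2[OF f] continuous_on_compose2[OF ck']) auto
  qed auto
  have "?B x integrable_on cbox (- c) c"
    by (intro integrable_continuous continuous_intros continuous_on_subset[OF f]
          continuous_on_compose2[OF ck']) auto
  then have "blinfun_apply (integral (cbox (- c) c) (?B x)) b = integral (cbox (- c) c) (\<lambda>y. f y * (k' (x - y) \<bullet> b))" for b
    using integral_linear[of "?B x" "cbox (- c) c" "\<lambda>F. blinfun_apply F b"]
    by (simp add: bounded_linear_intros o_def blinfun.scaleR_left)
  moreover have "conv f (\<lambda>z. k' z \<bullet> b) x = integral (cbox (- c) c) (\<lambda>y. f y * (k' (x - y) \<bullet> b))" for b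
    by (rule eq) (intro continuous_intros ck')
  moreover have "conv f k = (\<lambda>x. integral (cbox (- c) c) (\<lambda>y. f y * k (x - y)))"
    using eq[OF ck] by blast
  ultimately show ?thesis using that D by auto
qed

text \<open>Each step of the induction passes to a partial derivative of the kernel, so smoothness
  of the kernel of every order is carried along.\<close>

lemma Ck_on_conv:
  assumes f: "continuous_on UNIV f" and K: "compact K" "\<And>x. x \<notin> K \<Longrightarrow> f x = 0" 
    and k: "\<And>k. Ck_on k UNIV \<kappa>"
  shows "Ck_on k UNIV (conv f \<kappa>)"
  using k
proof (induction k arbitrary: \<kappa>)
  case (Suc k)
  have c1: "c1_on UNIV \<kappa> (gradient \<kappa>)"
    by (intro Ck_on_1_c1 Suc.prems) auto
  have D: "\<exists>D. (conv f \<kappa> has_derivative D) (at x) \<and> (\<forall>b. D b = conv f (\<lambda>z. gradient \<kappa> z \<bullet> b) x)" for x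
    by (rule conv_has_derivative[OF f K c1, of x]) blast+
  have g: "gradient \<kappa> z \<bullet> b = partial b \<kappa> z" for z b
    using partial_eq[OF c1_onD[OF c1]] by auto
  have "partial b (conv f \<kappa>) = conv f (partial b \<kappa>)" for b
  proof
    fix x
    obtain D where D': "(conv f \<kappa> has_derivative D) (at x)" "\<And>b. D b = conv f (\<lambda>z. gradient \<kappa> z \<bullet> b) x"
      using D by blast
    show "partial b (conv f \<kappa>) x = conv f (partial b \<kappa>) x"
      using partial_eq[OF D'(1)] D'(2) g by simp
  qed
  moreover have "Ck_on j UNIV (partial b \<kappa>)" if "b \<in> Basis" for b j
    using Suc.prems[of "Suc j"] that by simp
  moreover have "conv f \<kappa> differentiable_on UNIV"
    unfolding differentiable_on_def differentiable_def using D by auto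
  ultimately show ?case using Suc.IH by simp
next
  case 0
  have c1: "c1_on UNIV \<kappa> (gradient \<kappa>)"
    by (intro Ck_on_1_c1 0) auto
  have "isCont (conv f \<kappa>) x" for x
    by (rule conv_has_derivative[OF f K c1, of x]) (auto intro: has_derivative_continuous)
  then show ?case by (simp add: continuous_at_imp_continuous_on)
qed

text \<open>The gradient of the convolution is used in two forms: with the derivative on the kernel
  it shows smoothness, with the derivative on \<open>f\<close> it is an average of \<open>g\<close>
  and hence close to \<open>g\<close>.\<close>

lemma mollify:
  fixes f :: "'b::euclidean_space \<Rightarrow> real"
  assumes f: "c1_on UNIV f g" and K: "compact K" "\<And>x. x \<notin> K \<Longrightarrow> f x = 0"
    and \<Omega>: "open \<Omega>" "K \<subseteq> \<Omega>" and e: "0 < e"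
  obtains \<phi> where "\<phi> \<in> test_functions \<Omega>" "\<And>x. \<bar>\<phi> x - f x\<bar> \<le> e" "\<And>x. norm (gradient \<phi> x - g x) \<le> e"
proof -
  have cf: "continuous_on UNIV f" by (rule c1_on_continuous[OF f])
  have cg: "continuous_on UNIV g" by (rule c1_on_continuous_grad[OF f])
  have gz: "g x = 0" if "x \<notin> K" for x
    using c1_on_UNIV_grad_zero[OF f compact_imp_closed[OF K(1)] K(2) that] .
  obtain d1 where d1: "0 < d1" "\<And>x y. norm (x - y) < d1 \<Longrightarrow> norm (f x - f y) \<le> e"
    using uniformly_continuous_compact_support[OF cf K e] by blast
  obtain d2 where d2: "0 < d2" "\<And>x y. norm (x - y) < d2 \<Longrightarrow> norm (g x - g y) \<le> e"
    using uniformly_continuous_compact_support[OF cg K(1) gz e] by blast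
  obtain d3 where d3: "0 < d3" "(\<Union>x\<in>K. ball x d3) \<subseteq> \<Omega>"
    using compact_subset_open_imp_ball_epsilon_subset[OF K(1) \<Omega>] by blast
  \<comment> \<open>\<open>d1\<close> and \<open>d2\<close> give closeness of the values and of the
    gradients; half of \<open>d3\<close> keeps the enlarged support inside \<Omega>.\<close>
  define r where "r = min (min d1 d2) (d3 / 2)"
  have r: "0 < r" "r \<le> d1" "r \<le> d2" "r < d3" using d1(1) d2(1) d3(1) by (auto simp: r_def)
  define N where "N = (\<integral>y. bump r y \<partial>(lborel :: 'b measure))"
  have N: "0 < N" unfolding N_def by (rule integral_bump_pos[OF r(1)])
  define \<phi> where "\<phi> = conv (\<lambda>y. f y / N) (bump r)"
  have cfN: "continuous_on UNIV (\<lambda>y. f y / N)" using N by (intro continuous_intros cf) auto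
  have zN: "f x / N = 0" if "x \<notin> K" for x using K(2)[OF that] by simp
  have \<phi>_eq: "\<phi> x = (\<integral>y. bump r (x - y) *\<^sub>R f y \<partial>lborel) /\<^sub>R N" for x
    by (simp add: \<phi>_def conv_def divide_inverse mult_ac)
  have c1: "c1_on UNIV (bump r) (gradient (bump r))"
    by (intro Ck_on_1_c1 Ck_on_bump) auto
  have grad: "gradient \<phi> x = (\<integral>y. bump r (x - y) *\<^sub>R g y \<partial>lborel) /\<^sub>R N" for x
  proof -
    obtain D where D: "(\<phi> has_derivative D) (at x)" "\<And>b. D b = conv (\<lambda>y. f y / N) (\<lambda>z. gradient (bump r) z \<bullet> b) x"
      unfolding \<phi>_def using conv_has_derivative[OF cfN K(1) zN c1, of x] by blast
    let ?v = "\<integral>y. bump r (x - y) *\<^sub>R g y \<partial>lborel"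
    have iv: "integrable lborel (\<lambda>y. bump r (x - y) *\<^sub>R g y)"
      by (rule integrable_continuous_compact_support[OF _ K(1)]) (auto intro!: continuous_intros cg simp: gz)
    have "D b = (?v /\<^sub>R N) \<bullet> b" for b
    proof -
      have shift: "c1_on UNIV (\<lambda>y. bump r (x - y)) (\<lambda>y. - gradient (bump r) (x - y))"
        unfolding c1_on_def
      proof (intro conjI ballI)
        fix y
        have "((\<lambda>y. bump r (x - y)) has_derivative (\<lambda>h. gradient (bump r) (x - y) \<bullet> (- h))) (at y)"
          by (rule has_derivative_compose[where f = "\<lambda>y. x - y" and g = "bump r"])
            (auto intro!: derivative_eq_intros c1_onD[OF c1])
        then show "((\<lambda>y. bump r (x - y)) has_derivative (\<lambda>h. - gradient (bump r) (x - y) \<bullet> h)) (at y)"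
          by simp
      qed (intro continuous_intros continuous_on_compose2[OF c1_on_continuous_grad[OF c1]] subset_UNIV)
      \<comment> \<open>The product of \<open>f\<close> with the reflected kernel has compact
        support, so its derivative integrates to zero. The sign from the reflection cancels the one
        from integrating by parts.\<close>
      have "0 = (\<integral>y. (f y *\<^sub>R - gradient (bump r) (x - y) + bump r (x - y) *\<^sub>R g y) \<bullet> b \<partial>lborel)"
        by (rule integral_directional_derivative_zero[OF c1_on_mult[OF f shift] K(1), symmetric]) (simp add: K(2))
      also have "\<dots> = (\<integral>y. bump r (x - y) *\<^sub>R g y \<bullet> b - f y * (gradient (bump r) (x - y) \<bullet> b) \<partial>lborel)"
        by (simp add: inner_add_left inner_diff_left)
      also have "\<dots> = (\<integral>y. bump r (x - y) *\<^sub>R g y \<bullet> b \<partial>lborel) - (\<integral>y. f y * (gradient (bump r) (x - y) \<bullet> b) \<partial>lborel)"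
      proof (rule Bochner_Integration.integral_diff)
        show "integrable lborel (\<lambda>y. bump r (x - y) *\<^sub>R g y \<bullet> b)" using iv by (rule integrable_inner_left)
        show "integrable lborel (\<lambda>y. f y * (gradient (bump r) (x - y) \<bullet> b))"
          by (rule integrable_continuous_compact_support[OF _ K(1)]) 
            (auto intro!: continuous_intros cf continuous_on_compose2[OF c1_on_continuous_grad[OF c1]] simp: K(2))
      qed
      also have "(\<integral>y. bump r (x - y) *\<^sub>R g y \<bullet> b \<partial>lborel) = ?v \<bullet> b"
        using iv by (rule integral_inner_left)
      finally have "?v \<bullet> b = (\<integral>y. f y * (gradient (bump r) (x - y) \<bullet> b) \<partial>lborel)" by simp
      then show ?thesis
        using D(2)[of b] by (simp add: conv_def inner_scaleR_left divide_inverse mult_ac)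
    qed
    then have "D = (\<lambda>h. (?v /\<^sub>R N) \<bullet> h)" by blast
    with D(1) show ?thesis by (auto intro: gradient_eq)
  qed
  have supp: "{x. \<phi> x \<noteq> 0} \<subseteq> {x + y | x y. x \<in> K \<and> y \<in> cball 0 r}"
  proof
    fix x assume "x \<in> {x. \<phi> x \<noteq> 0}"
    then have "\<exists>y. f y / N * bump r (x - y) \<noteq> 0"
      unfolding \<phi>_def conv_def by (metis (mono_tags, lifting) Bochner_Integration.integral_cong integral_zero mem_Collect_eq)
    then obtain y where y: "f y \<noteq> 0" "bump r (x - y) \<noteq> 0" by auto
    then have "y \<in> K" "norm (x - y) < r" using K(2) bump_eq_0[OF r(1)] by (blast, force)
    moreover have "x = y + (x - y)" by simp
    ultimately show "x \<in> {x + y | x y. x \<in> K \<and> y \<in> cball 0 r}"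
      by (metis (mono_tags, lifting) less_imp_le mem_Collect_eq mem_cball_0)
  qed
  have cS: "compact {x + y | x y. x \<in> K \<and> y \<in> cball 0 r}"
    by (intro compact_sums K) auto
  have cl: "closure {x. \<phi> x \<noteq> 0} \<subseteq> {x + y | x y. x \<in> K \<and> y \<in> cball 0 r}"
    using closure_minimal[OF supp compact_imp_closed[OF cS]] .
  have "{x + y | x y. x \<in> K \<and> y \<in> cball 0 r} \<subseteq> \<Omega>"
    using d3(2) r(4) by (force simp: dist_norm)
  moreover have "compact (closure {x. \<phi> x \<noteq> 0})"
    using compact_Int_closed[OF cS closed_closure[of "{x. \<phi> x \<noteq> 0}"]] cl by (simp only: inf.absorb2)
  moreover have "Ck_on k UNIV \<phi>" for k
    unfolding \<phi>_def by (rule Ck_on_conv[OF cfN K(1) zN Ck_on_bump])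
  ultimately have test: "\<phi> \<in> test_functions \<Omega>"
    using cl unfolding test_functions_def by blast
  show ?thesis
  proof (rule that[OF test])
    show "\<bar>\<phi> x - f x\<bar> \<le> e" for x
      using mollify_approx[OF cf r(1), of x e] d1(2) r(2) by (force simp: \<phi>_eq N_def)
    show "norm (gradient \<phi> x - g x) \<le> e" for x
      unfolding grad N_def using d2(2) r(3) by (intro mollify_approx[OF cg r(1)]) force
  qed
qed

section \<open>The comparison principle\<close>

text \<open>A bridge between the measure used for the equation and \<open>lborel\<close>, on which
  integration by parts and the Poincare inequality are proved.\<close>

lemma lebesgue_on_integral_eq:
  fixes f :: "'b::euclidean_space \<Rightarrow> 'c::euclidean_space"
  assumes \<Omega>: "open \<Omega>" and f: "continuous_on UNIV f" and z: "\<And>x. x \<notin> \<Omega> \<Longrightarrow> f x = 0"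
  shows "(\<integral>x. f x \<partial>lebesgue_on \<Omega>) = (\<integral>x. f x \<partial>lborel)"
proof -
  have [measurable]: "f \<in> borel_measurable borel"
    by (rule borel_measurable_continuous_onI[OF f])
  have "(\<integral>x. f x \<partial>lebesgue_on \<Omega>) = (\<integral>x. indicator \<Omega> x *\<^sub>R f x \<partial>lebesgue)"
    using \<Omega> by (intro integral_restrict_space) auto
  also have "(\<lambda>x. indicator \<Omega> x *\<^sub>R f x) = f"
    using z by (auto simp: indicator_def)
  also have "(\<integral>x. f x \<partial>lebesgue) = (\<integral>x. f x \<partial>lborel)"
    by (rule integral_completion) simp
  finally show ?thesis .
qed

section \<open>Square integrable functions on a bounded open set\<close>

lemma finite_measure_lebesgue_on_bounded: 
  "open \<Omega> \<Longrightarrow> bounded \<Omega> \<Longrightarrow> finite_measure (lebesgue_on \<Omega>)"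
  by (intro finite_measure_lebesgue_on bounded_set_imp_lmeasurable) auto

lemma L2_on_bounded:
  fixes f :: "'b::euclidean_space \<Rightarrow> 'c::euclidean_space"
  assumes \<Omega>: "open \<Omega>" "bounded \<Omega>" and f: "f \<in> borel_measurable (lebesgue_on \<Omega>)" "\<And>x. x \<in> \<Omega> \<Longrightarrow> norm (f x) \<le> B"
  shows "L2_on \<Omega> f"
proof -
  interpret finite_measure "lebesgue_on \<Omega>"
    by (rule finite_measure_lebesgue_on_bounded[OF \<Omega>])
  have "integrable (lebesgue_on \<Omega>) (\<lambda>x. (norm (f x))\<^sup>2)"
  proof (rule integrable_const_bound[where B = "B\<^sup>2"])
    show "AE x in lebesgue_on \<Omega>. norm ((norm (f x))\<^sup>2) \<le> B\<^sup>2"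
      by (rule AE_I2) (use f(2) in \<open>auto intro!: power_mono\<close>)
  qed (use f(1) in measurable)
  with f(1) show ?thesis by (simp add: L2_on_def)
qed

lemma L2_on_continuous:
  fixes f :: "'b::euclidean_space \<Rightarrow> 'c::euclidean_space"
  assumes \<Omega>: "open \<Omega>" "bounded \<Omega>" and f: "continuous_on UNIV f"
  shows "L2_on \<Omega> f"
proof -
  have "compact (f ` closure \<Omega>)"
    by (intro compact_continuous_image) (use \<Omega> f in \<open>auto intro: continuous_on_subset simp: compact_closure\<close>)
  then obtain B where B: "\<And>x. x \<in> closure \<Omega> \<Longrightarrow> norm (f x) \<le> B"
    by (meson compact_imp_bounded bounded_iff image_eqI)
  show ?thesis
  proof (rule L2_on_bounded[OF \<Omega>, where B = B])
    show "f \<in> borel_measurable (lebesgue_on \<Omega>)"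
      using \<Omega> f by (intro continuous_imp_measurable_on_sets_lebesgue) (auto intro: continuous_on_subset)
    show "\<And>x. x \<in> \<Omega> \<Longrightarrow> norm (f x) \<le> B"
      using B closure_subset by blast
  qed
qed

lemma L2_on_inner_integrable:
  fixes f h :: "'b::euclidean_space \<Rightarrow> 'c::euclidean_space"
  assumes "L2_on \<Omega> f" "L2_on \<Omega> h"
  shows "integrable (lebesgue_on \<Omega>) (\<lambda>x. f x \<bullet> h x)"
proof (rule Bochner_Integration.integrable_bound[where f = "\<lambda>x. (norm (f x))\<^sup>2 + (norm (h x))\<^sup>2"])
  show "integrable (lebesgue_on \<Omega>) (\<lambda>x. (norm (f x))\<^sup>2 + (norm (h x))\<^sup>2)"
    using assms by (simp add: L2_on_def)
  show "(\<lambda>x. f x \<bullet> h x) \<in> borel_measurable (lebesgue_on \<Omega>)"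
    using assms by (auto simp: L2_on_def intro!: borel_measurable_inner borel_measurable_diff)
  show "AE x in lebesgue_on \<Omega>. norm (f x \<bullet> h x) \<le> norm ((norm (f x))\<^sup>2 + (norm (h x))\<^sup>2)"
  proof (rule AE_I2)
    fix x
    have "\<bar>f x \<bullet> h x\<bar> \<le> norm (f x) * norm (h x)" by (rule Cauchy_Schwarz_ineq2)
    also have "\<dots> \<le> (norm (f x))\<^sup>2 + (norm (h x))\<^sup>2"
    proof -
      have "0 \<le> norm (f x) * norm (h x)" by simp
      then show ?thesis
        using sum_squares_bound[of "norm (f x)" "norm (h x)"] unfolding mult.assoc by linarith
    qed
    finally show "norm (f x \<bullet> h x) \<le> norm ((norm (f x))\<^sup>2 + (norm (h x))\<^sup>2)" by simp
  qed
qed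

lemma L2_on_diff:
  fixes f h :: "'b::euclidean_space \<Rightarrow> 'c::euclidean_space"
  assumes "L2_on \<Omega> f" "L2_on \<Omega> h"
  shows "L2_on \<Omega> (\<lambda>x. f x - h x)"
  unfolding L2_on_def
proof
  show "(\<lambda>x. f x - h x) \<in> borel_measurable (lebesgue_on \<Omega>)"
    using assms by (auto simp: L2_on_def intro!: borel_measurable_inner borel_measurable_diff)
  have "(\<lambda>x. (norm (f x - h x))\<^sup>2) = (\<lambda>x. (norm (f x))\<^sup>2 + (norm (h x))\<^sup>2 - 2 * (f x \<bullet> h x))"
    by (simp add: dot_norm_neg field_simps)
  then show "integrable (lebesgue_on \<Omega>) (\<lambda>x. (norm (f x - h x))\<^sup>2)"
    using assms L2_on_inner_integrable[OF assms] by (simp add: L2_on_def)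
qed

section \<open>The weak form of the equation and its extension to C^1 test functions\<close>

lemma test_functionD:
  assumes "\<phi> \<in> test_functions \<Omega>"
  shows "Ck_on k UNIV \<phi>" "c1_on UNIV \<phi> (gradient \<phi>)" "compact (closure {x. \<phi> x \<noteq> 0})" 
    "closure {x. \<phi> x \<noteq> 0} \<subseteq> \<Omega>" "x \<notin> closure {x. \<phi> x \<noteq> 0} \<Longrightarrow> \<phi> x = 0"
    "x \<notin> closure {x. \<phi> x \<noteq> 0} \<Longrightarrow> gradient \<phi> x = 0"
proof -
  show c1: "c1_on UNIV \<phi> (gradient \<phi>)"
    by (rule Ck_on_1_c1) (use assms in \<open>auto simp only: test_functions_def mem_Collect_eq open_UNIV\<close>)
  show z: "x \<notin> closure {x. \<phi> x \<noteq> 0} \<Longrightarrow> \<phi> x = 0" for x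
    using closure_subset[of "{x. \<phi> x \<noteq> 0}"] by auto
  show "x \<notin> closure {x. \<phi> x \<noteq> 0} \<Longrightarrow> gradient \<phi> x = 0"
    by (rule c1_on_UNIV_grad_zero[OF c1 closed_closure z]) auto
qed (use assms in \<open>auto simp: test_functions_def\<close>)

lemma partial_test_function:
  assumes \<phi>: "\<phi> \<in> test_functions \<Omega>" and b: "b \<in> Basis" 
  shows "partial b \<phi> \<in> test_functions \<Omega>"
proof -
  have eq: "partial b \<phi> x = gradient \<phi> x \<bullet> b" for x
    by (intro partial_eq[OF c1_onD[OF test_functionD(2)[OF \<phi>]]]) auto
  have "{x. partial b \<phi> x \<noteq> 0} \<subseteq> closure {x. \<phi> x \<noteq> 0}"
    using test_functionD(6)[OF \<phi>] by (force simp: eq)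
  then have cl: "closure {x. partial b \<phi> x \<noteq> 0} \<subseteq> closure {x. \<phi> x \<noteq> 0}"
    by (rule closure_minimal) auto
  then have "compact (closure {x. partial b \<phi> x \<noteq> 0})"
    using compact_Int_closed[OF test_functionD(3)[OF \<phi>] closed_closure[of "{x. partial b \<phi> x \<noteq> 0}"]] 
    by (simp only: inf.absorb2)
  moreover have "Ck_on k UNIV (partial b \<phi>)" for k
    using test_functionD(1)[OF \<phi>, of "Suc k"] b by simp
  ultimately show ?thesis
    using cl test_functionD(4)[OF \<phi>] unfolding test_functions_def by blast
qed

lemma continuous_on_test_function: 
  assumes "\<phi> \<in> test_functions \<Omega>" shows "continuous_on UNIV \<phi>" "continuous_on UNIV (gradient \<phi>)"
  using c1_on_continuous[OF test_functionD(2)] c1_on_continuous_grad[OF test_functionD(2)] assms by blast+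

text \<open>The equation is given with both derivatives on the test function. Inserting
  \<open>partial b \<phi>\<close> into the definition of the weak gradient moves one of them onto
  \<open>u\<close>.\<close>

lemma weak_form_test:
  fixes \<Omega> :: "'b::euclidean_space set"
  assumes \<Omega>: "open \<Omega>" "bounded \<Omega>" and u: "torsion_function \<Omega> u" "L2_on \<Omega> u" "L2_on \<Omega> G" "weak_gradient \<Omega> u G"
    and \<phi>: "\<phi> \<in> test_functions \<Omega>"
  shows "(\<integral>x. G x \<bullet> gradient \<phi> x \<partial>lebesgue_on \<Omega>) = (\<integral>x. \<phi> x \<partial>lebesgue_on \<Omega>)"
proof -
  have b: "(\<integral>x. (G x \<bullet> b) * partial b \<phi> x \<partial>lebesgue_on \<Omega>) = - (\<integral>x. u x * partial b (partial b \<phi>) x \<partial>lebesgue_on \<Omega>)"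
    if "b \<in> Basis" for b
    using u(4) partial_test_function[OF \<phi> that] that unfolding weak_gradient_def by fastforce
  have L2p: "L2_on \<Omega> (partial b \<phi>)" "L2_on \<Omega> (partial b (partial b \<phi>))" if "b \<in> Basis" for b
    using partial_test_function[OF \<phi> that] partial_test_function[OF partial_test_function[OF \<phi> that] that]
    by (auto intro: L2_on_continuous[OF \<Omega>] continuous_on_test_function)
  have i1: "integrable (lebesgue_on \<Omega>) (\<lambda>x. (G x \<bullet> b) * partial b \<phi> x)" if "b \<in> Basis" for b
  proof -
    have "L2_on \<Omega> (\<lambda>x. partial b \<phi> x *\<^sub>R b)"
      by (intro L2_on_continuous[OF \<Omega>] continuous_on_test_function[OF partial_test_function[OF \<phi> that]] continuous_intros)
    from L2_on_inner_integrable[OF u(3) this] show ?thesis by (simp add: mult.commute)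
  qed
  have i2: "integrable (lebesgue_on \<Omega>) (\<lambda>x. u x * partial b (partial b \<phi>) x)" if "b \<in> Basis" for b
    using L2_on_inner_integrable[OF u(2) L2p(2)[OF that]] by simp
  have "(\<integral>x. G x \<bullet> gradient \<phi> x \<partial>lebesgue_on \<Omega>) = (\<integral>x. (\<Sum>b\<in>Basis. (G x \<bullet> b) * partial b \<phi> x) \<partial>lebesgue_on \<Omega>)"
    by (simp add: gradient_def inner_sum_right mult.commute)
  also have "\<dots> = (\<Sum>b\<in>Basis. \<integral>x. (G x \<bullet> b) * partial b \<phi> x \<partial>lebesgue_on \<Omega>)"
    by (intro Bochner_Integration.integral_sum i1)
  also have "\<dots> = - (\<Sum>b\<in>Basis. \<integral>x. u x * partial b (partial b \<phi>) x \<partial>lebesgue_on \<Omega>)"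
    by (simp add: b sum_negf)
  also have "(\<Sum>b\<in>Basis. \<integral>x. u x * partial b (partial b \<phi>) x \<partial>lebesgue_on \<Omega>) = (\<integral>x. u x * laplacian \<phi> x \<partial>lebesgue_on \<Omega>)"
    unfolding laplacian_def sum_distrib_left by (intro Bochner_Integration.integral_sum[symmetric] i2)
  also have "- \<dots> = (\<integral>x. \<phi> x \<partial>lebesgue_on \<Omega>)"
    using u(1) \<phi> by (simp add: torsion_function_def)
  finally show ?thesis .
qed

text \<open>Both sides are continuous under uniform convergence of \<phi> and its gradient, because
  \<open>G\<close> is integrable and \<Omega> has finite measure; mollification then reduces to test
  functions.\<close>

lemma weak_form_c1:
  fixes \<Omega> :: "'b::euclidean_space set"
  assumes \<Omega>: "open \<Omega>" "bounded \<Omega>" and u: "torsion_function \<Omega> u" "L2_on \<Omega> u" "L2_on \<Omega> G" "weak_gradient \<Omega> u G"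
    and \<phi>: "c1_on UNIV \<phi> g" "compact K" "K \<subseteq> \<Omega>" "\<And>x. x \<notin> K \<Longrightarrow> \<phi> x = 0"
  shows "(\<integral>x. G x \<bullet> g x \<partial>lebesgue_on \<Omega>) = (\<integral>x. \<phi> x \<partial>lebesgue_on \<Omega>)"
proof -
  interpret finite_measure "lebesgue_on \<Omega>"
    by (rule finite_measure_lebesgue_on_bounded[OF \<Omega>])
  let ?M = "lebesgue_on \<Omega>"
  have one: "L2_on \<Omega> (\<lambda>_. 1 :: real)"
    by (intro L2_on_continuous[OF \<Omega>]) auto
  have iG: "integrable ?M (\<lambda>x. norm (G x))"
  proof -
    have "L2_on \<Omega> (\<lambda>x. norm (G x))"
      using u(3) unfolding L2_on_def by auto
    from L2_on_inner_integrable[OF this one] show ?thesis by simp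
  qed
  have i: "integrable ?M (\<lambda>x. G x \<bullet> h x)" if "continuous_on UNIV h" for h
    by (intro L2_on_inner_integrable u L2_on_continuous[OF \<Omega>] that)
  have i': "integrable ?M h" if "continuous_on UNIV h" for h :: "'b \<Rightarrow> real"
    using L2_on_inner_integrable[OF L2_on_continuous[OF \<Omega> that] one] by simp
  have cg: "continuous_on UNIV g" and c\<phi>: "continuous_on UNIV \<phi>" 
    using c1_on_continuous_grad[OF \<phi>(1)] c1_on_continuous[OF \<phi>(1)] .
  \<comment> \<open>Replacing \<phi> by a mollification of accuracy \<open>e\<close> changes the
    difference of the two sides by at most \<open>e * L\<close>.\<close>
  define L where "L = (\<integral>x. norm (G x) \<partial>?M) + measure ?M (space ?M)"
  have L0: "0 \<le> L" by (simp add: L_def)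
  let ?d = "\<bar>(\<integral>x. G x \<bullet> g x \<partial>?M) - (\<integral>x. \<phi> x \<partial>?M)\<bar>"
  have "?d \<le> e * L" if e: "0 < e" for e
  proof -
    obtain \<psi> where \<psi>: "\<psi> \<in> test_functions \<Omega>" "\<And>x. \<bar>\<psi> x - \<phi> x\<bar> \<le> e" "\<And>x. norm (gradient \<psi> x - g x) \<le> e"
      using mollify[OF \<phi>(1,2,4) \<Omega>(1) \<phi>(3) e] by blast
    have c: "continuous_on UNIV (gradient \<psi>)" "continuous_on UNIV \<psi>"
      using continuous_on_test_function[OF \<psi>(1)] by auto
    have "(\<integral>x. G x \<bullet> g x \<partial>?M) - (\<integral>x. \<phi> x \<partial>?M) = 
        ((\<integral>x. G x \<bullet> g x \<partial>?M) - (\<integral>x. G x \<bullet> gradient \<psi> x \<partial>?M)) + ((\<integral>x. \<psi> x \<partial>?M) - (\<integral>x. \<phi> x \<partial>?M))"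
      using weak_form_test[OF \<Omega> u \<psi>(1)] by simp
    also have "\<dots> = (\<integral>x. G x \<bullet> (g x - gradient \<psi> x) \<partial>?M) + (\<integral>x. \<psi> x - \<phi> x \<partial>?M)"
      using i[OF cg] i[OF c(1)] i'[OF c\<phi>] i'[OF c(2)] by (simp add: inner_diff_right)
    finally have "?d \<le> \<bar>\<integral>x. G x \<bullet> (g x - gradient \<psi> x) \<partial>?M\<bar> + \<bar>\<integral>x. \<psi> x - \<phi> x \<partial>?M\<bar>"
      by simp
    also have "\<bar>\<integral>x. G x \<bullet> (g x - gradient \<psi> x) \<partial>?M\<bar> \<le> (\<integral>x. \<bar>G x \<bullet> (g x - gradient \<psi> x)\<bar> \<partial>?M)"
      by (rule integral_abs_bound)
    also have "\<dots> \<le> (\<integral>x. norm (G x) * e \<partial>?M)"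
    proof (rule integral_mono)
      show "integrable ?M (\<lambda>x. \<bar>G x \<bullet> (g x - gradient \<psi> x)\<bar>)"
        by (intro integrable_abs i continuous_intros cg c)
      show "integrable ?M (\<lambda>x. norm (G x) * e)" using iG by simp
      show "\<bar>G x \<bullet> (g x - gradient \<psi> x)\<bar> \<le> norm (G x) * e" for x
        using \<psi>(3)[of x] Cauchy_Schwarz_ineq2[of "G x" "g x - gradient \<psi> x"] 
        by (smt (verit) mult_left_mono norm_ge_zero norm_minus_commute)
    qed
    also have "\<bar>\<integral>x. \<psi> x - \<phi> x \<partial>?M\<bar> \<le> (\<integral>x. \<bar>\<psi> x - \<phi> x\<bar> \<partial>?M)"
      by (rule integral_abs_bound)
    also have "\<dots> \<le> (\<integral>x. e \<partial>?M)"
      by (rule integral_mono) (use \<psi>(2) i'[OF c(2)] i'[OF c\<phi>] in auto)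
    finally show ?thesis by (simp add: L_def algebra_simps)
  qed
  note le = this
  have "?d \<le> 0"
  proof (rule field_le_epsilon)
    fix e :: real assume "0 < e"
    have "?d \<le> e / (L + 1) * L" using L0 \<open>0 < e\<close> by (intro le) auto
    also have "\<dots> \<le> e" using L0 \<open>0 < e\<close> by (simp add: field_simps)
    finally show "?d \<le> 0 + e" by simp
  qed
  then show ?thesis by simp
qed

text \<open>\<open>H b\<close> is the gradient of the derivative of \<open>f\<close> in direction \<open>b\<close>, so that
  \<open>\<Sum>b\<in>Basis. H b x \<bullet> b\<close> is the Laplacian.\<close>

definition c2_on :: "'b::euclidean_space set \<Rightarrow> ('b \<Rightarrow> real) \<Rightarrow> ('b \<Rightarrow> 'b) \<Rightarrow> ('b \<Rightarrow> 'b \<Rightarrow> 'b) \<Rightarrow> bool" where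
  "c2_on U f g H \<longleftrightarrow> c1_on U f g \<and> (\<forall>b\<in>Basis. c1_on U (\<lambda>x. g x \<bullet> b) (H b))"

definition lapl :: "('b::euclidean_space \<Rightarrow> 'b \<Rightarrow> 'b) \<Rightarrow> 'b \<Rightarrow> real" where
  "lapl H x = (\<Sum>b\<in>Basis. H b x \<bullet> b)"

text \<open>Testing the equation for \<open>u - S\<close> with \<open>flat 0 (\<sigma> * (\<psi> k - S))\<close>, where \<open>\<psi> k\<close> are test functions
  approximating \<open>u\<close>; this function is supported in a compact subset of \<open>\<Omega>\<close>, and its derivative
  satisfies \<open>\<theta>'\<^sup>2 \<le> \<theta>'\<close>.\<close>

theorem comparison:
  fixes \<Omega> :: "'b::euclidean_space set"
  assumes \<Omega>: "open \<Omega>" "bounded \<Omega>" and u: "torsion_function \<Omega> u" and \<sigma>: "\<sigma> = 1 \<or> \<sigma> = -1"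
    and S: "c2_on \<Omega> S g H" and lap: "\<And>x. x \<in> \<Omega> \<Longrightarrow> \<sigma> * (lapl H x + 1) \<le> 0"
    and K: "compact K" "K \<subseteq> \<Omega>" "\<And>x. x \<in> \<Omega> - K \<Longrightarrow> 0 \<le> \<sigma> * S x"
  shows "AE x in lebesgue_on \<Omega>. \<sigma> * (u x - S x) \<le> 0"
proof -
  interpret finite_measure "lebesgue_on \<Omega>"
    by (rule finite_measure_lebesgue_on_bounded[OF \<Omega>])
  let ?M = "lebesgue_on \<Omega>"
  have \<sigma>2: "\<sigma> * \<sigma> = 1" using \<sigma> by auto
  obtain R where R: "\<And>x. x \<in> \<Omega> \<Longrightarrow> norm x \<le> R"
    using \<Omega>(2) by (auto simp: bounded_iff)
  obtain G \<psi> where L2u: "L2_on \<Omega> u" and G: "L2_on \<Omega> G" "weak_gradient \<Omega> u G" and \<psi>: "\<And>k. \<psi> k \<in> test_functions \<Omega>"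
    and lim: "(\<lambda>k. (\<integral>x. (u x - \<psi> k x)\<^sup>2 \<partial>?M) + (\<integral>x. (norm (G x - gradient (\<psi> k) x))\<^sup>2 \<partial>?M)) \<longlonglongrightarrow> 0"
    using u unfolding torsion_function_def W12_0_def by blast
  have S1: "c1_on \<Omega> S g" and S2: "\<And>b. b \<in> Basis \<Longrightarrow> c1_on \<Omega> (\<lambda>x. g x \<bullet> b) (H b)"
    using S by (auto simp: c2_on_def)
  have cS: "continuous_on \<Omega> S" by (rule c1_on_continuous[OF S1])
  have sets: "\<Omega> \<in> sets lebesgue" using \<Omega>(1) by auto
  have mS: "S \<in> borel_measurable ?M"
    by (rule continuous_imp_measurable_on_sets_lebesgue[OF cS sets])
  have mu: "u \<in> borel_measurable ?M" using L2u by (simp add: L2_on_def)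
  \<comment> \<open>\<open>F\<close> is positive exactly where the claim fails, so it suffices that
    its integral vanishes. It is integrable since \<open>flat 0\<close> is bounded.\<close>
  define F where "F x = (flat 0 (\<sigma> * (u x - S x)))\<^sup>2" for x
  have flat_le1: "flat 0 t \<le> 1" for t by (simp add: flat_def)
  have mF: "F \<in> borel_measurable ?M"
  proof -
    have "flat 0 \<in> borel_measurable borel"
      by (intro borel_measurable_continuous_onI continuous_on_flat continuous_on_id)
    from measurable_compose[OF _ this] show ?thesis unfolding F_def using mu mS by measurable
  qed
  have iF: "integrable ?M F"
  proof (rule integrable_const_bound[OF _ mF, where B = 1])
    show "AE x in ?M. norm (F x) \<le> 1"
      by (rule AE_I2) (simp add: F_def flat_le1 flat_nonneg power_le_one)
  qed
  \<comment> \<open>The constant is independent of \<open>k\<close>, and the right side tends to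
    zero by \<open>lim\<close>.\<close>
  have key: "(\<integral>x. F x \<partial>?M) \<le> (8 * R\<^sup>2 + 2) * ((\<integral>x. (u x - \<psi> k x)\<^sup>2 \<partial>?M) + (\<integral>x. (norm (G x - gradient (\<psi> k) x))\<^sup>2 \<partial>?M))" for k
  proof -
    let ?p = "\<psi> k" and ?gp = "gradient (\<psi> k)"
    let ?s = "closure {x. \<psi> k x \<noteq> 0}"
    let ?K = "K \<union> ?s"
    have Kc: "compact ?K" using K(1) test_functionD(3)[OF \<psi>] by auto
    have K\<Omega>: "?K \<subseteq> \<Omega>" using K(2) test_functionD(4)[OF \<psi>] by auto
    let ?q = "\<lambda>x. flat 0 (\<sigma> * (?p x - S x))"
    let ?gq = "\<lambda>x. flat (-2) (\<sigma> * (?p x - S x)) *\<^sub>R \<sigma> *\<^sub>R (?gp x - g x)"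
    have q1: "c1_on \<Omega> ?q ?gq"
      by (intro c1_on_compose_real c1_on_cmult c1_on_diff S1 c1_on_subset[OF test_functionD(2)[OF \<psi>]] continuous_intros)
        (use flat_deriv[of 0] in auto)
    \<comment> \<open>Off \<open>?K\<close> the test function vanishes and
      \<open>\<sigma> * S x\<close> is nonnegative, so \<open>flat 0\<close> is evaluated at a
      nonpositive argument.\<close>
    have q0: "?q x = 0" if "x \<in> \<Omega> - ?K" for x
      using test_functionD(5)[OF \<psi>, of x k] K(3)[of x] that by auto
    define \<phi> where "\<phi> = (\<lambda>x. if x \<in> \<Omega> then ?q x else 0)"
    define e where "e = (\<lambda>x. if x \<in> \<Omega> then ?gq x else 0)"
    have c1: "c1_on UNIV \<phi> e"
      unfolding \<phi>_def e_def by (rule c1_on_extend_zero[OF q1 \<Omega>(1) compact_imp_closed[OF Kc] K\<Omega> q0])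
    have \<phi>0: "\<phi> x = 0" if "x \<notin> ?K" for x
      using q0[of x] that by (auto simp: \<phi>_def)
    have e0: "e x = 0" if "x \<notin> ?K" for x
      by (rule c1_on_UNIV_grad_zero[OF c1 compact_imp_closed[OF Kc] \<phi>0 that])
    have c\<phi>: "continuous_on UNIV \<phi>" and ce: "continuous_on UNIV e"
      using c1_on_continuous[OF c1] c1_on_continuous_grad[OF c1] .
    have L2e: "L2_on \<Omega> e" and L2\<phi>: "L2_on \<Omega> \<phi>" 
      by (intro L2_on_continuous[OF \<Omega>] ce c\<phi>)+
    have L2gp: "L2_on \<Omega> ?gp" and L2p: "L2_on \<Omega> ?p"
      by (intro L2_on_continuous[OF \<Omega>] continuous_on_test_function[OF \<psi>])+
    have I1: "(\<integral>x. G x \<bullet> e x \<partial>?M) = (\<integral>x. \<phi> x \<partial>?M)"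
      by (rule weak_form_c1[OF \<Omega> u L2u G c1 Kc K\<Omega> \<phi>0])
    \<comment> \<open>\<open>w b\<close> is the derivative in direction \<open>b\<close> of the
      \<open>b\<close>-component of the field \<open>?q x *\<^sub>R g x\<close>, extended by zero.
      The sum over \<open>b\<close> is the divergence, whose integral vanishes; this is the weak
      form for \<open>S\<close>.\<close>
    define w where "w b x = (if x \<in> \<Omega> then ((g x \<bullet> b) *\<^sub>R ?gq x + ?q x *\<^sub>R H b x) \<bullet> b else 0)" for b x
    have wb: "(\<integral>x. w b x \<partial>?M) = 0 \<and> integrable ?M (w b)" if b: "b \<in> Basis" for b
    proof -
      have p1: "c1_on \<Omega> (\<lambda>x. (g x \<bullet> b) * ?q x) (\<lambda>x. (g x \<bullet> b) *\<^sub>R ?gq x + ?q x *\<^sub>R H b x)"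
        by (rule c1_on_mult[OF S2[OF b] q1])
      have p0: "(g x \<bullet> b) * ?q x = 0" if "x \<in> \<Omega> - ?K" for x
        using q0[OF that] by simp
      note ext = c1_on_extend_zero[OF p1 \<Omega>(1) compact_imp_closed[OF Kc] K\<Omega> p0]
      have w: "w b = (\<lambda>x. (if x \<in> \<Omega> then (g x \<bullet> b) *\<^sub>R ?gq x + ?q x *\<^sub>R H b x else 0) \<bullet> b)"
        by (auto simp: w_def fun_eq_iff)
      have cw: "continuous_on UNIV (w b)"
        unfolding w by (intro continuous_intros c1_on_continuous_grad[OF ext])
      have "(\<integral>x. w b x \<partial>lborel) = 0"
        unfolding w by (rule integral_directional_derivative_zero[OF ext Kc]) (use q0 in auto)
      moreover have "(\<integral>x. w b x \<partial>?M) = (\<integral>x. w b x \<partial>lborel)"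
        by (rule lebesgue_on_integral_eq[OF \<Omega>(1) cw]) (auto simp: w_def)
      moreover have "integrable ?M (w b)"
        using L2_on_inner_integrable[OF L2_on_continuous[OF \<Omega> cw] L2_on_continuous[OF \<Omega> continuous_on_const[of _ "1::real"]]] by simp
      ultimately show ?thesis by simp
    qed
    have sum_w: "(\<Sum>b\<in>Basis. w b x) = g x \<bullet> e x + lapl H x * \<phi> x" if "x \<in> \<Omega>" for x
    proof -
      have "(\<Sum>b\<in>Basis. w b x) = (\<Sum>b\<in>Basis. (g x \<bullet> b) * (?gq x \<bullet> b)) + (\<Sum>b\<in>Basis. ?q x * (H b x \<bullet> b))"
        using that by (simp add: w_def inner_add_left sum.distrib mult.assoc)
      also have "(\<Sum>b\<in>Basis. (g x \<bullet> b) * (?gq x \<bullet> b)) = g x \<bullet> ?gq x"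
        by (rule euclidean_inner[symmetric])
      finally show ?thesis using that by (simp add: e_def \<phi>_def lapl_def sum_distrib_left sum_distrib_right mult.commute)
    qed
    have I2: "(\<integral>x. g x \<bullet> e x + lapl H x * \<phi> x \<partial>?M) = 0" and iI2: "integrable ?M (\<lambda>x. g x \<bullet> e x + lapl H x * \<phi> x)"
    proof -
      have "(\<integral>x. g x \<bullet> e x + lapl H x * \<phi> x \<partial>?M) = (\<integral>x. (\<Sum>b\<in>Basis. w b x) \<partial>?M)"
        by (rule Bochner_Integration.integral_cong) (use sum_w in auto)
      also have "\<dots> = (\<Sum>b\<in>Basis. \<integral>x. w b x \<partial>?M)"
        using wb by (intro Bochner_Integration.integral_sum) auto
      finally show "(\<integral>x. g x \<bullet> e x + lapl H x * \<phi> x \<partial>?M) = 0" using wb by simp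
      have "integrable ?M (\<lambda>x. \<Sum>b\<in>Basis. w b x)" using wb by (intro Bochner_Integration.integrable_sum) auto
      also have "?this \<longleftrightarrow> integrable ?M (\<lambda>x. g x \<bullet> e x + lapl H x * \<phi> x)"
        by (rule Bochner_Integration.integrable_cong) (use sum_w in auto)
      finally show "integrable ?M (\<lambda>x. g x \<bullet> e x + lapl H x * \<phi> x)" .
    qed
    \<comment> \<open>After \<theta>'^2 \<le> \<theta>' the gradient difference is split at
      \<open>G x\<close>, and the hypothesis on the Laplacian supplies the terms in \<phi>. All but
      the first term on the right integrate to zero by \<open>I1\<close> and \<open>I2\<close>,
      which leaves the approximation error.\<close>
    have pw: "(norm (e x))\<^sup>2 \<le> \<sigma> * (e x \<bullet> (?gp x - G x)) + \<sigma> * (G x \<bullet> e x) - \<sigma> * \<phi> x - \<sigma> * (g x \<bullet> e x + lapl H x * \<phi> x)"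
      if x: "x \<in> \<Omega>" for x
    proof -
      let ?t = "flat (-2) (\<sigma> * (?p x - S x))" and ?d = "?gp x - g x"
      have ex: "e x = (?t * \<sigma>) *\<^sub>R ?d" using x by (simp add: e_def)
      have "(norm (e x))\<^sup>2 = ?t * ?t * (?d \<bullet> ?d)"
      proof -
        have "(norm (e x))\<^sup>2 = (?t * \<sigma>) * ((?t * \<sigma>) * (?d \<bullet> ?d))"
          unfolding power2_norm_eq_inner ex by (simp only: inner_scaleR_left inner_scaleR_right)
        also have "\<dots> = (\<sigma> * \<sigma>) * (?t * ?t * (?d \<bullet> ?d))" by (simp only: mult_ac)
        finally show ?thesis by (simp only: \<sigma>2 mult_1)
      qed
      also have "\<dots> \<le> 1 * ?t * (?d \<bullet> ?d)"
        by (intro mult_right_mono flat0_deriv_le1 flat_nonneg) auto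
      also have "\<dots> = \<sigma> * (e x \<bullet> ?d)"
      proof -
        have "\<sigma> * (e x \<bullet> ?d) = (\<sigma> * \<sigma>) * (?t * (?d \<bullet> ?d))"
          unfolding ex by (simp only: inner_scaleR_left mult_ac)
        then show ?thesis by (simp only: \<sigma>2 mult_1)
      qed
      also have "\<dots> = \<sigma> * (e x \<bullet> (?gp x - G x)) + \<sigma> * (G x \<bullet> e x) - \<sigma> * (g x \<bullet> e x)"
        by (simp add: inner_diff_right inner_commute algebra_simps)
      also have "\<dots> \<le> \<sigma> * (e x \<bullet> (?gp x - G x)) + \<sigma> * (G x \<bullet> e x) - \<sigma> * (g x \<bullet> e x) - (\<sigma> * (lapl H x + 1)) * \<phi> x"
      proof -
        have "\<phi> x \<ge> 0" by (simp add: \<phi>_def flat_nonneg)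
        then have "(\<sigma> * (lapl H x + 1)) * \<phi> x \<le> 0" using lap[OF x] by (rule mult_nonpos_nonneg[rotated])
        then show ?thesis by simp
      qed
      finally show ?thesis by (simp add: algebra_simps)
    qed
    have ie: "integrable ?M (\<lambda>x. (norm (e x))\<^sup>2)" using L2e by (simp add: L2_on_def)
    have L2d: "L2_on \<Omega> (\<lambda>x. ?gp x - G x)" by (rule L2_on_diff[OF L2gp G(1)])
    have id: "integrable ?M (\<lambda>x. (norm (?gp x - G x))\<^sup>2)" using L2d by (simp add: L2_on_def)
    have ied: "integrable ?M (\<lambda>x. e x \<bullet> (?gp x - G x))" by (rule L2_on_inner_integrable[OF L2e L2d])
    have iGe: "integrable ?M (\<lambda>x. G x \<bullet> e x)" by (rule L2_on_inner_integrable[OF G(1) L2e])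
    have i\<phi>: "integrable ?M \<phi>"
      using L2_on_inner_integrable[OF L2\<phi> L2_on_continuous[OF \<Omega> continuous_on_const[of _ "1::real"]]] by simp
    have "(\<integral>x. (norm (e x))\<^sup>2 \<partial>?M) \<le> (\<integral>x. \<sigma> * (e x \<bullet> (?gp x - G x)) + \<sigma> * (G x \<bullet> e x) - \<sigma> * \<phi> x - \<sigma> * (g x \<bullet> e x + lapl H x * \<phi> x) \<partial>?M)"
      by (rule integral_mono) (use ie ied iGe i\<phi> iI2 pw in auto)
    also have "\<dots> = \<sigma> * (\<integral>x. e x \<bullet> (?gp x - G x) \<partial>?M) + \<sigma> * (\<integral>x. G x \<bullet> e x \<partial>?M) - \<sigma> * (\<integral>x. \<phi> x \<partial>?M) - \<sigma> * (\<integral>x. g x \<bullet> e x + lapl H x * \<phi> x \<partial>?M)"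
      using ied iGe i\<phi> iI2 by simp
    also have "\<dots> = (\<integral>x. \<sigma> * (e x \<bullet> (?gp x - G x)) \<partial>?M)"
      by (simp add: I1 I2)
    also have "\<dots> \<le> (\<integral>x. (norm (e x))\<^sup>2 / 2 + (norm (?gp x - G x))\<^sup>2 / 2 \<partial>?M)"
    proof (rule integral_mono)
      fix x
      have "\<sigma> * (e x \<bullet> (?gp x - G x)) \<le> \<bar>e x \<bullet> (?gp x - G x)\<bar>" using \<sigma> by auto
      also have "\<dots> \<le> norm (e x) * norm (?gp x - G x)" by (rule Cauchy_Schwarz_ineq2)
      also have "\<dots> \<le> (norm (e x))\<^sup>2 / 2 + (norm (?gp x - G x))\<^sup>2 / 2"
        using sum_squares_bound[of "norm (e x)" "norm (?gp x - G x)"] by simp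
      finally show "\<sigma> * (e x \<bullet> (?gp x - G x)) \<le> (norm (e x))\<^sup>2 / 2 + (norm (?gp x - G x))\<^sup>2 / 2" .
    qed (use ie id ied in auto)
    also have "\<dots> = (\<integral>x. (norm (e x))\<^sup>2 \<partial>?M) / 2 + (\<integral>x. (norm (?gp x - G x))\<^sup>2 \<partial>?M) / 2"
      using ie id by simp
    finally have e_le: "(\<integral>x. (norm (e x))\<^sup>2 \<partial>?M) \<le> (\<integral>x. (norm (G x - ?gp x))\<^sup>2 \<partial>?M)"
      by (simp add: norm_minus_commute)
    have "(\<integral>x. (\<phi> x)\<^sup>2 \<partial>?M) = (\<integral>x. (\<phi> x)\<^sup>2 \<partial>lborel)"
      by (rule lebesgue_on_integral_eq[OF \<Omega>(1) continuous_on_power[OF c\<phi>]]) (simp add: \<phi>_def)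
    also have "\<dots> \<le> 4 * R\<^sup>2 * (\<integral>x. (norm (e x))\<^sup>2 \<partial>lborel)"
      by (rule poincare_c1[OF c1 Kc _ \<phi>0]) (use K\<Omega> R in auto)
    also have "(\<integral>x. (norm (e x))\<^sup>2 \<partial>lborel) = (\<integral>x. (norm (e x))\<^sup>2 \<partial>?M)"
      by (rule lebesgue_on_integral_eq[OF \<Omega>(1) continuous_on_power[OF continuous_on_norm[OF ce]], symmetric]) (simp add: e_def)
    also have "4 * R\<^sup>2 * \<dots> \<le> 4 * R\<^sup>2 * (\<integral>x. (norm (G x - ?gp x))\<^sup>2 \<partial>?M)"
      by (intro mult_left_mono e_le) auto
    finally have \<phi>_le: "(\<integral>x. (\<phi> x)\<^sup>2 \<partial>?M) \<le> 4 * R\<^sup>2 * (\<integral>x. (norm (G x - ?gp x))\<^sup>2 \<partial>?M)" .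
    have i1: "integrable ?M (\<lambda>x. (\<phi> x)\<^sup>2)" using L2\<phi> by (simp add: L2_on_def)
    have i2: "integrable ?M (\<lambda>x. (u x - ?p x)\<^sup>2)" using L2_on_diff[OF L2u L2p] by (simp add: L2_on_def)
    \<comment> \<open>\<phi> differs from the function squared in \<open>F\<close> only by
      \<open>?p\<close> in place of \<open>u\<close>, and \<open>flat 0\<close> is
      1-Lipschitz.\<close>
    have "(\<integral>x. F x \<partial>?M) \<le> (\<integral>x. 2 * (\<phi> x)\<^sup>2 + 2 * (u x - ?p x)\<^sup>2 \<partial>?M)"
    proof (rule integral_mono[OF iF])
      show "integrable ?M (\<lambda>x. 2 * (\<phi> x)\<^sup>2 + 2 * (u x - ?p x)\<^sup>2)" using i1 i2 by auto
      fix x assume "x \<in> space ?M"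
      then have x: "x \<in> \<Omega>" by simp
      let ?a = "flat 0 (\<sigma> * (u x - S x))"
      have "\<bar>?a - \<phi> x\<bar> \<le> \<bar>\<sigma> * (u x - S x) - \<sigma> * (?p x - S x)\<bar>"
        using x flat0_lipschitz by (simp add: \<phi>_def)
      also have "\<dots> = \<bar>u x - ?p x\<bar>" using \<sigma> by auto
      finally have "(?a - \<phi> x)\<^sup>2 \<le> (u x - ?p x)\<^sup>2" by (simp add: abs_le_square_iff)
      moreover have "0 \<le> (?a - 2 * \<phi> x)\<^sup>2" by simp
      ultimately show "F x \<le> 2 * (\<phi> x)\<^sup>2 + 2 * (u x - ?p x)\<^sup>2"
        by (simp add: F_def power2_eq_square algebra_simps)
    qed
    also have "\<dots> = 2 * (\<integral>x. (\<phi> x)\<^sup>2 \<partial>?M) + 2 * (\<integral>x. (u x - ?p x)\<^sup>2 \<partial>?M)"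
      using i1 i2 by simp
    also have "\<dots> \<le> 8 * R\<^sup>2 * (\<integral>x. (norm (G x - ?gp x))\<^sup>2 \<partial>?M) + 2 * (\<integral>x. (u x - ?p x)\<^sup>2 \<partial>?M)"
      using \<phi>_le by simp
    also have "\<dots> \<le> (8 * R\<^sup>2 + 2) * ((\<integral>x. (u x - ?p x)\<^sup>2 \<partial>?M) + (\<integral>x. (norm (G x - ?gp x))\<^sup>2 \<partial>?M))"
      by (simp add: algebra_simps)
    finally show ?thesis .
  qed
  have "(\<integral>x. F x \<partial>?M) \<le> (8 * R\<^sup>2 + 2) * 0"
    by (rule LIMSEQ_le_const[OF tendsto_mult_left[OF lim]]) (use key in auto)
  moreover have "0 \<le> (\<integral>x. F x \<partial>?M)" by (simp add: F_def)
  ultimately have "(\<integral>x. F x \<partial>?M) = 0" by simp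
  moreover have F0: "\<And>x. 0 \<le> F x" by (simp add: F_def)
  ultimately have "AE x in ?M. F x = 0"
    using integral_nonneg_eq_0_iff_AE[OF iF] F0 by simp
  then show ?thesis
  proof (rule AE_mp, intro AE_I2 impI)
    fix x assume "F x = 0"
    then show "\<sigma> * (u x - S x) \<le> 0"
      using flat_pos[of "\<sigma> * (u x - S x)" 0] by (force simp: F_def)
  qed
qed

section \<open>Barriers\<close>

lemma c1_on_const: "c1_on U (\<lambda>_. c) (\<lambda>_. 0)"
  by (auto simp: c1_on_def)

lemma c1_on_add:
  "c1_on U f g \<Longrightarrow> c1_on U f' g' \<Longrightarrow> c1_on U (\<lambda>x. f x + f' x) (\<lambda>x. g x + g' x)"
  unfolding c1_on_def by (auto intro!: continuous_intros has_derivative_eq_rhs[OF has_derivative_add] simp: inner_add_left)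

lemma c1_on_sum:
  "finite I \<Longrightarrow> (\<And>i. i \<in> I \<Longrightarrow> c1_on U (f i) (g i)) \<Longrightarrow> c1_on U (\<lambda>x. \<Sum>i\<in>I. f i x) (\<lambda>x. \<Sum>i\<in>I. g i x)"
  by (induction I rule: finite_induct) (auto intro: c1_on_add c1_on_const)

lemma c1_on_cong: 
  assumes "open U" "\<And>x. x \<in> U \<Longrightarrow> f x = f' x" "\<And>x. x \<in> U \<Longrightarrow> g x = g' x" "c1_on U f g"
  shows "c1_on U f' g'"
  unfolding c1_on_def
proof (intro conjI ballI)
  fix x assume x: "x \<in> U"
  show "(f' has_derivative (\<lambda>h. g' x \<bullet> h)) (at x)"
    using has_derivative_transform_within_open[OF c1_onD[OF assms(4) x] assms(1) x assms(2)] assms(3)[OF x] by simp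
qed (use c1_on_continuous_grad[OF assms(4)] assms(3) in \<open>rule continuous_on_eq\<close>)

lemma c2_onD: "c2_on U f g H \<Longrightarrow> c1_on U f g" "c2_on U f g H \<Longrightarrow> b \<in> Basis \<Longrightarrow> c1_on U (\<lambda>x. g x \<bullet> b) (H b)"
  by (auto simp: c2_on_def)

lemma c2_on_subset: "c2_on U f g H \<Longrightarrow> V \<subseteq> U \<Longrightarrow> c2_on V f g H"
  by (auto simp: c2_on_def intro: c1_on_subset)

lemma continuous_on_lapl: "c2_on U f g H \<Longrightarrow> continuous_on U (lapl H)"
  unfolding lapl_def[abs_def] by (intro continuous_intros c1_on_continuous_grad[OF c2_onD(2)])

lemma c2_on_diff:
  assumes "c2_on U f g H" "c2_on U f' g' H'"
  shows "c2_on U (\<lambda>x. f x - f' x) (\<lambda>x. g x - g' x) (\<lambda>b x. H b x - H' b x)"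
  using assms by (auto simp: c2_on_def inner_diff_left intro: c1_on_diff)

lemma c2_on_cmult:
  assumes "c2_on U f g H"
  shows "c2_on U (\<lambda>x. c * f x) (\<lambda>x. c *\<^sub>R g x) (\<lambda>b x. c *\<^sub>R H b x)"
  using assms by (auto simp: c2_on_def intro: c1_on_cmult)

lemma c2_on_mult:
  assumes "c2_on U f g H" "c2_on U f' g' H'"
  shows "c2_on U (\<lambda>x. f x * f' x) (\<lambda>x. f x *\<^sub>R g' x + f' x *\<^sub>R g x)
    (\<lambda>b x. (f x *\<^sub>R H' b x + (g' x \<bullet> b) *\<^sub>R g x) + (f' x *\<^sub>R H b x + (g x \<bullet> b) *\<^sub>R g' x))"
  unfolding c2_on_def
proof (intro conjI ballI)
  show "c1_on U (\<lambda>x. f x * f' x) (\<lambda>x. f x *\<^sub>R g' x + f' x *\<^sub>R g x)"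
    by (intro c1_on_mult c2_onD(1)[OF assms(1)] c2_onD(1)[OF assms(2)])
  fix b :: 'a assume b: "b \<in> Basis"
  show "c1_on U (\<lambda>x. (f x *\<^sub>R g' x + f' x *\<^sub>R g x) \<bullet> b)
    (\<lambda>x. (f x *\<^sub>R H' b x + (g' x \<bullet> b) *\<^sub>R g x) + (f' x *\<^sub>R H b x + (g x \<bullet> b) *\<^sub>R g' x))"
    unfolding inner_add_left inner_scaleR_left
    by (intro c1_on_add c1_on_mult c2_onD(1)[OF assms(1)] c2_onD(1)[OF assms(2)] 
          c2_onD(2)[OF assms(1) b] c2_onD(2)[OF assms(2) b])
qed

lemma c2_on_const: "c2_on U (\<lambda>_. c) (\<lambda>_. 0) (\<lambda>_ _. 0)"
  by (auto simp: c2_on_def intro: c1_on_const)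

lemma c2_on_inner: "c2_on U (\<lambda>x. x \<bullet> a) (\<lambda>_. a) (\<lambda>_ _. 0)"
  by (auto simp: c2_on_def c1_on_def inner_commute intro!: derivative_eq_intros)

lemma c2_on_compose_real:
  assumes f: "c2_on U f g H" 
    and \<theta>: "\<And>x. x \<in> U \<Longrightarrow> (\<theta> has_real_derivative \<theta>' (f x)) (at (f x))" 
      "\<And>x. x \<in> U \<Longrightarrow> (\<theta>' has_real_derivative \<theta>'' (f x)) (at (f x))" 
      "continuous_on (f ` U) \<theta>'" "continuous_on (f ` U) \<theta>''"
  shows "c2_on U (\<lambda>x. \<theta> (f x)) (\<lambda>x. \<theta>' (f x) *\<^sub>R g x) 
     (\<lambda>b x. \<theta>' (f x) *\<^sub>R H b x + (g x \<bullet> b) *\<^sub>R (\<theta>'' (f x) *\<^sub>R g x))"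
  unfolding c2_on_def
proof (intro conjI ballI)
  show "c1_on U (\<lambda>x. \<theta> (f x)) (\<lambda>x. \<theta>' (f x) *\<^sub>R g x)"
    by (intro c1_on_compose_real c2_onD(1)[OF f] \<theta>)
  fix b :: 'a assume b: "b \<in> Basis"
  show "c1_on U (\<lambda>x. (\<theta>' (f x) *\<^sub>R g x) \<bullet> b) 
     (\<lambda>x. \<theta>' (f x) *\<^sub>R H b x + (g x \<bullet> b) *\<^sub>R (\<theta>'' (f x) *\<^sub>R g x))"
    unfolding inner_scaleR_left
    by (intro c1_on_mult c1_on_compose_real c2_onD(1)[OF f] c2_onD(2)[OF f b] \<theta>)
qed

lemma lapl_compose_real:
  "lapl (\<lambda>b x. \<theta>' (f x) *\<^sub>R H b x + (g x \<bullet> b) *\<^sub>R (\<theta>'' (f x) *\<^sub>R g x)) x = 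
     \<theta>' (f x) * lapl H x + \<theta>'' (f x) * (g x \<bullet> g x)"
proof -
  have "(\<Sum>b\<in>Basis. (g x \<bullet> b) * (\<theta>'' (f x) * (g x \<bullet> b))) = \<theta>'' (f x) * (g x \<bullet> g x)"
    by (subst euclidean_inner[of "g x" "g x"]) (simp add: sum_distrib_left mult_ac)
  then show ?thesis
    by (simp add: lapl_def inner_add_left sum.distrib sum_distrib_left mult.assoc)
qed

section \<open>Truncated barriers and comparison with them\<close>

text \<open>Since \<open>ppart d\<close> and its first two derivatives vanish at nonpositive
  arguments, the truncation extends by zero as a C^2 function. The term of the chain rule with
  \<open>ppart''\<close> is nonnegative by convexity and is dropped, hence the one-sided bound on
  the Laplacian.\<close>

lemma c2_on_ppart_glue:
  assumes q: "c2_on U q g H" and U: "open U" "U \<subseteq> \<Omega>" and C: "open (\<Omega> - C)" "C \<subseteq> U" 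
    and z: "\<And>x. x \<in> U - C \<Longrightarrow> q x \<le> 0" and d: "0 < d"
  obtains g' H' where "c2_on \<Omega> (\<lambda>x. if x \<in> U then ppart d (q x) else 0) g' H'"
    "\<And>x. x \<in> U \<Longrightarrow> ppart' d (q x) * lapl H x \<le> lapl H' x"
    "\<And>x. x \<notin> U \<Longrightarrow> lapl H' x = 0"
proof -
  let ?g = "\<lambda>x. ppart' d (q x) *\<^sub>R g x"
  let ?H = "\<lambda>b x. ppart' d (q x) *\<^sub>R H b x + (g x \<bullet> b) *\<^sub>R (ppart'' d (q x) *\<^sub>R g x)"
  have 2: "c2_on U (\<lambda>x. ppart d (q x)) ?g ?H"
    by (rule c2_on_compose_real[OF q ppart_deriv[OF d] ppart'_deriv[OF d]]) (auto intro!: continuous_intros)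
  let ?g' = "\<lambda>x. if x \<in> U then ?g x else 0"
  let ?H' = "\<lambda>b x. if x \<in> U then ?H b x else 0"
  show ?thesis
  proof (rule that)
    show "c2_on \<Omega> (\<lambda>x. if x \<in> U then ppart d (q x) else 0) ?g' ?H'"
      unfolding c2_on_def
    proof (intro conjI ballI)
      show "c1_on \<Omega> (\<lambda>x. if x \<in> U then ppart d (q x) else 0) ?g'"
        by (rule c1_on_glue[OF c2_onD(1)[OF 2] U C]) (use z d in auto)
      fix b :: 'a assume b: "b \<in> Basis"
      have "c1_on \<Omega> (\<lambda>x. if x \<in> U then ?g x \<bullet> b else 0) (?H' b)"
        by (rule c1_on_glue[OF c2_onD(2)[OF 2 b] U C]) (use z d in auto)
      also have "(\<lambda>x. if x \<in> U then ?g x \<bullet> b else 0) = (\<lambda>x. ?g' x \<bullet> b)" by auto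
      finally show "c1_on \<Omega> (\<lambda>x. ?g' x \<bullet> b) (?H' b)" .
    qed
    show "ppart' d (q x) * lapl H x \<le> lapl ?H' x" if "x \<in> U" for x
    proof -
      have "lapl ?H' x = lapl ?H x" using that by (simp add: lapl_def)
      also have "\<dots> = ppart' d (q x) * lapl H x + ppart'' d (q x) * (g x \<bullet> g x)"
        by (rule lapl_compose_real)
      finally show ?thesis using ppart''_nonneg[OF d] by simp
    qed
    show "lapl ?H' x = 0" if "x \<notin> U" for x using that by (simp add: lapl_def)
  qed
qed

text \<open>Compactness of the superlevel sets replaces a boundary condition: near the boundary of
  \<open>U\<close> the barrier stays below any positive level. Lowering \<open>w\<close> by
  \<open>e\<close> and truncating gives a compactly supported C^2 function on \<Omega> with
  Laplacian at least -1; then \<open>d\<close> and \<open>e\<close> tend to zero.\<close>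

theorem lower_barrier:
  fixes \<Omega> :: "'b::euclidean_space set"
  assumes \<Omega>: "open \<Omega>" "bounded \<Omega>" and u: "torsion_function \<Omega> u"
    and U: "open U" "U \<subseteq> \<Omega>" and w: "c2_on U w g H" "\<And>x. x \<in> U \<Longrightarrow> -1 \<le> lapl H x"
    and cpt: "\<And>d. 0 < d \<Longrightarrow> compact {x \<in> U. d \<le> w x}"
  shows "AE x in lebesgue_on \<Omega>. x \<in> U \<longrightarrow> w x \<le> u x"
proof -
  have *: "AE x in lebesgue_on \<Omega>. x \<in> U \<longrightarrow> ppart d (w x - e) \<le> u x" if d: "0 < d" and e: "0 < e" for d e
  proof -
    let ?C = "{x \<in> U. e \<le> w x}"
    have C: "open (\<Omega> - ?C)" "?C \<subseteq> U"
      using \<Omega>(1) compact_imp_closed[OF cpt[OF e]] by auto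
    have z: "w x - e \<le> 0" if "x \<in> U - ?C" for x using that by auto
    obtain g' H' where S: "c2_on \<Omega> (\<lambda>x. if x \<in> U then ppart d (w x - e) else 0) g' H'"
       "\<And>x. x \<in> U \<Longrightarrow> ppart' d (w x - e) * lapl (\<lambda>b x. H b x - 0) x \<le> lapl H' x" 
       "\<And>x. x \<notin> U \<Longrightarrow> lapl H' x = 0"
      using c2_on_ppart_glue[OF c2_on_diff[OF w(1) c2_on_const[of U e]] U C z d] by blast
    have lap: "-1 * (lapl H' x + 1) \<le> 0" if "x \<in> \<Omega>" for x
    proof (cases "x \<in> U")
      case True
      have "ppart' d (w x - e) * (- 1) \<le> ppart' d (w x - e) * lapl H x"
        by (intro mult_left_mono w(2) True ppart'_nonneg)
      then show ?thesis using S(2)[OF True] ppart'_le1[OF d, of "w x - e"] by (simp add: lapl_def)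
    qed (simp add: S(3))
    have "AE x in lebesgue_on \<Omega>. -1 * (u x - (if x \<in> U then ppart d (w x - e) else 0)) \<le> 0"
      by (rule comparison[OF \<Omega> u _ S(1) lap cpt[OF e]]) (use U d in auto)
    then show ?thesis by (rule AE_mp) (auto intro!: AE_I2)
  qed
  \<comment> \<open>Both parameters run through sequences, so that the exceptional null sets can be
    united.\<close>
  have "AE x in lebesgue_on \<Omega>. \<forall>m k. x \<in> U \<longrightarrow> ppart (1 / real (Suc k)) (w x - 1 / real (Suc m)) \<le> u x"
    unfolding AE_all_countable by (intro allI *) auto
  then show ?thesis
  proof (rule AE_mp, intro AE_I2 impI)
    fix x assume x: "\<forall>m k. x \<in> U \<longrightarrow> ppart (1 / real (Suc k)) (w x - 1 / real (Suc m)) \<le> u x" "x \<in> U"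
    have "max (w x - 1 / real (Suc m)) 0 \<le> u x" for m
      by (rule LIMSEQ_le_const2[OF ppart_tendsto]) (use x in auto)
    then have "w x - 1 / real (Suc m) \<le> u x" for m
      by (meson max.boundedE)
    moreover have "(\<lambda>m. w x - 1 / real (Suc m)) \<longlonglongrightarrow> w x - 0"
      by (intro tendsto_intros LIMSEQ_inverse_real_of_nat[unfolded inverse_eq_divide])
    ultimately show "w x \<le> u x"
      using LIMSEQ_le_const2 by fastforce
  qed
qed

lemma c2_on_norm_square: "c2_on U (\<lambda>x. x \<bullet> x) (\<lambda>x. 2 *\<^sub>R x) (\<lambda>b _. 2 *\<^sub>R b)"
  unfolding c2_on_def
proof (intro conjI ballI)
  show "c1_on U (\<lambda>x. x \<bullet> x) (\<lambda>x. 2 *\<^sub>R x)"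
    by (auto simp: c1_on_def inner_commute intro!: derivative_eq_intros continuous_intros)
  fix b :: 'a
  show "c1_on U (\<lambda>x. (2 *\<^sub>R x) \<bullet> b) (\<lambda>_. 2 *\<^sub>R b)"
    by (auto simp: c1_on_def inner_commute intro!: derivative_eq_intros continuous_intros)
qed

text \<open>The paraboloid \<open>B\<close> has Laplacian -1 and values in [0, R^2] on \<Omega>. The
  minimum of \<open>B\<close> and \<open>v\<close> is \<open>B\<close> minus the positive part of
  \<open>B - v\<close>; smoothing by a convex function keeps the Laplacian at most -1. On
  \<open>U - C\<close>, where \<open>v\<close> is at least R^2, it coincides with \<open>B\<close>
  and so continues to all of \<Omega>.\<close>

theorem upper_barrier:
  fixes \<Omega> :: "'b::euclidean_space set"
  assumes \<Omega>: "open \<Omega>" "bounded \<Omega>" and u: "torsion_function \<Omega> u"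
    and U: "open U" "U \<subseteq> \<Omega>" and v: "c2_on U v g H" "\<And>x. x \<in> U \<Longrightarrow> lapl H x \<le> -1" "\<And>x. x \<in> U \<Longrightarrow> 0 \<le> v x"
    and R: "\<And>x. x \<in> \<Omega> \<Longrightarrow> norm x \<le> R"
    and C: "open (\<Omega> - C)" "C \<subseteq> U" "\<And>x. x \<in> U - C \<Longrightarrow> R\<^sup>2 \<le> v x"
  shows "AE x in lebesgue_on \<Omega>. x \<in> U \<longrightarrow> u x \<le> v x"
proof -
  define n where "n = real DIM('b)"
  have n: "1 \<le> n" using DIM_positive[where 'a = 'b] by (simp add: n_def Suc_le_eq)
  define B where "B = (\<lambda>x :: 'b. (1 / (2 * n)) * (R\<^sup>2 - x \<bullet> x))"
  have B: "c2_on W B (\<lambda>x. (1 / (2 * n)) *\<^sub>R (0 - 2 *\<^sub>R x)) (\<lambda>b x. (1 / (2 * n)) *\<^sub>R (0 - 2 *\<^sub>R b))" for W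
    unfolding B_def by (intro c2_on_cmult c2_on_diff c2_on_const c2_on_norm_square)
  let ?HB = "\<lambda>b x :: 'b. (1 / (2 * n)) *\<^sub>R (0 - 2 *\<^sub>R b)"
  have lB: "lapl ?HB x = - 1" for x
    using n by (simp add: lapl_def n_def sum_negf)
  have B0: "0 \<le> B x" "B x \<le> R\<^sup>2" if "x \<in> \<Omega>" for x
  proof -
    have "x \<bullet> x \<le> R\<^sup>2" using R[OF that] by (metis norm_ge_zero power2_norm_eq_inner power_mono)
    then show "0 \<le> B x" using n by (simp add: B_def)
    have "B x \<le> (1 / (2 * n)) * R\<^sup>2" unfolding B_def using n by (intro mult_left_mono) auto
    also have "\<dots> \<le> 1 * R\<^sup>2" using n by (intro mult_right_mono) auto
    finally show "B x \<le> R\<^sup>2" by simp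
  qed
  have *: "AE x in lebesgue_on \<Omega>. x \<in> U \<longrightarrow> u x \<le> B x - ppart d (B x - v x)" if d: "0 < d" for d
  proof -
    have z: "B x - v x \<le> 0" if "x \<in> U - C" for x
      using C(3)[OF that] B0(2)[of x] that U(2) by auto
    obtain g' H' where S: "c2_on \<Omega> (\<lambda>x. if x \<in> U then ppart d (B x - v x) else 0) g' H'"
       "\<And>x. x \<in> U \<Longrightarrow> ppart' d (B x - v x) * lapl (\<lambda>b x. ?HB b x - H b x) x \<le> lapl H' x" 
       "\<And>x. x \<notin> U \<Longrightarrow> lapl H' x = 0"
      using c2_on_ppart_glue[OF c2_on_diff[OF B v(1)] U C(1,2) z d] by blast
    have lap: "1 * (lapl (\<lambda>b x. ?HB b x - H' b x) x + 1) \<le> 0" if "x \<in> \<Omega>" for x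
    proof -
      have "lapl (\<lambda>b x. ?HB b x - H' b x) x = - 1 - lapl H' x"
        using lB[of x] by (simp add: lapl_def inner_diff_left sum_subtractf)
      moreover have "0 \<le> lapl H' x"
      proof (cases "x \<in> U")
        case True
        have "lapl (\<lambda>b x. ?HB b x - H b x) x = - 1 - lapl H x"
          using lB[of x] by (simp add: lapl_def inner_diff_left sum_subtractf)
        then have "0 \<le> ppart' d (B x - v x) * lapl (\<lambda>b x. ?HB b x - H b x) x"
          using v(2)[OF True] by (intro mult_nonneg_nonneg ppart'_nonneg) auto
        then show ?thesis using S(2)[OF True] by linarith
      qed (simp add: S(3))
      ultimately show ?thesis by simp
    qed
    \<comment> \<open>The exceptional compact set can be empty: the smoothed minimum lies above the
      minimum of \<open>B\<close> and \<open>v\<close>, hence is nonnegative throughout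
      \<Omega>.\<close>
    have "AE x in lebesgue_on \<Omega>. 1 * (u x - (B x - (if x \<in> U then ppart d (B x - v x) else 0))) \<le> 0"
    proof (rule comparison[OF \<Omega> u _ c2_on_diff[OF B S(1)] lap compact_empty])
      fix x assume "x \<in> \<Omega> - {}"
      then show "0 \<le> 1 * (B x - (if x \<in> U then ppart d (B x - v x) else 0))"
        using ppart_le[OF d, of "B x - v x"] B0(1)[of x] v(3)[of x] by auto
    qed auto
    then show ?thesis by (rule AE_mp) (auto intro!: AE_I2)
  qed
  have "AE x in lebesgue_on \<Omega>. \<forall>k. x \<in> U \<longrightarrow> u x \<le> B x - ppart (1 / real (Suc k)) (B x - v x)"
    unfolding AE_all_countable by (intro allI *) auto
  then show ?thesis
  proof (rule AE_mp, intro AE_I2 impI)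
    fix x assume x: "\<forall>k. x \<in> U \<longrightarrow> u x \<le> B x - ppart (1 / real (Suc k)) (B x - v x)" "x \<in> U"
    have "u x \<le> B x - max (B x - v x) 0"
      by (rule LIMSEQ_le_const[OF tendsto_diff[OF tendsto_const ppart_tendsto]]) (use x in auto)
    then show "u x \<le> v x" by linarith
  qed
qed

section \<open>Invariance of the Laplacian under rigid motions\<close>

lemma orthogonal_transformation_inverse:
  fixes A :: "'b::euclidean_space \<Rightarrow> 'b"
  assumes A: "orthogonal_transformation A"
  obtains B where "orthogonal_transformation B" "\<And>x. A (B x) = x" "\<And>x. B (A x) = x" "\<And>v h. B v \<bullet> h = v \<bullet> A h"
proof -
  have B: "orthogonal_transformation (inv A)" by (rule orthogonal_transformation_inv[OF A])
  have bij: "bij A" by (rule orthogonal_transformation_bij[OF A])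
  have AB: "A (inv A x) = x" for x using bij by (simp add: bij_is_surj surj_f_inv_f)
  have BA: "inv A (A x) = x" for x using bij by (simp add: bij_is_inj inv_f_f)
  have "inv A v \<bullet> h = v \<bullet> A h" for v h
    using A AB[of v] unfolding orthogonal_transformation_def by metis
  then show ?thesis using that B AB BA by blast
qed

text \<open>The Laplacian is the trace of the Hessian: after exchanging the sums, the inner one is
  the coordinate expansion of an inner product of two images under \<open>B\<close>, and
  \<open>B\<close> is orthogonal.\<close>

lemma c2_on_rigid:
  fixes A :: "'b::euclidean_space \<Rightarrow> 'b"
  assumes A: "orthogonal_transformation A" and f: "c2_on V f g H"
  obtains g' H' where "c2_on {x. A (x - p) \<in> V} (\<lambda>x. f (A (x - p))) g' H'" 
    "\<And>x. lapl H' x = lapl H (A (x - p))"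
proof -
  obtain B where B: "orthogonal_transformation B" "\<And>x. A (B x) = x" "\<And>x. B (A x) = x" "\<And>v h. B v \<bullet> h = v \<bullet> A h"
    using orthogonal_transformation_inverse[OF A] by blast
  have linA: "bounded_linear A" and linB: "bounded_linear B"
    using A B(1) by (auto simp: orthogonal_transformation_linear linear_conv_bounded_linear[symmetric])
  have c1: "c1_on {x. A (x - p) \<in> V} (\<lambda>x. f (A (x - p))) (\<lambda>x. B (g (A (x - p))))" if "c1_on V f g" for f g
    unfolding c1_on_def
  proof (intro conjI ballI)
    fix x assume x: "x \<in> {x. A (x - p) \<in> V}"
    have "((\<lambda>x. A (x - p)) has_derivative A) (at x)"
      by (rule has_derivative_eq_rhs[OF bounded_linear.has_derivative[OF linA]]) (auto intro!: derivative_eq_intros)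
    then have "((\<lambda>x. f (A (x - p))) has_derivative (\<lambda>h. g (A (x - p)) \<bullet> A h)) (at x)"
      by (rule has_derivative_compose) (use c1_onD[OF that] x in auto)
    then show "((\<lambda>x. f (A (x - p))) has_derivative (\<lambda>h. B (g (A (x - p))) \<bullet> h)) (at x)"
      by (simp add: B(4))
  next
    show "continuous_on {x. A (x - p) \<in> V} (\<lambda>x. B (g (A (x - p))))"
      by (intro bounded_linear.continuous_on[OF linB] continuous_on_compose2[OF c1_on_continuous_grad[OF that]]
          bounded_linear.continuous_on[OF linA] continuous_intros) auto
  qed
  let ?H' = "\<lambda>b x. \<Sum>c\<in>Basis. (c \<bullet> A b) *\<^sub>R B (H c (A (x - p)))"
  show ?thesis
  proof (rule that)
    show "c2_on {x. A (x - p) \<in> V} (\<lambda>x. f (A (x - p))) (\<lambda>x. B (g (A (x - p)))) ?H'"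
      unfolding c2_on_def
    proof (intro conjI ballI c1 c2_onD(1)[OF f])
      fix b :: 'b
      have "c1_on {x. A (x - p) \<in> V} (\<lambda>x. \<Sum>c\<in>Basis. (c \<bullet> A b) * (g (A (x - p)) \<bullet> c)) (?H' b)"
        by (intro c1_on_sum c1_on_cmult c1 c2_onD(2)[OF f]) auto
      also have "(\<lambda>x. \<Sum>c\<in>Basis. (c \<bullet> A b) * (g (A (x - p)) \<bullet> c)) = (\<lambda>x. B (g (A (x - p))) \<bullet> b)"
        unfolding B(4) by (subst (2) euclidean_inner) (simp add: inner_commute mult.commute)
      finally show "c1_on {x. A (x - p) \<in> V} (\<lambda>x. B (g (A (x - p))) \<bullet> b) (?H' b)" .
    qed
    show "lapl ?H' x = lapl H (A (x - p))" for x
    proof -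
      have "lapl ?H' x = (\<Sum>b\<in>Basis. \<Sum>c\<in>Basis. (B c \<bullet> b) * (B (H c (A (x - p))) \<bullet> b))"
        by (simp add: lapl_def inner_sum_left B(4))
      also have "\<dots> = (\<Sum>c\<in>Basis. \<Sum>b\<in>Basis. (B c \<bullet> b) * (B (H c (A (x - p))) \<bullet> b))"
        by (rule sum.swap)
      also have "\<dots> = (\<Sum>c\<in>Basis. B c \<bullet> B (H c (A (x - p))))"
        by (intro sum.cong refl euclidean_inner[symmetric])
      also have "\<dots> = (\<Sum>c\<in>Basis. c \<bullet> H c (A (x - p)))"
        using B(1) by (simp add: orthogonal_transformation_def)
      finally show ?thesis by (simp add: lapl_def inner_commute)
    qed
  qed
qed

section \<open>Rigid motions and slice integrals\<close>

lemma nn_integral_lborel_translate: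
  fixes f :: "'b::euclidean_space \<Rightarrow> ennreal"
  assumes [measurable]: "f \<in> borel_measurable borel"
  shows "(\<integral>\<^sup>+x. f (x + c) \<partial>lborel) = (\<integral>\<^sup>+x. f x \<partial>lborel)"
proof -
  have "(\<integral>\<^sup>+x. f x \<partial>lborel) = (\<integral>\<^sup>+x. f x \<partial>distr lborel borel ((+) c))"
    by (simp only: lborel_distr_plus)
  also have "\<dots> = (\<integral>\<^sup>+x. f (x + c) \<partial>lborel)"
    by (subst nn_integral_distr) (auto simp: add.commute)
  finally show ?thesis by simp
qed

lemma nn_integral_lborel_reflect:
  fixes f :: "'b::euclidean_space \<Rightarrow> ennreal"
  assumes [measurable]: "f \<in> borel_measurable borel"
  shows "(\<integral>\<^sup>+x. f (c - x) \<partial>lborel) = (\<integral>\<^sup>+x. f x \<partial>lborel)"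
proof -
  have "(\<integral>\<^sup>+x. f x \<partial>lborel) = (\<integral>\<^sup>+x. f x \<partial>density (distr lborel borel (\<lambda>x. c + (- 1) *\<^sub>R x)) (\<lambda>_. ennreal (\<bar>- 1 :: real\<bar> ^ DIM('b))))"
    by (subst lborel_affine[of "- 1" c]) auto
  also have "\<dots> = (\<integral>\<^sup>+x. f (c - x) \<partial>lborel)"
    by (simp add: density_1 nn_integral_distr)
  finally show ?thesis by simp
qed

text \<open>Uniqueness of the Haar measure: for a translation invariant measure \<open>\<mu>\<close> Tonelli's theorem gives
  \<open>\<lambda>(f) * \<mu>(ub) = \<lambda>(ub) * \<mu>(f)\<close>; here \<open>\<mu>\<close> is the image of \<open>\<lambda>\<close> under \<open>A\<close> and \<open>ub\<close> the indicator of the unit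
  ball, for which \<open>\<mu>(ub) = \<lambda>(ub)\<close>.\<close>

lemma nn_integral_orthogonal_transformation:
  fixes f :: "'b::euclidean_space \<Rightarrow> ennreal" and A :: "'b \<Rightarrow> 'b"
  assumes A: "orthogonal_transformation A" and [measurable]: "f \<in> borel_measurable borel"
  shows "(\<integral>\<^sup>+x. f (A x) \<partial>lborel) = (\<integral>\<^sup>+x. f x \<partial>lborel)"
proof -
  obtain B where "orthogonal_transformation B" and B: "\<And>x. A (B x) = x" "\<And>x. B (A x) = x" 
    and "\<And>v h. B v \<bullet> h = v \<bullet> A h"
    using orthogonal_transformation_inverse[OF A] by blast
  have linA: "linear A" using A by (simp add: orthogonal_transformation_linear)
  have [measurable]: "A \<in> borel_measurable borel"
    by (intro borel_measurable_continuous_onI linear_continuous_on linA[unfolded linear_conv_bounded_linear])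
  define ub :: "'b \<Rightarrow> ennreal" where "ub = indicator (ball 0 1)"
  have [measurable]: "ub \<in> borel_measurable borel" unfolding ub_def by (rule borel_measurable_indicator) simp
  have ubA: "ub (A x) = ub x" for x
    using A by (simp add: ub_def indicator_def orthogonal_transformation_norm)
  \<comment> \<open>Adding \<open>x\<close> after \<open>A\<close> amounts to adding
    \<open>B x\<close> before it: the image measure is translation invariant.\<close>
  have inv: "(\<integral>\<^sup>+y. g (A y + x) \<partial>lborel) = (\<integral>\<^sup>+y. g (A y) \<partial>lborel)" 
    if [measurable]: "g \<in> borel_measurable borel" for g :: "'b \<Rightarrow> ennreal" and x
  proof -
    have "(\<integral>\<^sup>+y. g (A (y + B x)) \<partial>lborel) = (\<integral>\<^sup>+y. g (A y) \<partial>lborel)"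
      by (rule nn_integral_lborel_translate) measurable
    then show ?thesis using linA B by (simp add: linear_add)
  qed
  define c where "c = (\<integral>\<^sup>+x. ub x \<partial>lborel)"
  have c: "c \<noteq> 0" "c \<noteq> \<infinity>"
  proof -
    have "c = ennreal (unit_ball_vol (real DIM('b)))"
      unfolding c_def ub_def by (simp add: emeasure_ball)
    moreover have "0 < unit_ball_vol (real DIM('b))" by (simp add: unit_ball_vol_pos)
    ultimately show "c \<noteq> 0" "c \<noteq> \<infinity>" by (simp_all add: ennreal_eq_0_iff not_le)
  qed
  have "(\<integral>\<^sup>+x. f x \<partial>lborel) * c = (\<integral>\<^sup>+x. f x * c \<partial>lborel)"
    by (simp add: nn_integral_multc)
  also have "\<dots> = (\<integral>\<^sup>+x. \<integral>\<^sup>+y. f x * ub (A y - x) \<partial>lborel \<partial>lborel)"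
  proof (rule nn_integral_cong)
    fix x
    have "c = (\<integral>\<^sup>+y. ub (A y) \<partial>lborel)" by (simp add: c_def ubA)
    also have "\<dots> = (\<integral>\<^sup>+y. ub (A y - x) \<partial>lborel)"
      using inv[of ub "- x"] by simp
    finally show "f x * c = (\<integral>\<^sup>+y. f x * ub (A y - x) \<partial>lborel)"
      by (simp add: nn_integral_cmult)
  qed
  also have "\<dots> = (\<integral>\<^sup>+y. \<integral>\<^sup>+x. f x * ub (A y - x) \<partial>lborel \<partial>lborel)"
    by (rule lborel_pair.Fubini') measurable
  also have "\<dots> = (\<integral>\<^sup>+y. \<integral>\<^sup>+z. f (A y - z) * ub z \<partial>lborel \<partial>lborel)"
  proof (rule nn_integral_cong)
    fix y
    have "(\<integral>\<^sup>+x. f (A y - (A y - x)) * ub (A y - x) \<partial>lborel) = (\<integral>\<^sup>+z. f (A y - z) * ub z \<partial>lborel)"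
      by (rule nn_integral_lborel_reflect) measurable
    then show "(\<integral>\<^sup>+x. f x * ub (A y - x) \<partial>lborel) = (\<integral>\<^sup>+z. f (A y - z) * ub z \<partial>lborel)" by simp
  qed
  also have "\<dots> = (\<integral>\<^sup>+z. \<integral>\<^sup>+y. f (A y - z) * ub z \<partial>lborel \<partial>lborel)"
    by (rule lborel_pair.Fubini') measurable
  also have "\<dots> = (\<integral>\<^sup>+z. (\<integral>\<^sup>+y. f (A y) \<partial>lborel) * ub z \<partial>lborel)"
  proof (rule nn_integral_cong)
    fix z
    show "(\<integral>\<^sup>+y. f (A y - z) * ub z \<partial>lborel) = (\<integral>\<^sup>+y. f (A y) \<partial>lborel) * ub z"
      using inv[of f "- z"] by (simp add: nn_integral_multc)
  qed
  also have "\<dots> = (\<integral>\<^sup>+y. f (A y) \<partial>lborel) * c"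
    by (simp add: nn_integral_cmult c_def)
  finally show ?thesis
    using c by (simp add: mult.commute[of _ c] ennreal_mult_cancel_left)
qed

lemma nn_integral_rigid:
  fixes f :: "'b::euclidean_space \<Rightarrow> ennreal" and A :: "'b \<Rightarrow> 'b"
  assumes A: "orthogonal_transformation A" and f: "f \<in> borel_measurable borel"
  shows "(\<integral>\<^sup>+x. f (A (x - p)) \<partial>lborel) = (\<integral>\<^sup>+x. f x \<partial>lborel)"
proof -
  have linA: "linear A" using A by (simp add: orthogonal_transformation_linear)
  have [measurable]: "A \<in> borel_measurable borel"
    by (intro borel_measurable_continuous_onI linear_continuous_on linA[unfolded linear_conv_bounded_linear])
  have "(\<integral>\<^sup>+x. f (A (x + (- p))) \<partial>lborel) = (\<integral>\<^sup>+x. f (A x) \<partial>lborel)"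
    by (rule nn_integral_lborel_translate) (use f in measurable)
  then show ?thesis
    using nn_integral_orthogonal_transformation[OF A f] by simp
qed

lemma nn_integral_lborel_scale:
  fixes f :: "'b::euclidean_space \<Rightarrow> ennreal"
  assumes [measurable]: "f \<in> borel_measurable borel" and r: "0 < r"
  shows "(\<integral>\<^sup>+x. f x \<partial>lborel) = ennreal (r ^ DIM('b)) * (\<integral>\<^sup>+x. f (r *\<^sub>R x) \<partial>lborel)"
proof -
  have "(\<integral>\<^sup>+x. f x \<partial>lborel) = (\<integral>\<^sup>+x. f x \<partial>density (distr lborel borel (\<lambda>x. 0 + r *\<^sub>R x)) (\<lambda>_. \<bar>r\<bar> ^ DIM('b)))"
    by (subst lborel_affine[of r 0]) (use r in auto)
  also have "\<dots> = (\<integral>\<^sup>+x. ennreal (r ^ DIM('b)) * f x \<partial>distr lborel borel (\<lambda>x. 0 + r *\<^sub>R x))"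
    using r by (subst nn_integral_density) auto
  also have "\<dots> = ennreal (r ^ DIM('b)) * (\<integral>\<^sup>+x. f (r *\<^sub>R x) \<partial>lborel)"
    by (subst nn_integral_distr) (auto simp: nn_integral_cmult)
  finally show ?thesis .
qed

section \<open>Integrals of negative powers over balls, slices and intervals\<close>

lemma emeasure_shell_le:
  fixes h :: real
  assumes h: "0 \<le> h" "h \<le> 1"
  shows "emeasure lborel {z :: 'b::euclidean_space. 1 - h \<le> norm z \<and> norm z < 1} 
     \<le> ennreal (unit_ball_vol (real DIM('b)) * (real DIM('b) * h))"
proof -
  let ?n = "DIM('b)" and ?V = "unit_ball_vol (real DIM('b))"
  have V: "0 \<le> ?V" by simp
  have eq: "{z :: 'b. 1 - h \<le> norm z \<and> norm z < 1} = ball 0 1 - ball 0 (1 - h)" by auto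
  have "emeasure lborel (ball (0::'b) 1 - ball 0 (1 - h)) = emeasure lborel (ball (0::'b) 1) - emeasure lborel (ball (0::'b) (1 - h))"
    by (rule emeasure_Diff) (use h in \<open>auto simp: emeasure_ball\<close>)
  also have "\<dots> = ennreal (?V * 1 ^ ?n - ?V * (1 - h) ^ ?n)"
    using h V by (simp add: emeasure_ball ennreal_minus)
  also have "\<dots> \<le> ennreal (?V * (real ?n * h))"
  proof (rule ennreal_leI)
    \<comment> \<open>Bernoulli's inequality makes the volume of a shell at most proportional to its
      thickness.\<close>
    have "1 + real ?n * (- h) \<le> (1 + (- h)) ^ ?n"
      by (rule Bernoulli_inequality) (use h in auto)
    then have "?V * (1 - (1 - h) ^ ?n) \<le> ?V * (real ?n * h)"
      by (intro mult_left_mono V) auto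
    then show "?V * 1 ^ ?n - ?V * (1 - h) ^ ?n \<le> ?V * (real ?n * h)"
      by (simp add: algebra_simps)
  qed
  finally show ?thesis unfolding eq .
qed

lemma dyadic_scale:
  fixes s :: real
  assumes "0 < s" "s \<le> 1"
  obtains j where "(1/2) ^ Suc j < s" "s \<le> (1/2) ^ j"
proof -
  define k where "k = (LEAST k. (1/2::real) ^ k < s)"
  have ex: "\<exists>k. (1/2::real) ^ k < s" using real_arch_pow_inv[of s "1/2"] assms by auto
  have k: "(1/2::real) ^ k < s" unfolding k_def by (rule LeastI_ex[OF ex])
  then have "k \<noteq> 0" using assms by (intro notI) auto
  then obtain j where j: "k = Suc j" using not0_implies_Suc by blast
  have "\<not> (1/2::real) ^ j < s" using not_less_Least[of j "\<lambda>k. (1/2::real) ^ k < s"] j by (auto simp: k_def)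
  then show ?thesis using that[of j] k j by auto
qed

text \<open>Dyadic shells take the place of polar coordinates. At distance between 2^(-j-1) and
  2^(-j) from the sphere the integrand is at most 2^((j+1) \<beta>), the shell has measure
  O(2^(-j)), and the geometric series has ratio 2^\<beta> / 2 < 1.\<close>

lemma nn_integral_ball_powr_finite:
  fixes \<beta> :: real
  assumes \<beta>: "0 < \<beta>" "\<beta> < 1"
  shows "(\<integral>\<^sup>+z. (if norm z < 1 then ennreal ((1 - norm z) powr (- \<beta>)) else 0) \<partial>(lborel :: 'b::euclidean_space measure)) < \<infinity>"
proof -
  let ?V = "unit_ball_vol (real DIM('b))"
  define a where "a j = ((1/2::real) ^ Suc j) powr (- \<beta>)" for j
  \<comment> \<open>The shells reach up to the sphere and are nested; the overlap is harmless for an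
    upper bound.\<close>
  define S where "S j = {z :: 'b. 1 - (1/2) ^ j \<le> norm z \<and> norm z < 1}" for j :: nat
  have S[measurable]: "S j \<in> sets borel" for j
  proof -
    have "S j = ball 0 1 - ball 0 (1 - (1/2) ^ j)" by (auto simp: S_def)
    then show ?thesis by simp
  qed
  have a: "a j = 2 powr \<beta> * (2 powr \<beta>) ^ j" for j
  proof -
    have "a j = (2 ^ Suc j) powr \<beta>"
      by (simp only: a_def power_one_over powr_minus_divide[symmetric]) (simp add: powr_divide powr_minus field_simps)
    also have "\<dots> = (2 powr \<beta>) ^ Suc j"
      by (simp add: powr_realpow[symmetric] powr_powr mult.commute powr_mult flip: power_Suc)
    finally show ?thesis by simp
  qed
  have "(\<integral>\<^sup>+z. (if norm z < 1 then ennreal ((1 - norm z) powr (- \<beta>)) else 0) \<partial>(lborel :: 'b measure))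
      \<le> (\<integral>\<^sup>+z. (\<Sum>j. ennreal (a j) * indicator (S j) z) \<partial>lborel)"
  proof (rule nn_integral_mono)
    fix z :: 'b
    show "(if norm z < 1 then ennreal ((1 - norm z) powr (- \<beta>)) else 0) \<le> (\<Sum>j. ennreal (a j) * indicator (S j) z)"
    proof (cases "norm z < 1")
      case True
      then obtain j where j: "(1/2) ^ Suc j < 1 - norm z" "1 - norm z \<le> (1/2) ^ j"
        using dyadic_scale[of "1 - norm z"] by auto
      have "(1 - norm z) powr (- \<beta>) \<le> a j"
        unfolding a_def using j(1) \<beta> by (intro powr_mono2') auto
      then have "ennreal ((1 - norm z) powr (- \<beta>)) \<le> ennreal (a j) * indicator (S j) z"
        using j(2) True by (auto simp: S_def intro: ennreal_leI)
      also have "\<dots> = (\<Sum>i\<in>{j}. ennreal (a i) * indicator (S i) z)"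
        by (simp only: sum.empty sum.insert finite.emptyI empty_iff not_False_eq_True add_0_right)
      also have "\<dots> \<le> (\<Sum>j. ennreal (a j) * indicator (S j) z)"
        by (rule sum_le_suminf) auto
      finally show ?thesis using True by simp
    qed simp
  qed
  also have "\<dots> = (\<Sum>j. \<integral>\<^sup>+z. ennreal (a j) * indicator (S j) z \<partial>lborel)"
    by (rule nn_integral_suminf) measurable
  also have "\<dots> = (\<Sum>j. ennreal (a j) * emeasure lborel (S j))"
    by (simp add: nn_integral_cmult)
  also have "\<dots> \<le> (\<Sum>j. ennreal (2 powr \<beta> * ?V * real DIM('b) * (2 powr \<beta> / 2) ^ j))"
  proof (rule suminf_le)
    fix j
    have "ennreal (a j) * emeasure lborel (S j) \<le> ennreal (a j) * ennreal (?V * (real DIM('b) * (1/2) ^ j))"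
      unfolding S_def by (intro mult_left_mono emeasure_shell_le) (auto simp: power_le_one)
    also have "\<dots> = ennreal (a j * (?V * (real DIM('b) * (1/2) ^ j)))"
      by (simp add: ennreal_mult[symmetric] a_def)
    also have "a j * (?V * (real DIM('b) * (1/2) ^ j)) = 2 powr \<beta> * ?V * real DIM('b) * (2 powr \<beta> / 2) ^ j"
      unfolding a power_divide by simp
    finally show "ennreal (a j) * emeasure lborel (S j) \<le> ennreal (2 powr \<beta> * ?V * real DIM('b) * (2 powr \<beta> / 2) ^ j)" .
  qed auto
  also have "\<dots> < \<infinity>"
  proof -
    have "2 powr \<beta> < (2::real) powr 1" using \<beta> by (intro powr_less_mono) auto
    then have "summable (\<lambda>j. (2 powr \<beta> / 2) ^ j)" by (intro summable_geometric) simp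
    then have "summable (\<lambda>j. 2 powr \<beta> * ?V * real DIM('b) * (2 powr \<beta> / 2) ^ j)" by (rule summable_mult)
    then have "(\<Sum>j. ennreal (2 powr \<beta> * ?V * real DIM('b) * (2 powr \<beta> / 2) ^ j)) \<noteq> top"
      by (rule ennreal_suminf_neq_top) simp
    then show ?thesis by (simp only: less_top infinity_ennreal_def)
  qed
  finally show ?thesis .
qed

text \<open>Scaling to the unit ball gives R^n from the volume and R^(-2\<beta>) from the integrand,
  n being the dimension of the slice; |x|^2 \<le> |x| reduces the rest to the previous
  integral.\<close>

lemma nn_integral_slice_powr:
  fixes \<beta> c :: real
  assumes \<beta>: "0 < \<beta>" "\<beta> < 1" and c: "0 < c"
  obtains J :: real where "0 \<le> J" 
    "\<And>R. 0 < R \<Longrightarrow> (\<integral>\<^sup>+x. (if norm x < R then ennreal ((c * (R\<^sup>2 - (norm x)\<^sup>2)) powr (- \<beta>)) else 0) \<partial>(lborel :: 'b::euclidean_space measure))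
       \<le> ennreal (J * R powr (real DIM('b) - 2 * \<beta>))"
proof -
  let ?I = "\<integral>\<^sup>+z. (if norm z < 1 then ennreal ((1 - norm z) powr (- \<beta>)) else 0) \<partial>(lborel :: 'b measure)"
  define j where "j = enn2real ?I"
  have j: "?I = ennreal j" "0 \<le> j"
    using nn_integral_ball_powr_finite[OF \<beta>, where 'b = 'b] by (auto simp: j_def)
  show ?thesis
  proof (rule that[of "c powr (- \<beta>) * j"])
    fix R :: real assume R: "0 < R"
    let ?f = "\<lambda>x :: 'b. if norm x < R then ennreal ((c * (R\<^sup>2 - (norm x)\<^sup>2)) powr (- \<beta>)) else 0"
    have "(\<integral>\<^sup>+x. ?f x \<partial>lborel) = ennreal (R ^ DIM('b)) * (\<integral>\<^sup>+x. ?f (R *\<^sub>R x) \<partial>lborel)"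
      by (rule nn_integral_lborel_scale[OF _ R]) measurable
    also have "\<dots> \<le> ennreal (R ^ DIM('b)) * (\<integral>\<^sup>+x. ennreal (c powr (- \<beta>) * R powr (- 2 * \<beta>)) * (if norm x < 1 then ennreal ((1 - norm x) powr (- \<beta>)) else 0) \<partial>(lborel :: 'b measure))"
    proof (intro mult_left_mono nn_integral_mono)
      fix x :: 'b
      show "?f (R *\<^sub>R x) \<le> ennreal (c powr (- \<beta>) * R powr (- 2 * \<beta>)) * (if norm x < 1 then ennreal ((1 - norm x) powr (- \<beta>)) else 0)"
      proof (cases "norm x < 1")
        case True
        have "R\<^sup>2 - (norm (R *\<^sub>R x))\<^sup>2 = R\<^sup>2 * (1 - (norm x)\<^sup>2)"
          by (simp add: power_mult_distrib algebra_simps)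
        moreover have "(norm x)\<^sup>2 \<le> norm x" using True by (simp add: power2_eq_square mult_left_le_one_le)
        ultimately have "(c * (R\<^sup>2 - (norm (R *\<^sub>R x))\<^sup>2)) powr (- \<beta>) \<le> (c * (R\<^sup>2 * (1 - norm x))) powr (- \<beta>)"
          using c R True \<beta> by (intro powr_mono2') auto
        also have "\<dots> = c powr (- \<beta>) * R powr (- 2 * \<beta>) * (1 - norm x) powr (- \<beta>)"
          using c R True by (simp add: powr_mult powr_powr flip: powr_numeral)
        finally show ?thesis using True R
          by (auto simp: ennreal_mult[symmetric] intro!: ennreal_leI)
      qed (use R in auto)
    qed auto
    also have "\<dots> = ennreal (R ^ DIM('b)) * (ennreal (c powr (- \<beta>) * R powr (- 2 * \<beta>)) * ennreal j)"
      by (subst nn_integral_cmult) (auto simp: j(1))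
    also have "\<dots> = ennreal (R ^ DIM('b) * ((c powr (- \<beta>) * R powr (- 2 * \<beta>)) * j))"
      using R j(2) by (simp add: ennreal_mult)
    also have "R ^ DIM('b) * ((c powr (- \<beta>) * R powr (- 2 * \<beta>)) * j) = c powr (- \<beta>) * j * R powr (real DIM('b) - 2 * \<beta>)"
      using R by (simp add: powr_diff powr_minus field_simps powr_realpow)
    finally show "(\<integral>\<^sup>+x. ?f x \<partial>lborel) \<le> ennreal (c powr (- \<beta>) * j * R powr (real DIM('b) - 2 * \<beta>))" .
  qed (use j(2) in auto)
qed

lemma nn_integral_powr_interval:
  fixes \<beta> \<delta> :: real
  assumes "\<beta> < 1" "0 \<le> \<delta>"
  shows "(\<integral>\<^sup>+t. ennreal (t powr (- \<beta>)) * indicator {0..\<delta>} t \<partial>lborel) = ennreal (\<delta> powr (1 - \<beta>) / (1 - \<beta>))"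
  using nn_integral_has_integral_lebesgue'[OF _ has_integral_powr_from_0[of "- \<beta>" \<delta>]] assms by simp

lemma nn_integral_lborel_prod_eq:
  fixes f :: "'a::euclidean_space \<times> 'b::euclidean_space \<Rightarrow> ennreal"
  assumes "f \<in> borel_measurable borel"
  shows "(\<integral>\<^sup>+z. f z \<partial>lborel) = (\<integral>\<^sup>+x. \<integral>\<^sup>+y. f (x, y) \<partial>lborel \<partial>lborel)"
    and "(\<integral>\<^sup>+z. f z \<partial>lborel) = (\<integral>\<^sup>+y. \<integral>\<^sup>+x. f (x, y) \<partial>lborel \<partial>lborel)"
proof -
  have f: "f \<in> borel_measurable (lborel \<Otimes>\<^sub>M lborel)"
    using assms by (simp add: lborel_prod)
  show "(\<integral>\<^sup>+z. f z \<partial>lborel) = (\<integral>\<^sup>+x. \<integral>\<^sup>+y. f (x, y) \<partial>lborel \<partial>lborel)"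
    using lborel.nn_integral_fst[OF f] by (simp add: lborel_prod)
  show "(\<integral>\<^sup>+z. f z \<partial>lborel) = (\<integral>\<^sup>+y. \<integral>\<^sup>+x. f (x, y) \<partial>lborel \<partial>lborel)"
    using lborel_pair.nn_integral_snd[OF f] by (simp add: lborel_prod)
qed

section \<open>Interior points and regular boundary points\<close>

lemma orthogonal_transformation_inj_iff:
  fixes A :: "'b::euclidean_space \<Rightarrow> 'b"
  assumes "orthogonal_transformation A"
  shows "A (x - p) \<in> (\<lambda>x. A (x - p)) ` \<Omega> \<longleftrightarrow> x \<in> \<Omega>"
proof -
  have "inj (\<lambda>x. A (x - p))"
  proof (rule injI)
    fix x y assume "A (x - p) = A (y - p)"
    then have "x - p = y - p" by (rule injD[OF orthogonal_transformation_inj[OF assms]])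
    then show "x = y" by simp
  qed
  then show ?thesis by (rule inj_image_mem_iff)
qed

lemma continuous_on_rigid:
  fixes A :: "'b::euclidean_space \<Rightarrow> 'b"
  assumes "orthogonal_transformation A"
  shows "continuous_on S (\<lambda>x. A (x - p))"
  using assms
  by (intro bounded_linear.continuous_on[of A] continuous_intros)
    (simp add: orthogonal_transformation_linear linear_conv_bounded_linear[symmetric])

lemma open_rigid_vimage:
  fixes A :: "'b::euclidean_space \<Rightarrow> 'b"
  assumes "orthogonal_transformation A" "open U"
  shows "open {x. A (x - p) \<in> U}"
  using continuous_open_preimage[OF continuous_on_rigid[OF assms(1), of UNIV p] open_UNIV assms(2)]
  by (simp add: vimage_def)

lemma compact_rigid_vimage:
  fixes A :: "'b::euclidean_space \<Rightarrow> 'b"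
  assumes A: "orthogonal_transformation A" and K: "compact K"
  shows "compact {x. A (x - p) \<in> K}"
proof -
  obtain B where B: "orthogonal_transformation B" "\<And>x. A (B x) = x" "\<And>x. B (A x) = x" "\<And>v h. B v \<bullet> h = v \<bullet> A h"
    using orthogonal_transformation_inverse[OF A] by blast
  have "{x. A (x - p) \<in> K} = (\<lambda>y. B (y - 0) + p) ` K"
  proof (intro equalityI subsetI)
    fix x assume "x \<in> {x. A (x - p) \<in> K}"
    then show "x \<in> (\<lambda>y. B (y - 0) + p) ` K"
      using B(3) by (intro image_eqI[of _ _ "A (x - p)"]) auto
  qed (use B(2) in auto)
  then show ?thesis
    using K by (auto intro!: compact_continuous_image continuous_intros continuous_on_rigid[OF B(1), of _ 0, simplified])
qed

lemma lower_barrier_rigid: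
  fixes \<Omega> :: "'b::euclidean_space set" and A :: "'b \<Rightarrow> 'b"
  assumes \<Omega>: "open \<Omega>" "bounded \<Omega>" and u: "torsion_function \<Omega> u" and A: "orthogonal_transformation A"
    and U: "open U" "U \<subseteq> (\<lambda>x. A (x - p)) ` \<Omega>" and w: "c2_on U w g H" "\<And>y. y \<in> U \<Longrightarrow> -1 \<le> lapl H y"
    and cpt: "\<And>d. 0 < d \<Longrightarrow> compact {y \<in> U. d \<le> w y}"
  shows "AE x in lebesgue_on \<Omega>. A (x - p) \<in> U \<longrightarrow> w (A (x - p)) \<le> u x"
proof -
  obtain g' H' where w': "c2_on {x. A (x - p) \<in> U} (\<lambda>x. w (A (x - p))) g' H'" 
    "\<And>x. lapl H' x = lapl H (A (x - p))"
    using c2_on_rigid[OF A w(1)] by blast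
  have "AE x in lebesgue_on \<Omega>. x \<in> {x. A (x - p) \<in> U} \<longrightarrow> w (A (x - p)) \<le> u x"
  proof (rule lower_barrier[OF \<Omega> u open_rigid_vimage[OF A U(1)] _ w'(1)])
    show "{x. A (x - p) \<in> U} \<subseteq> \<Omega>"
      using U(2) orthogonal_transformation_inj_iff[OF A] by blast
    show "compact {x \<in> {x. A (x - p) \<in> U}. d \<le> w (A (x - p))}" if "0 < d" for d
      using compact_rigid_vimage[OF A cpt[OF that], of p] by simp
  qed (use w(2) w'(2) in auto)
  then show ?thesis by simp
qed

text \<open>Carries the estimate into the coordinates of the barrier. The majorant \<open>k\<close>
  is a Borel function on the whole space, as required by the change of variables, while
  \<open>w\<close> is controlled on \<open>U\<close> only.\<close>

lemma neg_power_integral_le_rigid: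
  fixes \<Omega> :: "'b::euclidean_space set" and A :: "'b \<Rightarrow> 'b"
  assumes \<Omega>: "open \<Omega>" and A: "orthogonal_transformation A" and \<beta>: "0 < \<beta>"
    and ae: "AE x in lebesgue_on \<Omega>. A (x - p) \<in> U \<longrightarrow> w (A (x - p)) \<le> u x"
    and N: "\<And>y. y \<in> N \<Longrightarrow> y \<in> (\<lambda>x. A (x - p)) ` \<Omega> \<Longrightarrow> y \<in> U \<and> 0 < w y \<and> ennreal (w y powr (- \<beta>)) \<le> k y"
    and k: "k \<in> borel_measurable borel"
  shows "neg_power_integral ({x. A (x - p) \<in> N} \<inter> \<Omega>) u \<beta> \<le> (\<integral>\<^sup>+y. k y \<partial>lborel)"
proof -
  have "AE x in lebesgue. x \<in> \<Omega> \<longrightarrow> A (x - p) \<in> U \<longrightarrow> w (A (x - p)) \<le> u x"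
    using ae \<Omega> by (subst (asm) AE_restrict_space_iff) auto
  then have "AE x in lebesgue. (if 0 < u x then ennreal (u x powr (- \<beta>)) else \<infinity>) * indicator ({x. A (x - p) \<in> N} \<inter> \<Omega>) x \<le> k (A (x - p))"
  proof (rule AE_mp, intro AE_I2 impI)
    fix x assume x: "x \<in> \<Omega> \<longrightarrow> A (x - p) \<in> U \<longrightarrow> w (A (x - p)) \<le> u x"
    show "(if 0 < u x then ennreal (u x powr (- \<beta>)) else \<infinity>) * indicator ({x. A (x - p) \<in> N} \<inter> \<Omega>) x \<le> k (A (x - p))"
    proof (cases "A (x - p) \<in> N \<and> x \<in> \<Omega>")
      case True
      then have *: "A (x - p) \<in> U" "0 < w (A (x - p))" "ennreal (w (A (x - p)) powr (- \<beta>)) \<le> k (A (x - p))"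
        using N[of "A (x - p)"] orthogonal_transformation_inj_iff[OF A] by auto
      then have "w (A (x - p)) \<le> u x" using x True by auto
      then have "0 < u x" "u x powr (- \<beta>) \<le> w (A (x - p)) powr (- \<beta>)"
        using *(2) \<beta> by (auto intro!: powr_mono2')
      then show ?thesis using True *(3) by (auto intro: order_trans[OF ennreal_leI])
    qed auto
  qed
  then have "neg_power_integral ({x. A (x - p) \<in> N} \<inter> \<Omega>) u \<beta> \<le> (\<integral>\<^sup>+x. k (A (x - p)) \<partial>lebesgue)"
    unfolding neg_power_integral_def by (rule nn_integral_mono_AE)
  also have "\<dots> = (\<integral>\<^sup>+x. k (A (x - p)) \<partial>lborel)" by (rule nn_integral_completion)
  also have "\<dots> = (\<integral>\<^sup>+y. k y \<partial>lborel)" by (rule nn_integral_rigid[OF A k])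
  finally show ?thesis .
qed

text \<open>The constant is chosen before \<open>u\<close>, so that a finite cover yields one
  constant for all torsion functions.\<close>

definition finite_near :: "'b::euclidean_space set \<Rightarrow> real \<Rightarrow> 'b \<Rightarrow> bool" where
  "finite_near \<Omega> \<beta> p \<longleftrightarrow> (\<exists>N. open N \<and> p \<in> N \<and>
     (\<exists>C::real. \<forall>u. torsion_function \<Omega> u \<longrightarrow> neg_power_integral (N \<inter> \<Omega>) u \<beta> \<le> ennreal C))"

lemma finite_near_rigid:
  fixes \<Omega> :: "'b::euclidean_space set" and A :: "'b \<Rightarrow> 'b"
  assumes \<Omega>: "open \<Omega>" "bounded \<Omega>" and A: "orthogonal_transformation A" and \<beta>: "0 < \<beta>"
    and U: "open U" "U \<subseteq> (\<lambda>x. A (x - p)) ` \<Omega>" and w: "c2_on U w g H" "\<And>y. y \<in> U \<Longrightarrow> -1 \<le> lapl H y"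
    and cpt: "\<And>d. 0 < d \<Longrightarrow> compact {y \<in> U. d \<le> w y}"
    and N: "open N" "0 \<in> N" 
      "\<And>y. y \<in> N \<Longrightarrow> y \<in> (\<lambda>x. A (x - p)) ` \<Omega> \<Longrightarrow> y \<in> U \<and> 0 < w y \<and> ennreal (w y powr (- \<beta>)) \<le> k y"
    and k: "k \<in> borel_measurable borel" "(\<integral>\<^sup>+y. k y \<partial>lborel) < \<infinity>"
  shows "finite_near \<Omega> \<beta> p"
  unfolding finite_near_def
proof (intro exI conjI allI impI)
  show "open {x. A (x - p) \<in> N}" by (rule open_rigid_vimage[OF A N(1)])
  show "p \<in> {x. A (x - p) \<in> N}" 
    using N(2) A by (simp add: orthogonal_transformation_linear linear_0)
  fix u assume u: "torsion_function \<Omega> u"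
  have "neg_power_integral ({x. A (x - p) \<in> N} \<inter> \<Omega>) u \<beta> \<le> (\<integral>\<^sup>+y. k y \<partial>lborel)"
    by (rule neg_power_integral_le_rigid[OF \<Omega>(1) A \<beta> lower_barrier_rigid[OF \<Omega> u A U w cpt] N(3) k(1)])
  also have "\<dots> = ennreal (enn2real (\<integral>\<^sup>+y. k y \<partial>lborel))"
    using k(2) by simp
  finally show "neg_power_integral ({x. A (x - p) \<in> N} \<inter> \<Omega>) u \<beta> \<le> ennreal (enn2real (\<integral>\<^sup>+y. k y \<partial>lborel))" .
qed

section \<open>Barriers at interior points and above a C^2 graph\<close>

lemma compact_superlevel:
  fixes w :: "'b::euclidean_space \<Rightarrow> real"
  assumes "compact K" "continuous_on K w" shows "compact {x \<in> K. d \<le> w x}"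
proof -
  have "closed (K \<inter> w -` {d..})"
    by (rule continuous_closed_preimage[OF assms(2) compact_imp_closed[OF assms(1)]]) auto
  then have "compact (K \<inter> (K \<inter> w -` {d..}))" using assms(1) by (rule compact_Int_closed[rotated])
  also have "K \<inter> (K \<inter> w -` {d..}) = {x \<in> K. d \<le> w x}" by auto
  finally show ?thesis .
qed

lemma finite_near_interior:
  fixes \<Omega> :: "'b::euclidean_space set"
  assumes \<Omega>: "open \<Omega>" "bounded \<Omega>" and \<beta>: "0 < \<beta>" and p: "p \<in> \<Omega>"
  shows "finite_near \<Omega> \<beta> p"
proof -
  obtain r where r: "0 < r" "ball p r \<subseteq> \<Omega>" using \<Omega>(1) p open_contains_ball by blast
  define n where "n = real DIM('b)"
  have n: "0 < n" by (simp add: n_def)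
  \<comment> \<open>The torsion function of the ball of radius \<open>r\<close>; \<open>m\<close>
    below is its value at distance r/2 from the centre.\<close>
  define w where "w = (\<lambda>y :: 'b. (1 / (2 * n)) * (r\<^sup>2 - y \<bullet> y))"
  have w: "c2_on (ball 0 r) w (\<lambda>y. (1 / (2 * n)) *\<^sub>R (0 - 2 *\<^sub>R y)) (\<lambda>b y. (1 / (2 * n)) *\<^sub>R (0 - 2 *\<^sub>R b))"
    unfolding w_def by (intro c2_on_cmult c2_on_diff c2_on_const c2_on_norm_square)
  have A: "orthogonal_transformation (\<lambda>x :: 'b. x)" by simp
  define m where "m = (1 / (2 * n)) * (r\<^sup>2 - (r / 2)\<^sup>2)"
  have m: "0 < m" using n r(1) by (simp add: m_def power_divide)
  show ?thesis
  proof (rule finite_near_rigid[OF \<Omega> A \<beta> _ _ w, where N = "ball 0 (r / 2)" and k = "\<lambda>y. ennreal (m powr (- \<beta>)) * indicator (ball 0 (r / 2)) y"])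
    show "ball 0 r \<subseteq> (\<lambda>x. x - p) ` \<Omega>"
    proof
      fix y :: 'b assume "y \<in> ball 0 r"
      then have "y + p \<in> \<Omega>" using r(2) by (auto simp: dist_norm)
      then show "y \<in> (\<lambda>x. x - p) ` \<Omega>" by (intro image_eqI[of _ _ "y + p"]) auto
    qed
    show "- 1 \<le> lapl (\<lambda>b y. (1 / (2 * n)) *\<^sub>R (0 - 2 *\<^sub>R b)) y" if "y \<in> ball 0 r" for y :: 'b
      using n by (simp add: lapl_def n_def sum_negf)
    show "compact {y \<in> ball 0 r. d \<le> w y}" if d: "0 < d" for d
    proof -
      have "compact {y \<in> cball 0 r. d \<le> w y}"
        unfolding w_def by (intro compact_superlevel continuous_intros) auto
      also have "{y \<in> cball 0 r. d \<le> w y} = {y \<in> ball 0 r. d \<le> w y}"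
      proof -
        have "norm y \<noteq> r" if "d \<le> w y" for y
        proof
          assume "norm y = r"
          then have "w y = 0" by (simp add: w_def power2_norm_eq_inner[symmetric])
          then show False using that d by simp
        qed
        then show ?thesis by force
      qed
      finally show ?thesis .
    qed
    fix y :: 'b assume y: "y \<in> ball 0 (r / 2)"
    have "y \<bullet> y \<le> (r / 2)\<^sup>2"
      using y by (simp add: power2_norm_eq_inner[symmetric] power_mono)
    then have "m \<le> w y" unfolding m_def w_def using n by (intro mult_left_mono) auto
    then show "y \<in> ball 0 r \<and> 0 < w y \<and> ennreal (w y powr (- \<beta>)) \<le> ennreal (m powr (- \<beta>)) * indicator (ball 0 (r / 2)) y"
      using y m r \<beta> by (auto intro!: ennreal_leI powr_mono2')
  next
    show "(\<lambda>y. ennreal (m powr (- \<beta>)) * indicator (ball 0 (r / 2)) y) \<in> borel_measurable borel"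
      by (intro borel_measurable_times_ennreal borel_measurable_const borel_measurable_indicator) auto
    show "(\<integral>\<^sup>+y. ennreal (m powr (- \<beta>)) * indicator (ball 0 (r / 2)) y \<partial>lborel) < \<infinity>"
      using r by (subst nn_integral_cmult_indicator) (auto simp: emeasure_ball ennreal_mult_less_top)
  qed (use r in auto)
qed

lemma Ck_on_2_c2:
  assumes f: "Ck_on 2 U f" "open U"
  shows "c2_on U f (gradient f) (\<lambda>b. gradient (partial b f))"
  unfolding c2_on_def
proof (intro conjI ballI)
  have f2: "Ck_on (Suc (Suc 0)) U f" using f(1) by (simp only: numeral_2_eq_2)
  show c1: "c1_on U f (gradient f)"
    by (rule Ck_on_1_c1[OF Ck_on_le[OF f2] f(2)])
  fix b :: 'a assume b: "b \<in> Basis"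
  then have "Ck_on (Suc 0) U (partial b f)" using f2 by auto
  then have c: "c1_on U (partial b f) (gradient (partial b f))"
    by (rule Ck_on_1_c1[OF _ f(2)])
  have eq: "partial b f x = gradient f x \<bullet> b" if "x \<in> U" for x
    by (rule partial_eq[OF c1_onD[OF c1 that]])
  show "c1_on U (\<lambda>x. gradient f x \<bullet> b) (gradient (partial b f))"
    by (rule c1_on_cong[OF f(2) eq refl c])
qed

lemma c1_on_fst:
  fixes f :: "'a::euclidean_space \<Rightarrow> real"
  assumes "c1_on U f g"
  shows "c1_on {y :: 'a \<times> real. fst y \<in> U} (\<lambda>y. f (fst y)) (\<lambda>y. (g (fst y), 0))"
  unfolding c1_on_def
proof (intro conjI ballI)
  fix y :: "'a \<times> real" assume y: "y \<in> {y. fst y \<in> U}"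
  have "((\<lambda>y :: 'a \<times> real. f (fst y)) has_derivative (\<lambda>h. g (fst y) \<bullet> fst h)) (at y)"
    by (rule has_derivative_compose[where f = fst and g = f])
      (use y in \<open>auto intro!: derivative_eq_intros c1_onD[OF assms]\<close>)
  then show "((\<lambda>y :: 'a \<times> real. f (fst y)) has_derivative (\<lambda>h. (g (fst y), 0) \<bullet> h)) (at y)"
    by (simp add: inner_prod_def)
next
  show "continuous_on {y :: 'a \<times> real. fst y \<in> U} (\<lambda>y. (g (fst y), 0 :: real))"
    by (intro continuous_intros continuous_on_compose2[OF c1_on_continuous_grad[OF assms]]) auto
qed

text \<open>The test \<open>snd b = 0\<close> recognises the basis vectors of the first factor; the
  remaining one, \<open>(0, 1)\<close>, has a zero Hessian row.\<close>

lemma c2_on_fst: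
  fixes f :: "'a::euclidean_space \<Rightarrow> real"
  assumes f: "c2_on U f g H"
  shows "c2_on {y :: 'a \<times> real. fst y \<in> U} (\<lambda>y. f (fst y)) (\<lambda>y. (g (fst y), 0)) 
    (\<lambda>b y. if snd b = 0 then (H (fst b) (fst y), 0) else 0)"
  unfolding c2_on_def
proof (intro conjI ballI c1_on_fst c2_onD(1)[OF f])
  fix b :: "'a \<times> real" assume "b \<in> Basis"
  then consider i where "i \<in> Basis" "b = (i, 0)" | "b = (0, 1)"
    by (auto simp: Basis_prod_def)
  then show "c1_on {y :: 'a \<times> real. fst y \<in> U} (\<lambda>y. (g (fst y), 0) \<bullet> b) (\<lambda>y. if snd b = 0 then (H (fst b) (fst y), 0) else 0)"
  proof cases
    case 1
    then show ?thesis using c1_on_fst[OF c2_onD(2)[OF f 1(1)]] by simp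
  next
    case 2
    then show ?thesis by (simp add: c1_on_const)
  qed
qed

lemma c2_on_bounded_lapl:
  assumes "c2_on V w g H" "compact K" "K \<subseteq> V"
  obtains L where "0 \<le> L" "\<And>y. y \<in> K \<Longrightarrow> \<bar>lapl H y\<bar> \<le> L"
proof -
  have "compact (lapl H ` K)"
    using assms continuous_on_lapl[OF assms(1)] by (intro compact_continuous_image) (auto intro: continuous_on_subset)
  then obtain L where L: "\<And>y. y \<in> K \<Longrightarrow> norm (lapl H y) \<le> L"
    using compact_imp_bounded by (force simp: bounded_iff)
  show ?thesis by (rule that[of "\<bar>L\<bar>"]) (use L in \<open>force\<close>)+
qed

lemma lapl_cmult: "lapl (\<lambda>b x. c *\<^sub>R H b x) x = c * lapl H x"
  by (simp add: lapl_def sum_distrib_left)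

text \<open>With \<open>s = t - \<phi> x'\<close> the height above the boundary, the barrier is a small multiple of
  \<open>s (\<delta> - s)\<close> minus a multiple of a function of \<open>x'\<close> that vanishes for \<open>\<bar>x'\<bar> \<le> \<rho>\<close> and is large for \<open>\<bar>x'\<bar> = r\<^sub>1\<close>.\<close>

lemma finite_near_C2_boundary:
  fixes \<Omega> :: "('a::euclidean_space \<times> real) set"
  assumes \<Omega>: "open \<Omega>" "bounded \<Omega>" and \<beta>: "0 < \<beta>" "\<beta> < 1" and p: "p \<in> frontier \<Omega>" "C2_boundary_at \<Omega> p"
  shows "finite_near \<Omega> \<beta> p"
proof -
  obtain A :: "'a \<times> real \<Rightarrow> 'a \<times> real" and \<phi> r h where A: "orthogonal_transformation A" 
    and rh: "0 < r" "0 < h" and \<phi>: "Ck_on 2 (ball 0 r) \<phi>"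
    and fr: "\<And>x' t. norm x' < r \<Longrightarrow> \<bar>t\<bar> < h \<Longrightarrow> (x', t) \<in> (\<lambda>x. A (x - p)) ` frontier \<Omega> \<longleftrightarrow> t = \<phi> x'"
    and im: "\<And>x' t. norm x' < r \<Longrightarrow> \<bar>t\<bar> < h \<Longrightarrow> (x', t) \<in> (\<lambda>x. A (x - p)) ` \<Omega> \<longleftrightarrow> \<phi> x' < t"
    using p(2) unfolding C2_boundary_at_def by blast
  have \<phi>0: "\<phi> 0 = 0"
  proof -
    have "A (p - p) = 0" using A by (simp add: orthogonal_transformation_linear linear_0)
    then have "A (p - p) = (0, 0)" by (simp only: zero_prod_def)
    then have "(0, 0) \<in> (\<lambda>x. A (x - p)) ` frontier \<Omega>" using p(1) by (metis imageI)
    then show ?thesis using fr[of 0 0] rh by simp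
  qed
  note \<phi>2 = Ck_on_2_c2[OF \<phi> open_ball]
  have c\<phi>: "continuous_on (ball 0 r) \<phi>" by (rule c1_on_continuous[OF c2_onD(1)[OF \<phi>2]])
  have small: "\<exists>d>0. d \<le> r / 2 \<and> (\<forall>x'. norm x' \<le> d \<longrightarrow> \<bar>\<phi> x'\<bar> < e)" if e: "0 < e" for e
  proof -
    have "isCont \<phi> 0" using c\<phi> rh by (simp add: continuous_on_eq_continuous_at)
    then obtain d where d: "d > 0" "\<And>x'. dist x' 0 < d \<Longrightarrow> dist (\<phi> x') (\<phi> 0) < e"
      using e unfolding continuous_at_eps_delta by blast
    show ?thesis
      by (rule exI[of _ "min (d / 2) (r / 2)"]) (use d rh \<phi>0 in auto)
  qed
  obtain r1 where r1: "0 < r1" "r1 \<le> r / 2" "\<And>x'. norm x' \<le> r1 \<Longrightarrow> \<bar>\<phi> x'\<bar> < h / 4"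
    using small[of "h / 4"] rh by auto
  \<comment> \<open>With \<open>\<phi>\<close> below h/4 in absolute value, a height above the graph
    of less than h/4 keeps |t| < h, inside the range of the graph description.\<close>
  define \<delta> where "\<delta> = h / 4"
  have \<delta>: "0 < \<delta>" using rh by (simp add: \<delta>_def)
  define \<rho> where "\<rho> = r1 / 2"
  \<comment> \<open>If \<open>\<phi>\<close> and t are both below \<delta>/4 in absolute value, the
    height s is less than \<delta>/2 and s (\<delta> - s) \<ge> s \<delta>/2.\<close>
  obtain r2 where r2: "0 < r2" "\<And>x'. norm x' \<le> r2 \<Longrightarrow> \<bar>\<phi> x'\<bar> < \<delta> / 4"
    using small[of "\<delta> / 4"] \<delta> by auto
  define \<rho>2 where "\<rho>2 = min \<rho> r2"
  have \<rho>2: "0 < \<rho>2" "\<rho>2 \<le> \<rho>" "\<rho>2 \<le> r2" "\<rho>2 < r1" using r1 r2 by (auto simp: \<rho>2_def \<rho>_def)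
  \<comment> \<open>\<open>P\<close> is the value of the lateral cut-off \<open>z\<close> at |x'| =
    r1. With M = \<delta>^2 / P the subtracted term is \<delta>^2 there, and s (\<delta> - s) cannot
    exceed it.\<close>
  define P where "P = ppart 1 (r1\<^sup>2 - \<rho>\<^sup>2)"
  have P: "0 < P"
    using r1(1) by (simp add: P_def \<rho>_def power_divide ppart_pos_eq)
  define M where "M = \<delta>\<^sup>2 / P"
  define V where "V = {y :: 'a \<times> real. fst y \<in> ball 0 r}"
  define s where "s = (\<lambda>y :: 'a \<times> real. y \<bullet> (0, 1) - \<phi> (fst y))"
  define z where "z = (\<lambda>y :: 'a \<times> real. ppart 1 ((\<lambda>x'. x' \<bullet> x' - \<rho>\<^sup>2) (fst y)))"
  define w0 where "w0 = (\<lambda>y. s y * (\<delta> - s y) - M * z y)"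
  have s_eq: "s y = snd y - \<phi> (fst y)" for y by (simp add: s_def inner_prod_def)
  have "\<exists>g H. c2_on V w0 g H"
  proof -
    have s2: "c2_on V s (\<lambda>y. (0, 1) - (gradient \<phi> (fst y), 0)) 
         (\<lambda>b y. 0 - (if snd b = 0 then (gradient (partial (fst b) \<phi>) (fst y), 0) else 0))"
      unfolding V_def s_def by (intro c2_on_diff c2_on_inner c2_on_fst[OF \<phi>2])
    note q2 = c2_on_diff[OF c2_on_norm_square c2_on_const[of "UNIV :: 'a set" "\<rho>\<^sup>2"]]
    have "\<exists>g H. c2_on UNIV (\<lambda>x' :: 'a. ppart 1 (x' \<bullet> x' - \<rho>\<^sup>2)) g H"
      by (intro exI, rule c2_on_compose_real[OF q2 ppart_deriv[OF zero_less_one] ppart'_deriv[OF zero_less_one]])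
        (auto intro!: continuous_intros)
    then obtain g1 H1 where "c2_on UNIV (\<lambda>x' :: 'a. ppart 1 (x' \<bullet> x' - \<rho>\<^sup>2)) g1 H1" by blast
    from c2_on_subset[OF c2_on_fst[OF this], of V] have "\<exists>g H. c2_on V z g H"
      unfolding z_def by auto
    then obtain gz Hz where z2: "c2_on V z gz Hz" by blast
    show ?thesis
      unfolding w0_def
      by (intro exI, rule c2_on_diff[OF c2_on_mult[OF s2 c2_on_diff[OF c2_on_const s2]] c2_on_cmult[OF z2]])
  qed
  then obtain g0 H0 where w0: "c2_on V w0 g0 H0" by blast
  define K where "K = {y :: 'a \<times> real. norm (fst y) \<le> r1 \<and> 0 \<le> s y \<and> s y \<le> \<delta>}"
  define U where "U = {y :: 'a \<times> real. norm (fst y) < r1 \<and> 0 < s y \<and> s y < \<delta>}"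
  have KV: "K \<subseteq> V" using r1 rh by (auto simp: K_def V_def)
  have UK: "U \<subseteq> K" by (auto simp: U_def K_def)
  have sub: "cball 0 r1 \<subseteq> ball (0 :: 'a) r" using r1 rh by auto
  have K: "compact K"
  proof -
    \<comment> \<open>A shear along the graph maps a compact cylinder onto \<open>K\<close>.\<close>
    have "K = (\<lambda>y. (fst y, \<phi> (fst y) + snd y)) ` (cball 0 r1 \<times> {0..\<delta>})"
    proof (intro equalityI subsetI)
      fix y assume "y \<in> K"
      then show "y \<in> (\<lambda>y. (fst y, \<phi> (fst y) + snd y)) ` (cball 0 r1 \<times> {0..\<delta>})"
        by (intro image_eqI[of _ _ "(fst y, s y)"]) (auto simp: K_def s_eq)
    qed (auto simp: K_def s_eq)
    moreover have "compact ((\<lambda>y. (fst y, \<phi> (fst y) + snd y)) ` (cball (0::'a) r1 \<times> {0..\<delta>}))"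
      by (intro compact_continuous_image continuous_intros continuous_on_compose2[OF continuous_on_subset[OF c\<phi> sub]])
        (auto intro: compact_Times)
    ultimately show ?thesis by simp
  qed
  have cs: "continuous_on V s"
    unfolding V_def s_def by (intro continuous_intros continuous_on_compose2[OF c\<phi>]) auto
  have openV: "open V"
  proof -
    have "V = fst -` ball 0 r" by (auto simp: V_def)
    then show ?thesis by (simp add: open_vimage_fst)
  qed
  have openU: "open U"
  proof -
    have 1: "open (V \<inter> s -` {0<..<\<delta>})" by (rule continuous_open_preimage[OF cs openV]) auto
    have 2: "open (fst -` ball (0::'a) r1 :: ('a \<times> real) set)" by (rule open_vimage_fst) auto
    have "U = (V \<inter> s -` {0<..<\<delta>}) \<inter> fst -` ball 0 r1"
      using r1 rh by (auto simp: U_def V_def)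
    then show ?thesis using 1 2 by auto
  qed
  have Uim: "y \<in> (\<lambda>x. A (x - p)) ` \<Omega>" if "y \<in> U" for y
  proof -
    obtain x' t where y: "y = (x', t)" by (cases y)
    have n: "norm x' < r1" "0 < t - \<phi> x'" "t - \<phi> x' < h / 4"
      using that by (auto simp: U_def y s_eq \<delta>_def)
    moreover have "\<bar>\<phi> x'\<bar> < h / 4" using r1(3)[of x'] n by simp
    ultimately have "norm x' < r" "\<bar>t\<bar> < h" "\<phi> x' < t"
      using r1(1,2) rh by linarith+
    then show ?thesis using im[of x' t] y by auto
  qed
  obtain L where L: "0 \<le> L" "\<And>y. y \<in> K \<Longrightarrow> \<bar>lapl H0 y\<bar> \<le> L"
    using c2_on_bounded_lapl[OF w0 K KV] by blast
  \<comment> \<open>\<open>L\<close> bounds the Laplacian of \<open>w0\<close> on \<open>K\<close>,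
    so this factor brings it above -1.\<close>
  define c where "c = 1 / (L + 1)"
  have c: "0 < c" using L(1) by (simp add: c_def)
  have z0: "0 \<le> z y" for y by (simp add: z_def ppart_nonneg)
  have M: "0 \<le> M" using P by (simp add: M_def)
  have cw0: "continuous_on K w0"
    using c1_on_continuous[OF c2_onD(1)[OF w0]] KV by (rule continuous_on_subset)
  have cpt: "compact {y \<in> U. d \<le> c * w0 y}" if d: "0 < d" for d
  proof -
    \<comment> \<open>On \<open>K\<close> a positive value of \<open>w0\<close> excludes all three
      kinds of faces: s = 0, s = \<delta> and |x'| = r1. A superlevel set in \<open>U\<close> is
      thus one in the compact \<open>K\<close>.\<close>
    have "y \<in> U" if y: "y \<in> K" "d \<le> c * w0 y" for y
    proof -
      have pos: "0 < w0 y" using y(2) d c by (smt (verit) mult_nonneg_nonpos2 mult.commute)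
      have s01: "0 \<le> s y" "s y \<le> \<delta>" using y(1) by (auto simp: K_def)
      have "0 \<le> M * z y" using M z0 by simp
      then have 1: "0 < s y * (\<delta> - s y)" using pos by (simp add: w0_def)
      then have 2: "0 < s y" "s y < \<delta>" using s01 by (auto simp: zero_less_mult_iff)
      have "norm (fst y) \<noteq> r1"
      proof
        assume n: "norm (fst y) = r1"
        have "z y = P" by (simp add: z_def P_def n power2_norm_eq_inner[symmetric])
        then have "M * z y = \<delta>\<^sup>2" using P by (simp add: M_def)
        moreover have "s y * (\<delta> - s y) \<le> \<delta> * \<delta>" using 2 by (intro mult_mono) auto
        ultimately show False using pos by (simp add: w0_def power2_eq_square)
      qed
      then show ?thesis using 2 y(1) by (auto simp: U_def K_def)
    qed
    then have "{y \<in> U. d \<le> c * w0 y} = {y \<in> K. d \<le> c * w0 y}" using UK by blast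
    moreover have "compact {y \<in> K. d \<le> c * w0 y}"
      by (intro compact_superlevel K continuous_intros cw0)
    ultimately show ?thesis by simp
  qed
  define c' where "c' = c * (\<delta> / 2)"
  have c': "0 < c'" using c \<delta> by (simp add: c'_def)
  \<comment> \<open>Extension by zero makes \<open>\<phi>\<close> Borel on the whole space, so that
    \<open>k\<close> is measurable.\<close>
  define \<phi>' where "\<phi>' = (\<lambda>x'. if x' \<in> ball 0 r then \<phi> x' else 0)"
  have [measurable]: "\<phi>' \<in> borel_measurable borel"
    unfolding \<phi>'_def by (rule borel_measurable_continuous_on_if[OF _ c\<phi>]) auto
  define f where "f t = ennreal (c' powr (- \<beta>)) * (ennreal (t powr (- \<beta>)) * indicator {0..\<delta>} t)" for t
  have [measurable]: "f \<in> borel_measurable borel"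
    unfolding f_def by measurable
  define k where "k y = (if norm (fst y) < \<rho>2 then f (snd y - \<phi>' (fst y)) else 0)" for y :: "'a \<times> real"
  have km: "k \<in> borel_measurable borel"
    unfolding k_def borel_prod[symmetric] by measurable
  have wk: "y \<in> U \<and> 0 < c * w0 y \<and> ennreal ((c * w0 y) powr (- \<beta>)) \<le> k y"
    if y: "y \<in> {y. norm (fst y) < \<rho>2 \<and> \<bar>snd y\<bar> < \<delta> / 4}" "y \<in> (\<lambda>x. A (x - p)) ` \<Omega>" for y
  proof -
    obtain x' t where yy: "y = (x', t)" by (cases y)
    have x': "norm x' < \<rho>2" and t: "\<bar>t\<bar> < \<delta> / 4" using y(1) by (auto simp: yy)
    have \<phi>x: "\<bar>\<phi> x'\<bar> < \<delta> / 4" using r2(2)[of x'] x' \<rho>2 by auto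
    have lt: "norm x' < r" "\<bar>t\<bar> < h" using x' t \<rho>2 r1 rh by (auto simp: \<delta>_def)
    have "\<phi> x' < t" using im[OF lt] y(2) by (auto simp: yy)
    then have s: "0 < s y" "s y < \<delta> / 2" using \<phi>x t by (auto simp: s_eq yy)
    have "z y = 0"
    proof -
      have "norm x' \<le> \<rho>" using x' \<rho>2 by simp
      then have "x' \<bullet> x' \<le> \<rho>\<^sup>2" by (metis norm_ge_zero power2_norm_eq_inner power_mono)
      then show ?thesis by (simp add: z_def yy)
    qed
    then have w0y: "w0 y = s y * (\<delta> - s y)" by (simp add: w0_def)
    have "s y * (\<delta> / 2) \<le> w0 y" unfolding w0y using s by (intro mult_left_mono) auto
    then have "c * (s y * (\<delta> / 2)) \<le> c * w0 y" using c by (intro mult_left_mono) auto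
    then have le: "c' * s y \<le> c * w0 y" by (simp add: c'_def mult_ac)
    have pos: "0 < c' * s y" using c' s by simp
    have "(c * w0 y) powr (- \<beta>) \<le> (c' * s y) powr (- \<beta>)"
      using le pos \<beta> by (intro powr_mono2') auto
    also have "\<dots> = c' powr (- \<beta>) * s y powr (- \<beta>)"
      by (rule powr_mult)
    finally have "ennreal ((c * w0 y) powr (- \<beta>)) \<le> ennreal (c' powr (- \<beta>)) * ennreal (s y powr (- \<beta>))"
      by (simp add: ennreal_mult[symmetric] ennreal_leI)
    moreover have "k y = ennreal (c' powr (- \<beta>)) * ennreal (s y powr (- \<beta>))"
      using s x' lt by (simp add: k_def f_def yy \<phi>'_def s_eq)
    moreover have "y \<in> U" using s x' \<rho>2 \<delta> by (auto simp: U_def yy)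
    ultimately show ?thesis using le pos by auto
  qed
  have fin: "(\<integral>\<^sup>+y. k y \<partial>lborel) < \<infinity>"
  proof -
    \<comment> \<open>Integrating vertically first, a translation by \<open>\<phi>' x'\<close> makes
      the inner integral equal to \<open>I\<close> for every x' in the ball.\<close>
    define I where "I = (\<integral>\<^sup>+t. f t \<partial>lborel)"
    have "I = ennreal (c' powr (- \<beta>)) * ennreal (\<delta> powr (1 - \<beta>) / (1 - \<beta>))"
      unfolding I_def f_def using \<beta> \<delta> by (subst nn_integral_cmult) (simp_all add: nn_integral_powr_interval)
    then have I: "I < \<infinity>" by (simp add: ennreal_mult_less_top)
    have "(\<integral>\<^sup>+y. k y \<partial>lborel) = (\<integral>\<^sup>+x'. \<integral>\<^sup>+t. k (x', t) \<partial>lborel \<partial>lborel)"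
      by (rule nn_integral_lborel_prod_eq(1)[OF km])
    also have "\<dots> = (\<integral>\<^sup>+x'. I * indicator (ball 0 \<rho>2) x' \<partial>(lborel :: 'a measure))"
    proof (rule nn_integral_cong)
      fix x' :: 'a
      have "(\<integral>\<^sup>+t. f (t + (- \<phi>' x')) \<partial>lborel) = I"
        unfolding I_def by (rule nn_integral_lborel_translate) measurable
      then show "(\<integral>\<^sup>+t. k (x', t) \<partial>lborel) = I * indicator (ball 0 \<rho>2) x'"
        by (cases "norm x' < \<rho>2") (simp_all add: k_def)
    qed
    also have "\<dots> = I * emeasure lborel (ball (0::'a) \<rho>2)"
      by (rule nn_integral_cmult_indicator) simp
    also have "\<dots> < \<infinity>"
      using I \<rho>2(1) by (simp add: emeasure_ball ennreal_mult_less_top)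
    finally show ?thesis .
  qed
  show ?thesis
  proof (rule finite_near_rigid[OF \<Omega> A \<beta>(1) openU _ c2_on_cmult[OF c2_on_subset[OF w0]] _ cpt _ _ wk km fin])
    show "U \<subseteq> (\<lambda>x. A (x - p)) ` \<Omega>" using Uim by blast
    show "U \<subseteq> V" using UK KV by blast
    show "- 1 \<le> lapl (\<lambda>b x. c *\<^sub>R H0 b x) y" if "y \<in> U" for y
    proof -
      have "\<bar>lapl H0 y\<bar> \<le> L" using that UK by (intro L(2)) auto
      then have "c * (- L) \<le> c * lapl H0 y" using c by (intro mult_left_mono) auto
      moreover have "c * L \<le> 1" using L(1) by (simp add: c_def)
      ultimately show ?thesis by (simp add: lapl_cmult)
    qed
    have "{y :: 'a \<times> real. norm (fst y) < \<rho>2 \<and> \<bar>snd y\<bar> < \<delta> / 4} = ball 0 \<rho>2 \<times> {- (\<delta> / 4)<..<\<delta> / 4}"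
      by auto
    then show "open {y :: 'a \<times> real. norm (fst y) < \<rho>2 \<and> \<bar>snd y\<bar> < \<delta> / 4}"
      by (simp add: open_Times)
    show "0 \<in> {y :: 'a \<times> real. norm (fst y) < \<rho>2 \<and> \<bar>snd y\<bar> < \<delta> / 4}"
      using \<rho>2 \<delta> by simp
  qed
qed

section \<open>Cusps\<close>

lemma c2_on_snd:
  fixes \<theta> :: "real \<Rightarrow> real"
  assumes "\<And>t. t \<in> I \<Longrightarrow> (\<theta> has_real_derivative \<theta>' t) (at t)" "\<And>t. t \<in> I \<Longrightarrow> (\<theta>' has_real_derivative \<theta>'' t) (at t)"
    and "continuous_on I \<theta>'" "continuous_on I \<theta>''"
  obtains g H where "c2_on {y :: 'a::euclidean_space \<times> real. snd y \<in> I} (\<lambda>y. \<theta> (snd y)) g H" "\<And>y. lapl H y = \<theta>'' (snd y)"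
proof -
  let ?a = "(0, 1) :: 'a \<times> real" and ?V = "{y :: 'a \<times> real. snd y \<in> I}"
  have s: "y \<bullet> ?a = snd y" for y by (simp add: inner_prod_def)
  have im: "(\<lambda>y. y \<bullet> ?a) ` ?V \<subseteq> I" by (auto simp: s)
  have 2: "c2_on ?V (\<lambda>y. \<theta> (y \<bullet> ?a)) (\<lambda>y. \<theta>' (y \<bullet> ?a) *\<^sub>R ?a) 
     (\<lambda>b y. \<theta>' (y \<bullet> ?a) *\<^sub>R 0 + (?a \<bullet> b) *\<^sub>R (\<theta>'' (y \<bullet> ?a) *\<^sub>R ?a))"
    by (rule c2_on_compose_real[OF c2_on_inner _ _ continuous_on_subset[OF assms(3) im] continuous_on_subset[OF assms(4) im]])
      (use assms(1,2) in \<open>simp_all add: s\<close>)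
  have "lapl (\<lambda>b y. \<theta>' (y \<bullet> ?a) *\<^sub>R 0 + (?a \<bullet> b) *\<^sub>R (\<theta>'' (y \<bullet> ?a) *\<^sub>R ?a)) y = \<theta>'' (snd y)" for y
    using lapl_compose_real[of \<theta>' "\<lambda>y. y \<bullet> ?a" "\<lambda>_ _. 0" "\<lambda>_. ?a" \<theta>'' y]
    by (simp add: s lapl_def inner_prod_def)
  with 2 show ?thesis using that by (simp only: s)
qed

lemma c2_on_fst_square:
  obtains g H where "c2_on V (\<lambda>y :: 'a::euclidean_space \<times> real. fst y \<bullet> fst y) g H" "\<And>y. lapl H y = 2 * real DIM('a)"
proof -
  let ?H = "\<lambda>(b :: 'a \<times> real) (y :: 'a \<times> real). if snd b = 0 then (2 *\<^sub>R fst b, 0 :: real) else 0"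
  have "c2_on {y :: 'a \<times> real. fst y \<in> UNIV} (\<lambda>y. fst y \<bullet> fst y) (\<lambda>y. (2 *\<^sub>R fst y, 0)) ?H"
    by (rule c2_on_fst[OF c2_on_norm_square])
  then have "c2_on V (\<lambda>y :: 'a \<times> real. fst y \<bullet> fst y) (\<lambda>y. (2 *\<^sub>R fst y, 0)) ?H"
    by (rule c2_on_subset) auto
  moreover have "lapl ?H y = 2 * real DIM('a)" for y
  proof -
    have "lapl ?H y = (\<Sum>b\<in>(\<lambda>u. (u, 0)) ` Basis \<union> (\<lambda>v. (0, v)) ` Basis. ?H b y \<bullet> b)"
      by (simp only: lapl_def Basis_prod_def)
    also have "\<dots> = (\<Sum>b\<in>(\<lambda>u :: 'a. (u, 0 :: real)) ` Basis. ?H b y \<bullet> b) + (\<Sum>b\<in>(\<lambda>v :: real. (0 :: 'a, v)) ` Basis. ?H b y \<bullet> b)"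
      by (rule sum.union_disjoint) auto
    also have "(\<Sum>b\<in>(\<lambda>u :: 'a. (u, 0 :: real)) ` Basis. ?H b y \<bullet> b) = (\<Sum>u\<in>Basis. ?H (u, 0) y \<bullet> (u, 0))"
      by (subst sum.reindex) (auto simp: inj_on_def)
    also have "(\<Sum>b\<in>(\<lambda>v :: real. (0 :: 'a, v)) ` Basis. ?H b y \<bullet> b) = 0"
      by (intro sum.neutral) auto
    finally show ?thesis by (simp add: inner_prod_def)
  qed
  ultimately show ?thesis using that by blast
qed

lemma c2_on_snd_minus_square:
  assumes "\<And>t. t \<in> I \<Longrightarrow> (\<theta> has_real_derivative \<theta>' t) (at t)" "\<And>t. t \<in> I \<Longrightarrow> (\<theta>' has_real_derivative \<theta>'' t) (at t)"
    and "continuous_on I \<theta>'" "continuous_on I \<theta>''"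
  obtains g H where "c2_on {y :: 'a::euclidean_space \<times> real. snd y \<in> I} (\<lambda>y. \<theta> (snd y) - fst y \<bullet> fst y) g H"
    "\<And>y. lapl H y = \<theta>'' (snd y) - 2 * real DIM('a)"
proof -
  let ?V = "{y :: 'a \<times> real. snd y \<in> I}"
  obtain g1 H1 where 1: "c2_on ?V (\<lambda>y. \<theta> (snd y)) g1 H1" "\<And>y. lapl H1 y = \<theta>'' (snd y)"
    using c2_on_snd[OF assms] by blast
  obtain g2 H2 where 2: "c2_on ?V (\<lambda>y. fst y \<bullet> fst y) g2 H2" "\<And>y. lapl H2 y = 2 * real DIM('a)"
    using c2_on_fst_square by blast
  have "lapl (\<lambda>b y. H1 b y - H2 b y) y = \<theta>'' (snd y) - 2 * real DIM('a)" for y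
    using 1(2)[of y] 2(2)[of y] by (simp add: lapl_def inner_diff_left sum_subtractf)
  then show ?thesis
    by (rule that[OF c2_on_diff[OF 1(1) 2(1)]])
qed

lemma open_snd_vimage: "open I \<Longrightarrow> open {y :: 'a::euclidean_space \<times> real. snd y \<in> I}"
  using open_vimage_snd[of I] by (simp add: vimage_def)

text \<open>Uniqueness of limits identifies \<open>F' 0\<close> from the C^2 data with the one-sided
  derivative prescribed at the tip; at interior heights the derivatives become two-sided, as
  \<open>c2_on\<close> demands.\<close>

lemma cusp_profileE:
  fixes \<Omega> :: "('a::euclidean_space \<times> real) set"
  assumes "cusp_profile \<Omega> p \<eta> F"
  obtains F' F'' and A :: "'a \<times> real \<Rightarrow> 'a \<times> real" and \<epsilon> where 
    "0 < \<eta>" "F 0 = 0" "\<And>t. 0 < t \<Longrightarrow> t \<le> \<eta> \<Longrightarrow> 0 < F t"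
    "\<And>t. 0 < t \<Longrightarrow> t < \<eta> \<Longrightarrow> (F has_real_derivative F' t) (at t)"
    "\<And>t. 0 < t \<Longrightarrow> t < \<eta> \<Longrightarrow> (F' has_real_derivative F'' t) (at t)"
    "continuous_on {0..\<eta>} F" "continuous_on {0..\<eta>} F'" "continuous_on {0..\<eta>} F''" "F' 0 = 0"
    "orthogonal_transformation A" "0 < \<epsilon>"
    "\<And>x' t. t \<le> \<eta> \<Longrightarrow> (x', t) \<in> (\<lambda>x. A (x - p)) ` \<Omega> \<longleftrightarrow> 0 < t \<and> norm x' < \<epsilon> * F t"
proof -
  obtain A :: "'a \<times> real \<Rightarrow> 'a \<times> real" and \<epsilon> where A: "orthogonal_transformation A" "0 < \<epsilon>"
    and eq: "{y \<in> (\<lambda>x. A (x - p)) ` \<Omega>. snd y \<le> \<eta>} = {(x', t). 0 < t \<and> t \<le> \<eta> \<and> norm x' < \<epsilon> * F t}"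
    using assms unfolding cusp_profile_def by blast
  have im: "(x', t) \<in> (\<lambda>x. A (x - p)) ` \<Omega> \<longleftrightarrow> 0 < t \<and> norm x' < \<epsilon> * F t" if "t \<le> \<eta>" for x' t
  proof -
    have "(x', t) \<in> (\<lambda>x. A (x - p)) ` \<Omega> \<longleftrightarrow> (x', t) \<in> {y \<in> (\<lambda>x. A (x - p)) ` \<Omega>. snd y \<le> \<eta>}"
      using that by simp
    also have "\<dots> \<longleftrightarrow> 0 < t \<and> norm x' < \<epsilon> * F t" unfolding eq using that by simp
    finally show ?thesis .
  qed
  have \<eta>: "0 < \<eta>" and F0: "F 0 = 0" and Fpos: "\<And>t. 0 < t \<Longrightarrow> t \<le> \<eta> \<Longrightarrow> 0 < F t"
    and d0: "(F has_real_derivative 0) (at 0 within {0..\<eta>})" and C2: "C2_on_closed \<eta> F"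
    using assms unfolding cusp_profile_def by auto
  obtain F' F'' where dF: "\<And>t. t \<in> {0..\<eta>} \<Longrightarrow> (F has_real_derivative F' t) (at t within {0..\<eta>})"
    and dF': "\<And>t. t \<in> {0..\<eta>} \<Longrightarrow> (F' has_real_derivative F'' t) (at t within {0..\<eta>})" and cF'': "continuous_on {0..\<eta>} F''"
    using C2 unfolding C2_on_closed_def by blast
  have F'0: "F' 0 = 0"
  proof -
    have "((\<lambda>t. (F t - F 0) / (t - 0)) \<longlongrightarrow> F' 0) (at 0 within {0..\<eta>})" 
      "((\<lambda>t. (F t - F 0) / (t - 0)) \<longlongrightarrow> 0) (at 0 within {0..\<eta>})"
      using dF[of 0] d0 \<eta> by (simp_all add: has_field_derivative_iff)
    moreover have "at 0 within {0..\<eta>} \<noteq> bot"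
      using \<eta> by (simp add: at_within_Icc_at_right trivial_limit_at_right_real)
    ultimately show ?thesis by (metis tendsto_unique)
  qed
  have cF: "continuous_on {0..\<eta>} F" and cF': "continuous_on {0..\<eta>} F'"
    by (rule DERIV_continuous_on, erule dF, rule DERIV_continuous_on, erule dF')
  have dF1: "(F has_real_derivative F' t) (at t)" and dF2: "(F' has_real_derivative F'' t) (at t)" if "0 < t" "t < \<eta>" for t
    using dF[of t] dF'[of t] that by (simp_all add: at_within_Icc_at)
  show ?thesis
    by (rule that[OF \<eta> F0 Fpos dF1 dF2 cF cF' cF'' F'0 A im])
qed

section \<open>Bounds for the torsion function inside a cusp\<close>

lemma continuous_on_bounded_Icc:
  fixes f :: "real \<Rightarrow> real"
  assumes "continuous_on {a..b} f"
  obtains L where "0 \<le> L" "\<And>t. t \<in> {a..b} \<Longrightarrow> \<bar>f t\<bar> \<le> L"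
proof -
  have "bounded (f ` {a..b})"
    using compact_continuous_image[OF assms] compact_imp_bounded by blast
  then obtain L where L: "\<And>t. t \<in> {a..b} \<Longrightarrow> norm (f t) \<le> L" by (force simp: bounded_iff)
  show ?thesis by (rule that[of "\<bar>L\<bar>"]) (use L in force)+
qed

text \<open>The barrier is a small multiple of \<open>\<epsilon>\<^sup>2 F\<^sup>2 X - \<bar>x'\<bar>\<^sup>2\<close>, where the cut-off \<open>X\<close> equals \<open>1\<close> on
  \<open>[0, \<eta>/2]\<close> and vanishes at \<open>\<eta>\<close>, so that the barrier is positive only inside the cusp.\<close>

lemma finite_near_cusp:
  fixes \<Omega> :: "('a::euclidean_space \<times> real) set"
  assumes \<Omega>: "open \<Omega>" "bounded \<Omega>" and \<beta>: "0 < \<beta>" "\<beta> < 1" and cusp: "cusp_profile \<Omega> p \<eta> F"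
    and fin: "(\<integral>\<^sup>+t\<in>{0..\<eta>}. ennreal (F t powr (real DIM('a) - 2 * \<beta>)) \<partial>lborel) < \<infinity>"
  shows "finite_near \<Omega> \<beta> p"
proof (rule cusp_profileE[OF cusp])
  fix F' F'' and A :: "'a \<times> real \<Rightarrow> 'a \<times> real" and \<epsilon>
  assume
    \<eta>: "0 < \<eta>" and F0: "F 0 = 0" and Fpos: "\<And>t. 0 < t \<Longrightarrow> t \<le> \<eta> \<Longrightarrow> 0 < F t"
    and dF: "\<And>t. 0 < t \<Longrightarrow> t < \<eta> \<Longrightarrow> (F has_real_derivative F' t) (at t)"
    and dF': "\<And>t. 0 < t \<Longrightarrow> t < \<eta> \<Longrightarrow> (F' has_real_derivative F'' t) (at t)"
    and cF: "continuous_on {0..\<eta>} F" "continuous_on {0..\<eta>} F'" "continuous_on {0..\<eta>} F''" and F'0: "F' 0 = 0"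
    and A: "orthogonal_transformation A" and \<epsilon>: "0 < \<epsilon>"
    and im: "\<And>x' t. t \<le> \<eta> \<Longrightarrow> (x', t) \<in> (\<lambda>x. A (x - p)) ` \<Omega> \<longleftrightarrow> 0 < t \<and> norm x' < \<epsilon> * F t"
  define m where "m = real DIM('a)"
  \<comment> \<open>Normalises the cut-off \<open>X\<close> so that it reaches 0 exactly at
    \<open>\<eta>\<close>.\<close>
  define \<kappa> where "\<kappa> = 1 / ppart 1 (\<eta> / 2)"
  have pp: "0 < ppart 1 (\<eta> / 2)" using \<eta> by (simp add: ppart_pos_eq)
  define X where "X t = 1 - \<kappa> * ppart 1 (t - \<eta> / 2)" for t
  define X' where "X' t = - \<kappa> * ppart' 1 (t - \<eta> / 2)" for t
  define X'' where "X'' t = - \<kappa> * ppart'' 1 (t - \<eta> / 2)" for t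
  have dX: "(X has_real_derivative X' t) (at t)" for t
    unfolding X_def X'_def by (auto intro!: derivative_eq_intros DERIV_chain2[OF ppart_deriv])
  have dX': "(X' has_real_derivative X'' t) (at t)" for t
    unfolding X'_def X''_def by (auto intro!: derivative_eq_intros DERIV_chain2[OF ppart'_deriv])
  have cX: "continuous_on S X" "continuous_on S X'" "continuous_on S X''" for S
    unfolding X_def X'_def X''_def by (intro continuous_intros)+
  have X1: "X t \<le> 1" for t using pp by (simp add: X_def \<kappa>_def ppart_nonneg)
  have Xh: "X t = 1" if "t \<le> \<eta> / 2" for t using that by (simp add: X_def)
  have X\<eta>: "X \<eta> = 0" using pp by (simp add: X_def \<kappa>_def)
  define G where "G t = \<epsilon>\<^sup>2 * (F t * F t * X t)" for t
  define G' where "G' t = \<epsilon>\<^sup>2 * (2 * F t * F' t * X t + F t * F t * X' t)" for t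
  define G'' where "G'' t = \<epsilon>\<^sup>2 * ((2 * F' t * F' t + 2 * F t * F'' t) * X t + 4 * F t * F' t * X' t + F t * F t * X'' t)" for t
  have dG: "(G has_real_derivative G' t) (at t)" "(G' has_real_derivative G'' t) (at t)" if "t \<in> {0<..<\<eta>}" for t
    unfolding G_def G'_def G''_def using that
    by (auto intro!: derivative_eq_intros dF dF' dX dX' simp: algebra_simps)
  have cG: "continuous_on {0..\<eta>} G" "continuous_on {0..\<eta>} G'" "continuous_on {0..\<eta>} G''"
    unfolding G_def G'_def G''_def by (intro continuous_intros cF cX)+
  \<comment> \<open>\<open>G''\<close> is bounded up to the tip because \<open>F\<close> is of class
    C^2 on the closed interval.\<close>
  obtain L where L: "0 \<le> L" "\<And>t. t \<in> {0..\<eta>} \<Longrightarrow> \<bar>G'' t\<bar> \<le> L"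
    using continuous_on_bounded_Icc[OF cG(3)] by blast
  obtain D where D: "0 \<le> D" "\<And>t. t \<in> {0..\<eta>} \<Longrightarrow> \<bar>G t\<bar> \<le> D"
    using continuous_on_bounded_Icc[OF cG(1)] by blast
  define T where "T = {y :: 'a \<times> real. snd y \<in> {0<..<\<eta>}}"
  define w0 where "w0 = (\<lambda>y :: 'a \<times> real. G (snd y) - fst y \<bullet> fst y)"
  have sub: "{0<..<\<eta>} \<subseteq> {0..\<eta>}" by auto
  obtain g H where w0: "c2_on T w0 g H" and lw: "\<And>y. lapl H y = G'' (snd y) - 2 * m"
    unfolding T_def w0_def m_def
    using c2_on_snd_minus_square[OF dG continuous_on_subset[OF cG(2) sub] continuous_on_subset[OF cG(3) sub]] by blast
  \<comment> \<open>The Laplacian of \<open>w0\<close> is \<open>G'' - 2 * m\<close> evaluated at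
    the height, hence at least - (L + 2 m); scaling by \<open>c\<close> brings it above -1.\<close>
  define c where "c = 1 / (L + 2 * m + 1)"
  have m: "0 \<le> m" by (simp add: m_def)
  have c: "0 < c" using L(1) m by (simp add: c_def)
  define U where "U = {y \<in> T. 0 < w0 y}"
  have openT: "open T" unfolding T_def by (rule open_snd_vimage) simp
  have openU: "open U"
  proof -
    have "open (T \<inter> w0 -` {0<..})"
      by (rule continuous_open_preimage[OF c1_on_continuous[OF c2_onD(1)[OF w0]] openT]) auto
    also have "T \<inter> w0 -` {0<..} = U" by (auto simp: U_def)
    finally show ?thesis .
  qed
  have G_le: "G t \<le> (\<epsilon> * F t)\<^sup>2" for t
  proof -
    have "\<epsilon>\<^sup>2 * (F t * F t * X t) \<le> \<epsilon>\<^sup>2 * (F t * F t * 1)"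
      by (intro mult_left_mono X1) auto
    then show ?thesis by (simp add: G_def power2_eq_square mult_ac)
  qed
  have Uim: "U \<subseteq> (\<lambda>x. A (x - p)) ` \<Omega>"
  proof
    fix y assume y: "y \<in> U"
    obtain x' t where yy: "y = (x', t)" by (cases y)
    have t: "0 < t" "t < \<eta>" and "0 < G t - x' \<bullet> x'" using y by (auto simp: U_def T_def w0_def yy)
    then have "(norm x')\<^sup>2 < (\<epsilon> * F t)\<^sup>2" using G_le[of t] by (simp add: power2_norm_eq_inner)
    then have "norm x' < \<epsilon> * F t"
      by (rule power2_less_imp_less) (use \<epsilon> Fpos[of t] t in auto)
    then show "y \<in> (\<lambda>x. A (x - p)) ` \<Omega>" using im[of t x'] t yy by simp
  qed
  have cpt: "compact {y \<in> U. d \<le> c * w0 y}" if d: "0 < d" for d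
  proof -
    \<comment> \<open>D \<le> (D + 1)^2 turns the bound \<open>D\<close> for |x'|^2 into the radius
      D + 1.\<close>
    let ?K = "cball (0 :: 'a) (D + 1) \<times> {0..\<eta>}"
    have "{y \<in> U. d \<le> c * w0 y} = {y \<in> ?K. d \<le> c * w0 y}"
    proof (intro equalityI subsetI)
      fix y assume "y \<in> {y \<in> U. d \<le> c * w0 y}"
      then have y: "y \<in> U" "d \<le> c * w0 y" by auto
      have t: "0 < snd y" "snd y < \<eta>" and "0 < w0 y" using y by (auto simp: U_def T_def)
      then have "(norm (fst y))\<^sup>2 < D" using D(2)[of "snd y"] by (simp add: w0_def power2_norm_eq_inner)
      also have "D \<le> (D + 1)\<^sup>2" using D(1) by (simp add: power2_sum)
      finally have "norm (fst y) < D + 1" by (rule power2_less_imp_less) (use D in auto)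
      then show "y \<in> {y \<in> ?K. d \<le> c * w0 y}" using y t by (cases y) auto
    next
      fix y assume "y \<in> {y \<in> ?K. d \<le> c * w0 y}"
      then have y: "0 \<le> snd y" "snd y \<le> \<eta>" "d \<le> c * w0 y" by auto
      have "0 < c * w0 y" using y d by linarith
      then have pos: "0 < w0 y" using c by (simp add: zero_less_mult_iff)
      have "snd y \<noteq> 0"
      proof
        assume "snd y = 0"
        then have "w0 y \<le> 0" by (simp add: w0_def G_def F0)
        with pos show False by simp
      qed
      moreover have "snd y \<noteq> \<eta>"
      proof
        assume "snd y = \<eta>"
        then have "w0 y \<le> 0" by (simp add: w0_def G_def X\<eta>)
        with pos show False by simp
      qed
      ultimately show "y \<in> {y \<in> U. d \<le> c * w0 y}" using y pos by (auto simp: U_def T_def)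
    qed
    moreover have "compact {y \<in> ?K. d \<le> c * w0 y}"
      unfolding w0_def
      by (intro compact_superlevel compact_Times continuous_intros continuous_on_compose2[OF cG(1)]) auto
    ultimately show ?thesis by simp
  qed
  \<comment> \<open>\<open>F\<close> is controlled on the closed interval only; extended by zero it
    is Borel.\<close>
  define F1 where "F1 t = (if t \<in> {0..\<eta>} then F t else 0)" for t
  have [measurable]: "F1 \<in> borel_measurable borel"
    unfolding F1_def[abs_def] by (rule borel_measurable_continuous_on_if[OF _ cF(1)]) auto
  define k where "k y = (if 0 < snd y \<and> snd y < \<eta> / 2 then 
     (if norm (fst y) < \<epsilon> * F1 (snd y) then ennreal ((c * ((\<epsilon> * F1 (snd y))\<^sup>2 - (norm (fst y))\<^sup>2)) powr (- \<beta>)) else 0) else 0)" for y :: "'a \<times> real"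
  have km: "k \<in> borel_measurable borel"
    unfolding k_def borel_prod[symmetric] by measurable
  have wk: "y \<in> U \<and> 0 < c * w0 y \<and> ennreal ((c * w0 y) powr (- \<beta>)) \<le> k y"
    if y: "y \<in> {y. snd y < \<eta> / 2}" "y \<in> (\<lambda>x. A (x - p)) ` \<Omega>" for y
  proof -
    obtain x' t where yy: "y = (x', t)" by (cases y)
    have t: "t < \<eta> / 2" using y by (simp add: yy)
    then have t2: "0 < t" "norm x' < \<epsilon> * F t" "t < \<eta>" using im[of t x'] y(2) \<eta> by (auto simp: yy)
    have w0y: "w0 y = (\<epsilon> * F t)\<^sup>2 - (norm x')\<^sup>2"
      using t Xh[of t] by (simp add: w0_def yy G_def power2_norm_eq_inner) (simp add: power2_eq_square)
    have "(norm x')\<^sup>2 < (\<epsilon> * F t)\<^sup>2" using t2 by (intro power_strict_mono) auto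
    then have "0 < w0 y" by (simp add: w0y)
    moreover have "k y = ennreal ((c * w0 y) powr (- \<beta>))"
      unfolding w0y using t t2 by (simp add: k_def yy F1_def)
    ultimately show ?thesis using t2 c by (auto simp: U_def T_def yy)
  qed
  obtain J where J: "0 \<le> J" "\<And>R. 0 < R \<Longrightarrow> (\<integral>\<^sup>+x. (if norm x < R then ennreal ((c * (R\<^sup>2 - (norm x)\<^sup>2)) powr (- \<beta>)) else 0) \<partial>(lborel :: 'a measure))
       \<le> ennreal (J * R powr (m - 2 * \<beta>))"
    unfolding m_def using nn_integral_slice_powr[OF \<beta> c] by blast
  define q where "q t = ennreal (F1 t powr (m - 2 * \<beta>)) * indicator {0..\<eta>} t" for t
  have [measurable]: "q \<in> borel_measurable borel" unfolding q_def by measurable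
  have "(\<integral>\<^sup>+t. q t \<partial>lborel) = (\<integral>\<^sup>+t\<in>{0..\<eta>}. ennreal (F t powr (m - 2 * \<beta>)) \<partial>lborel)"
    by (intro nn_integral_cong) (simp add: q_def F1_def indicator_def)
  then have finq: "(\<integral>\<^sup>+t. q t \<partial>lborel) < \<infinity>" using fin by (simp add: m_def)
  have "(\<integral>\<^sup>+y. k y \<partial>lborel) = (\<integral>\<^sup>+t. \<integral>\<^sup>+x'. k (x', t) \<partial>lborel \<partial>lborel)"
    by (rule nn_integral_lborel_prod_eq(2)[OF km])
  \<comment> \<open>The slice at height t is a ball of radius \<epsilon> F(t), so the slice estimate
    applies with that radius.\<close>
  also have "\<dots> \<le> (\<integral>\<^sup>+t. ennreal (J * \<epsilon> powr (m - 2 * \<beta>)) * q t \<partial>lborel)"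
  proof (rule nn_integral_mono)
    fix t :: real
    show "(\<integral>\<^sup>+x'. k (x', t) \<partial>lborel) \<le> ennreal (J * \<epsilon> powr (m - 2 * \<beta>)) * q t"
    proof (cases "0 < t \<and> t < \<eta> / 2")
      case True
      then have t: "0 < F1 t" "t \<in> {0..\<eta>}" using Fpos[of t] \<eta> by (auto simp: F1_def)
      have "(\<integral>\<^sup>+x'. k (x', t) \<partial>lborel) \<le> ennreal (J * (\<epsilon> * F1 t) powr (m - 2 * \<beta>))"
      proof -
        have "k (x', t) = (if norm x' < \<epsilon> * F1 t then ennreal ((c * ((\<epsilon> * F1 t)\<^sup>2 - (norm x')\<^sup>2)) powr (- \<beta>)) else 0)" for x'
          using True by (auto simp: k_def)
        then show ?thesis using J(2)[of "\<epsilon> * F1 t"] \<epsilon> t by simp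
      qed
      also have "J * (\<epsilon> * F1 t) powr (m - 2 * \<beta>) = J * \<epsilon> powr (m - 2 * \<beta>) * F1 t powr (m - 2 * \<beta>)"
        by (simp add: powr_mult)
      also have "ennreal \<dots> = ennreal (J * \<epsilon> powr (m - 2 * \<beta>)) * q t"
        using t J(1) by (simp add: q_def ennreal_mult)
      finally show ?thesis .
    next
      case False
      then have "k (x', t) = 0" for x' by (auto simp: k_def)
      then show ?thesis by simp
    qed
  qed
  also have "\<dots> = ennreal (J * \<epsilon> powr (m - 2 * \<beta>)) * (\<integral>\<^sup>+t. q t \<partial>lborel)"
    by (rule nn_integral_cmult) simp
  also have "\<dots> < \<infinity>" using finq by (simp add: ennreal_mult_less_top)
  finally have fink: "(\<integral>\<^sup>+y. k y \<partial>lborel) < \<infinity>" .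
  show ?thesis
  proof (rule finite_near_rigid[OF \<Omega> A \<beta>(1) openU Uim c2_on_cmult[OF c2_on_subset[OF w0]] _ cpt _ _ wk km fink])
    show "U \<subseteq> T" by (auto simp: U_def)
    show "- 1 \<le> lapl (\<lambda>b x. c *\<^sub>R H b x) y" if "y \<in> U" for y
    proof -
      have "snd y \<in> {0..\<eta>}" using that by (auto simp: U_def T_def)
      then have "- L \<le> G'' (snd y)" using L(2)[of "snd y"] by auto
      then have "c * (- L - 2 * m) \<le> c * lapl H y"
        using c by (intro mult_left_mono) (auto simp: lw)
      moreover have "- 1 \<le> c * (- L - 2 * m)" using L(1) m by (simp add: c_def field_simps)
      ultimately show ?thesis by (simp add: lapl_cmult)
    qed
    show "open {y :: 'a \<times> real. snd y < \<eta> / 2}" using open_snd_vimage[of "{..<\<eta> / 2}"] by simp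
    show "0 \<in> {y :: 'a \<times> real. snd y < \<eta> / 2}" using \<eta> by simp
  qed
qed

lemma nn_integral_bounded_powr_finite:
  fixes F :: "real \<Rightarrow> real"
  assumes "continuous_on {a..b} F" "\<And>t. t \<in> {a..b} \<Longrightarrow> 0 \<le> F t" "0 \<le> s"
  shows "(\<integral>\<^sup>+t\<in>{a..b}. ennreal (F t powr s) \<partial>lborel) < \<infinity>"
proof -
  obtain L where L: "0 \<le> L" "\<And>t. t \<in> {a..b} \<Longrightarrow> \<bar>F t\<bar> \<le> L"
    using continuous_on_bounded_Icc[OF assms(1)] by blast
  have "(\<integral>\<^sup>+t\<in>{a..b}. ennreal (F t powr s) \<partial>lborel) \<le> (\<integral>\<^sup>+t. ennreal (L powr s) * indicator {a..b} t \<partial>lborel)"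
  proof (rule nn_integral_mono)
    fix t
    show "ennreal (F t powr s) * indicator {a..b} t \<le> ennreal (L powr s) * indicator {a..b} t"
    proof (cases "t \<in> {a..b}")
      case True
      then have "F t powr s \<le> L powr s" using assms(2)[OF True] assms(3) L(2)[OF True] by (intro powr_mono2) auto
      then show ?thesis using True by (simp add: ennreal_leI)
    qed simp
  qed
  also have "\<dots> < \<infinity>" 
    by (subst nn_integral_cmult_indicator) (auto simp: ennreal_mult_less_top emeasure_lborel_Icc_eq)
  finally show ?thesis .
qed

lemma cusp_profile_powr_finite:
  fixes \<Omega> :: "('a::euclidean_space \<times> real) set"
  assumes "cusp_profile \<Omega> p \<eta> F" "0 \<le> s"
  shows "(\<integral>\<^sup>+t\<in>{0..\<eta>}. ennreal (F t powr s) \<partial>lborel) < \<infinity>"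
proof (rule cusp_profileE[OF assms(1)], rule nn_integral_bounded_powr_finite[OF _ _ assms(2)])
  fix t assume F: "\<And>t. 0 < t \<Longrightarrow> t \<le> \<eta> \<Longrightarrow> 0 < F t" "F 0 = 0" "t \<in> {0..\<eta>}"
  then show "0 \<le> F t" by (cases "t = 0") (auto intro: less_imp_le)
qed

text \<open>Near the cusp \<open>u\<close> lies below \<open>v = C (2 \<epsilon>\<^sup>2 F\<^sup>2 - \<bar>x'\<bar>\<^sup>2)\<close>: this \<open>v\<close> is a supersolution for
  \<open>t < t\<^sub>0\<close> since \<open>(F\<^sup>2)'' \<rightarrow> 0\<close> at the cusp, and it is large for \<open>t\<close> close to \<open>t\<^sub>0\<close> if \<open>C\<close> is large.\<close>

lemma cusp_integral_finite:
  fixes \<Omega> :: "('a::euclidean_space \<times> real) set"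
  assumes \<Omega>: "open \<Omega>" "bounded \<Omega>" and u: "torsion_function \<Omega> u" and \<beta>: "0 < \<beta>"
    and cusp: "cusp_profile \<Omega> p \<eta> F" and fin: "neg_power_integral \<Omega> u \<beta> < \<infinity>"
  shows "(\<integral>\<^sup>+t\<in>{0..\<eta>}. ennreal (F t powr (real DIM('a) - 2 * \<beta>)) \<partial>lborel) < \<infinity>"
proof (rule cusp_profileE[OF cusp])
  fix F' F'' and A :: "'a \<times> real \<Rightarrow> 'a \<times> real" and \<epsilon>
  assume \<eta>: "0 < \<eta>" and F0: "F 0 = 0" and Fpos: "\<And>t. 0 < t \<Longrightarrow> t \<le> \<eta> \<Longrightarrow> 0 < F t"
    and dF: "\<And>t. 0 < t \<Longrightarrow> t < \<eta> \<Longrightarrow> (F has_real_derivative F' t) (at t)"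
    and dF': "\<And>t. 0 < t \<Longrightarrow> t < \<eta> \<Longrightarrow> (F' has_real_derivative F'' t) (at t)"
    and cF: "continuous_on {0..\<eta>} F" "continuous_on {0..\<eta>} F'" "continuous_on {0..\<eta>} F''" and F'0: "F' 0 = 0"
    and A: "orthogonal_transformation A" and \<epsilon>: "0 < \<epsilon>"
    and im: "\<And>x' t. t \<le> \<eta> \<Longrightarrow> (x', t) \<in> (\<lambda>x. A (x - p)) ` \<Omega> \<longleftrightarrow> 0 < t \<and> norm x' < \<epsilon> * F t"
  define m where "m = real DIM('a)"
  have m1: "1 \<le> m" using DIM_positive[where 'a = 'a] by (simp add: m_def Suc_le_eq)
  \<comment> \<open>\<open>Q\<close> is the second derivative of \<open>G\<close> below and vanishes
    at 0; \<open>t0\<close> is chosen so that it stays at most 1. The horizontal part contributes -2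
    m \<le> -2, hence the sum is at most -1.\<close>
  define Q where "Q t = 2 * \<epsilon>\<^sup>2 * (2 * F' t * F' t + 2 * F t * F'' t)" for t
  have cQ: "continuous_on {0..\<eta>} Q" unfolding Q_def by (intro continuous_intros cF)
  obtain d where d: "0 < d" "\<And>t. t \<in> {0..\<eta>} \<Longrightarrow> dist t 0 < d \<Longrightarrow> dist (Q t) (Q 0) < 1"
    using cQ \<eta> unfolding continuous_on_iff by (metis atLeastAtMost_iff less_imp_le order_refl zero_less_one)
  define t0 where "t0 = min (d / 2) (\<eta> / 2)"
  have t0: "0 < t0" "t0 < \<eta>" "t0 < d" using d(1) \<eta> by (auto simp: t0_def)
  have Q1: "Q t \<le> 1" if "0 < t" "t < t0" for t
    using d(2)[of t] that t0 by (simp add: Q_def F0 F'0 dist_real_def)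
  have sub: "{t0 / 2..t0} \<subseteq> {0..\<eta>}" using t0 by auto
  obtain \<mu> where \<mu>: "0 < \<mu>" "\<And>t. t \<in> {t0 / 2..t0} \<Longrightarrow> \<mu> \<le> F t"
  proof -
    obtain s where s: "s \<in> {t0 / 2..t0}" "\<And>t. t \<in> {t0 / 2..t0} \<Longrightarrow> F s \<le> F t"
      using continuous_attains_inf[OF _ _ continuous_on_subset[OF cF(1) sub]] t0 by auto
    show ?thesis by (rule that[of "F s"]) (use s t0 Fpos in auto)
  qed
  obtain R where R: "\<And>x. x \<in> \<Omega> \<Longrightarrow> norm x \<le> R"
    using \<Omega>(2) by (auto simp: bounded_iff)
  \<comment> \<open>The summand 1 gives C \<ge> 1, so scaling keeps the Laplacian at most -1; the
    other makes C \<epsilon>^2 F^2 at least R^2 wherever F \<ge> \<mu>.\<close>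
  define C where "C = 1 + R\<^sup>2 / (\<epsilon>\<^sup>2 * \<mu>\<^sup>2)"
  have C: "1 \<le> C" by (simp add: C_def)
  have CR: "R\<^sup>2 \<le> C * (\<epsilon>\<^sup>2 * \<mu>\<^sup>2)"
  proof -
    have "C * (\<epsilon>\<^sup>2 * \<mu>\<^sup>2) = \<epsilon>\<^sup>2 * \<mu>\<^sup>2 + R\<^sup>2" using \<epsilon> \<mu>(1) by (simp add: C_def field_simps)
    then show ?thesis by simp
  qed
  \<comment> \<open>The factor 2 keeps \<open>v\<close> at least C \<epsilon>^2 F^2 throughout the
    slice |x'| < \<epsilon> F.\<close>
  define G where "G t = 2 * \<epsilon>\<^sup>2 * (F t * F t)" for t
  define G' where "G' t = 2 * \<epsilon>\<^sup>2 * (2 * F t * F' t)" for t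
  have dG: "(G has_real_derivative G' t) (at t)" "(G' has_real_derivative Q t) (at t)" if "t \<in> {0<..<t0}" for t
    unfolding G_def G'_def Q_def using that t0
    by (auto intro!: derivative_eq_intros dF dF' simp: algebra_simps)
  have sub0: "{0<..<t0} \<subseteq> {0..\<eta>}" using t0 by auto
  have cG: "continuous_on {0<..<t0} G'" "continuous_on {0<..<t0} Q" "continuous_on {0<..<t0} F"
    unfolding G'_def by (intro continuous_intros continuous_on_subset[OF _ sub0] cF cQ)+
  define T where "T = {y :: 'a \<times> real. snd y \<in> {0<..<t0}}"
  define v where "v = (\<lambda>y :: 'a \<times> real. C * (G (snd y) - fst y \<bullet> fst y))"
  obtain g0 H0 where v0: "c2_on T (\<lambda>y. G (snd y) - fst y \<bullet> fst y) g0 H0" and lv0: "\<And>y. lapl H0 y = Q (snd y) - 2 * m"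
    unfolding T_def m_def using c2_on_snd_minus_square[OF dG cG(1,2)] by blast
  have v: "c2_on T v (\<lambda>y. C *\<^sub>R g0 y) (\<lambda>b y. C *\<^sub>R H0 b y)"
    unfolding v_def by (rule c2_on_cmult[OF v0])
  have lv: "lapl (\<lambda>b y. C *\<^sub>R H0 b y) y = C * (Q (snd y) - 2 * m)" for y
    by (simp add: lapl_cmult lv0)
  define U where "U = {y \<in> T. norm (fst y) < \<epsilon> * F (snd y)}"
  have openT: "open T" unfolding T_def by (rule open_snd_vimage) simp
  have openU: "open U"
  proof -
    have "continuous_on T (\<lambda>y. \<epsilon> * F (snd y) - norm (fst y))"
      unfolding T_def by (intro continuous_intros continuous_on_compose2[OF cG(3)]) auto
    then have "open (T \<inter> (\<lambda>y. \<epsilon> * F (snd y) - norm (fst y)) -` {0<..})"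
      by (rule continuous_open_preimage[OF _ openT]) auto
    also have "T \<inter> (\<lambda>y. \<epsilon> * F (snd y) - norm (fst y)) -` {0<..} = U" by (auto simp: U_def)
    finally show ?thesis .
  qed
  have v_ge: "C * (\<epsilon> * F (snd y))\<^sup>2 \<le> v y" and v_le: "v y \<le> C * (2 * \<epsilon>\<^sup>2) * (F (snd y))\<^sup>2" if "y \<in> U" for y
  proof -
    have "(norm (fst y))\<^sup>2 \<le> (\<epsilon> * F (snd y))\<^sup>2" using that by (intro power_mono) (auto simp: U_def)
    then have "(\<epsilon> * F (snd y))\<^sup>2 \<le> G (snd y) - fst y \<bullet> fst y"
      by (simp add: G_def power2_norm_eq_inner[symmetric] power_mult_distrib) (simp add: power2_eq_square)
    then show "C * (\<epsilon> * F (snd y))\<^sup>2 \<le> v y" unfolding v_def using C by (intro mult_left_mono) auto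
    have "v y \<le> C * G (snd y)" unfolding v_def using C by (intro mult_left_mono) auto
    then show "v y \<le> C * (2 * \<epsilon>\<^sup>2) * (F (snd y))\<^sup>2" by (simp add: G_def power2_eq_square mult_ac)
  qed
  have UT: "U \<subseteq> T" by (auto simp: U_def)
  obtain g' H' where v': "c2_on {x. A (x - p) \<in> U} (\<lambda>x. v (A (x - p))) g' H'" 
    "\<And>x. lapl H' x = lapl (\<lambda>b y. C *\<^sub>R H0 b y) (A (x - p))"
    using c2_on_rigid[OF A c2_on_subset[OF v UT]] by blast
  have Uiff: "A (x - p) \<in> U \<longleftrightarrow> x \<in> \<Omega>" if "snd (A (x - p)) < t0" for x
  proof -
    obtain x' t where yy: "A (x - p) = (x', t)" by (cases "A (x - p)")
    have "A (x - p) \<in> U \<longleftrightarrow> 0 < t \<and> norm x' < \<epsilon> * F t" using that by (auto simp: U_def T_def yy)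
    also have "\<dots> \<longleftrightarrow> A (x - p) \<in> (\<lambda>x. A (x - p)) ` \<Omega>" using im[of t x'] that t0 yy by auto
    also have "\<dots> \<longleftrightarrow> x \<in> \<Omega>" by (rule orthogonal_transformation_inj_iff[OF A])
    finally show ?thesis .
  qed
  \<comment> \<open>The lower half of the cusp piece, up to the boundary of \<Omega>. What remains
    of \<open>U\<close> is the collar t0/2 < t < t0, where \<open>v\<close> is at least R^2.\<close>
  let ?C = "{x \<in> \<Omega>. snd (A (x - p)) \<le> t0 / 2}"
  have ae: "AE x in lebesgue_on \<Omega>. x \<in> {x. A (x - p) \<in> U} \<longrightarrow> u x \<le> v (A (x - p))"
  proof (rule upper_barrier[OF \<Omega> u open_rigid_vimage[OF A openU] _ v'(1) _ _ R, where C = ?C])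
    show "{x. A (x - p) \<in> U} \<subseteq> \<Omega>" using Uiff by (auto simp: U_def T_def)
    show "lapl H' x \<le> - 1" if "x \<in> {x. A (x - p) \<in> U}" for x
    proof -
      have "Q (snd (A (x - p))) \<le> 1" using that by (intro Q1) (auto simp: U_def T_def)
      then have "C * (Q (snd (A (x - p))) - 2 * m) \<le> C * (- 1)" using C m1 by (intro mult_left_mono) auto
      then show ?thesis unfolding v'(2) lv using C by linarith
    qed
    show "0 \<le> v (A (x - p))" if "x \<in> {x. A (x - p) \<in> U}" for x
    proof -
      have "0 \<le> C * (\<epsilon> * F (snd (A (x - p))))\<^sup>2" using C by simp
      also have "\<dots> \<le> v (A (x - p))" by (rule v_ge) (use that in simp)
      finally show ?thesis .
    qed
    have "open {x. A (x - p) \<in> snd -` {t0 / 2<..}}"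
      by (intro open_rigid_vimage[OF A] open_vimage_snd) auto
    moreover have "\<Omega> - ?C = \<Omega> \<inter> {x. A (x - p) \<in> snd -` {t0 / 2<..}}" by auto
    ultimately show "open (\<Omega> - ?C)" using \<Omega>(1) by (simp only: open_Int)
    show "?C \<subseteq> {x. A (x - p) \<in> U}" using Uiff t0 by auto
    show "R\<^sup>2 \<le> v (A (x - p))" if "x \<in> {x. A (x - p) \<in> U} - ?C" for x
    proof -
      have xU: "A (x - p) \<in> U" using that by simp
      then have st: "snd (A (x - p)) < t0" by (auto simp: U_def T_def)
      have "x \<in> \<Omega>" using Uiff[OF st] xU by simp
      then have "\<mu> \<le> F (snd (A (x - p)))" using that st by (intro \<mu>(2)) auto
      then have "(\<epsilon> * \<mu>)\<^sup>2 \<le> (\<epsilon> * F (snd (A (x - p))))\<^sup>2" using \<epsilon> \<mu>(1) by (intro power_mono mult_left_mono) auto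
      then have "C * (\<epsilon> * \<mu>)\<^sup>2 \<le> C * (\<epsilon> * F (snd (A (x - p))))\<^sup>2" using C by (intro mult_left_mono) auto
      then show ?thesis using CR v_ge[OF xU] by (simp add: power_mult_distrib)
    qed
  qed
  define F1 where "F1 t = (if t \<in> {0..\<eta>} then F t else 0)" for t
  have [measurable]: "F1 \<in> borel_measurable borel"
    unfolding F1_def[abs_def] by (rule borel_measurable_continuous_on_if[OF _ cF(1)]) auto
  define D where "D = C * (2 * \<epsilon>\<^sup>2)"
  have D: "0 < D" using C \<epsilon> by (simp add: D_def)
  \<comment> \<open>Bounding \<open>v\<close> by \<open>D\<close> F^2 makes the minorant constant on
    each slice, so its slice integral is that value times the volume of an (n-1)-ball of radius
    \<epsilon> F(t).\<close>
  define k where "k y = (if 0 < snd y \<and> snd y < t0 then 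
     (if norm (fst y) < \<epsilon> * F1 (snd y) then ennreal ((D * (F1 (snd y))\<^sup>2) powr (- \<beta>)) else 0) else 0)" for y :: "'a \<times> real"
  have km: "k \<in> borel_measurable borel"
    unfolding k_def borel_prod[symmetric] by measurable
  have "(\<integral>\<^sup>+y. k y \<partial>lborel) = (\<integral>\<^sup>+x. k (A (x - p)) \<partial>lborel)"
    by (rule nn_integral_rigid[OF A km, symmetric])
  also have "\<dots> = (\<integral>\<^sup>+x. k (A (x - p)) \<partial>lebesgue)" by (rule nn_integral_completion[symmetric])
  also have "\<dots> \<le> neg_power_integral \<Omega> u \<beta>"
    unfolding neg_power_integral_def
  proof (rule nn_integral_mono_AE)
    have "AE x in lebesgue. x \<in> \<Omega> \<longrightarrow> x \<in> {x. A (x - p) \<in> U} \<longrightarrow> u x \<le> v (A (x - p))"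
      using ae \<Omega>(1) by (subst (asm) AE_restrict_space_iff) auto
    then show "AE x in lebesgue. k (A (x - p)) \<le> (if 0 < u x then ennreal (u x powr (- \<beta>)) else \<infinity>) * indicator \<Omega> x"
    proof (rule AE_mp, intro AE_I2 impI)
      fix x assume x: "x \<in> \<Omega> \<longrightarrow> x \<in> {x. A (x - p) \<in> U} \<longrightarrow> u x \<le> v (A (x - p))"
      show "k (A (x - p)) \<le> (if 0 < u x then ennreal (u x powr (- \<beta>)) else \<infinity>) * indicator \<Omega> x"
      proof (cases "A (x - p) \<in> U")
        case True
        then have t: "snd (A (x - p)) < t0" "0 < snd (A (x - p))" by (auto simp: U_def T_def)
        then have x\<Omega>: "x \<in> \<Omega>" using Uiff True by simp
        have F1: "F1 (snd (A (x - p))) = F (snd (A (x - p)))" using t t0 by (simp add: F1_def)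
        have "u x \<le> v (A (x - p))" using x x\<Omega> True by auto
        also have "\<dots> \<le> D * (F1 (snd (A (x - p))))\<^sup>2" using v_le[OF True] by (simp add: D_def F1)
        \<comment> \<open>Only positive \<open>u x\<close> has to be considered; elsewhere the
          integrand is \<infinity>.\<close>
        finally have "(D * (F1 (snd (A (x - p))))\<^sup>2) powr (- \<beta>) \<le> u x powr (- \<beta>)" if "0 < u x"
          using that \<beta> by (intro powr_mono2') auto
        then show ?thesis using x\<Omega> t by (auto simp: k_def intro: ennreal_leI)
      next
        case False
        have "k (A (x - p)) = 0"
        proof (rule ccontr)
          assume "k (A (x - p)) \<noteq> 0"
          then have "0 < snd (A (x - p))" "snd (A (x - p)) < t0" "norm (fst (A (x - p))) < \<epsilon> * F1 (snd (A (x - p)))"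
            by (auto simp: k_def split: if_splits)
          then have "A (x - p) \<in> U" using t0 by (auto simp: U_def T_def F1_def)
          with False show False by simp
        qed
        then show ?thesis by simp
      qed
    qed
  qed
  finally have kfin: "(\<integral>\<^sup>+y. k y \<partial>lborel) < \<infinity>" using fin by (rule le_less_trans)
  define V where "V = unit_ball_vol m"
  have V: "0 < V" unfolding V_def m_def by (rule unit_ball_vol_pos) simp
  define K where "K = V * \<epsilon> powr m * D powr (- \<beta>)"
  have K: "0 < K" using V \<epsilon> D by (simp add: K_def)
  define q where "q t = ennreal (F1 t powr (m - 2 * \<beta>)) * indicator {0<..<t0} t" for t
  have [measurable]: "q \<in> borel_measurable borel" unfolding q_def by measurable
  have "(\<integral>\<^sup>+y. k y \<partial>lborel) = (\<integral>\<^sup>+t. \<integral>\<^sup>+x'. k (x', t) \<partial>lborel \<partial>lborel)"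
    by (rule nn_integral_lborel_prod_eq(2)[OF km])
  also have "\<dots> = (\<integral>\<^sup>+t. ennreal K * q t \<partial>lborel)"
  proof (rule nn_integral_cong)
    fix t :: real
    show "(\<integral>\<^sup>+x'. k (x', t) \<partial>lborel) = ennreal K * q t"
    proof (cases "0 < t \<and> t < t0")
      case True
      then have F1: "0 < F1 t" using t0 Fpos[of t] by (simp add: F1_def)
      have "(\<integral>\<^sup>+x'. k (x', t) \<partial>lborel) = (\<integral>\<^sup>+x'. ennreal ((D * (F1 t)\<^sup>2) powr (- \<beta>)) * indicator (ball (0 :: 'a) (\<epsilon> * F1 t)) x' \<partial>lborel)"
        by (rule nn_integral_cong) (use True in \<open>auto simp: k_def\<close>)
      also have "\<dots> = ennreal ((D * (F1 t)\<^sup>2) powr (- \<beta>)) * emeasure lborel (ball (0 :: 'a) (\<epsilon> * F1 t))"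
        by (rule nn_integral_cmult_indicator) simp
      also have "\<dots> = ennreal ((D * (F1 t)\<^sup>2) powr (- \<beta>) * (V * (\<epsilon> * F1 t) ^ DIM('a)))"
        using \<epsilon> F1 by (simp add: emeasure_ball V_def m_def ennreal_mult)
      also have "(D * (F1 t)\<^sup>2) powr (- \<beta>) * (V * (\<epsilon> * F1 t) ^ DIM('a)) = K * F1 t powr (m - 2 * \<beta>)"
      proof -
        have "(\<epsilon> * F1 t) ^ DIM('a) = \<epsilon> powr m * F1 t powr m"
          using \<epsilon> F1 by (simp add: m_def powr_realpow power_mult_distrib)
        moreover have "(D * (F1 t)\<^sup>2) powr (- \<beta>) = D powr (- \<beta>) * F1 t powr (- 2 * \<beta>)"
          using D F1 by (simp add: powr_mult powr_powr flip: powr_numeral)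
        moreover have "F1 t powr (m - 2 * \<beta>) = F1 t powr m * F1 t powr (- 2 * \<beta>)"
          by (simp flip: powr_add)
        ultimately show ?thesis by (simp add: K_def)
      qed
      finally show ?thesis using True K by (simp add: q_def ennreal_mult)
    next
      case False
      then have "k (x', t) = 0" for x' by (auto simp: k_def)
      moreover have "q t = 0" using False by (auto simp: q_def)
      ultimately show ?thesis by simp
    qed
  qed
  also have "\<dots> = ennreal K * (\<integral>\<^sup>+t. q t \<partial>lborel)"
    by (rule nn_integral_cmult) simp
  finally have "ennreal K * (\<integral>\<^sup>+t. q t \<partial>lborel) < \<infinity>" using kfin by simp
  then have qfin: "(\<integral>\<^sup>+t. q t \<partial>lborel) < \<infinity>"
    using K by (auto simp: ennreal_mult_less_top ennreal_eq_0_iff)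
  \<comment> \<open>Above \<open>t0\<close> the profile is bounded away from zero, so the integrand
    is bounded whatever the sign of the exponent.\<close>
  have sub1: "{t0..\<eta>} \<subseteq> {0..\<eta>}" using t0 by auto
  have "continuous_on {t0..\<eta>} (\<lambda>t. F t powr (m - 2 * \<beta>))"
    by (intro continuous_on_powr continuous_on_const continuous_on_subset[OF cF(1) sub1])
      (use Fpos t0 in \<open>force simp: less_imp_neq[symmetric]\<close>)
  then obtain L where L: "0 \<le> L" "\<And>t. t \<in> {t0..\<eta>} \<Longrightarrow> \<bar>F t powr (m - 2 * \<beta>)\<bar> \<le> L"
    using continuous_on_bounded_Icc by blast
  have "(\<integral>\<^sup>+t\<in>{0..\<eta>}. ennreal (F t powr (m - 2 * \<beta>)) \<partial>lborel) \<le> (\<integral>\<^sup>+t. q t + ennreal L * indicator {t0..\<eta>} t \<partial>lborel)"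
  proof (rule nn_integral_mono)
    fix t
    \<comment> \<open>At t = 0 the convention that 0 \<open>powr\<close> anything is 0 makes the
      left side vanish.\<close>
    consider "t \<notin> {0..\<eta>}" | "t = 0" | "0 < t" "t < t0" | "t \<in> {t0..\<eta>}" by fastforce
    then show "ennreal (F t powr (m - 2 * \<beta>)) * indicator {0..\<eta>} t \<le> q t + ennreal L * indicator {t0..\<eta>} t"
    proof cases
      case 3
      then show ?thesis using t0 by (simp add: q_def F1_def)
    next
      case 4
      then have "ennreal (F t powr (m - 2 * \<beta>)) \<le> ennreal L" using L(2)[of t] by (intro ennreal_leI) auto
      then show ?thesis using 4 t0 by (simp add: q_def)
    qed (use F0 in \<open>simp_all\<close>)
  qed
  also have "\<dots> = (\<integral>\<^sup>+t. q t \<partial>lborel) + ennreal L * emeasure lborel {t0..\<eta>}"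
    by (simp add: nn_integral_add nn_integral_cmult_indicator)
  also have "\<dots> < \<infinity>"
    using qfin t0 by (simp add: ennreal_mult_less_top)
  finally show ?thesis by (simp add: m_def)
qed

section \<open>Covering the closure and assembling the cases\<close>

lemma neg_power_integral_bounded:
  fixes \<Omega> :: "'b::euclidean_space set"
  assumes \<Omega>: "open \<Omega>" "bounded \<Omega>" and near: "\<And>p. p \<in> closure \<Omega> \<Longrightarrow> finite_near \<Omega> \<beta> p"
  shows "\<exists>C::real. \<forall>u. torsion_function \<Omega> u \<longrightarrow> neg_power_integral \<Omega> u \<beta> \<le> ennreal C"
proof -
  \<comment> \<open>Neighbourhoods and constants are selected before \<open>u\<close> is fixed, so
    the final constant is independent of \<open>u\<close>.\<close>
  obtain N C where N: "\<And>p. p \<in> closure \<Omega> \<Longrightarrow> open (N p) \<and> p \<in> N p"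
    and C: "\<And>p u. p \<in> closure \<Omega> \<Longrightarrow> torsion_function \<Omega> u \<Longrightarrow> neg_power_integral (N p \<inter> \<Omega>) u \<beta> \<le> ennreal (C p)"
    using near unfolding finite_near_def by metis
  have "compact (closure \<Omega>)" using \<Omega>(2) by (simp add: compact_closure)
  then obtain D where D: "D \<subseteq> closure \<Omega>" "finite D" "closure \<Omega> \<subseteq> (\<Union>p\<in>D. N p)"
    by (rule compactE_image[of _ "closure \<Omega>" N]) (use N in auto)
  show ?thesis
  proof (intro exI allI impI)
    fix u assume u: "torsion_function \<Omega> u"
    define h where "h x = (if 0 < u x then ennreal (u x powr (- \<beta>)) else \<infinity>)" for x
    have um: "u \<in> borel_measurable (lebesgue_on \<Omega>)"
      using u by (auto simp: torsion_function_def W12_0_def L2_on_def)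
    have "h \<in> borel_measurable (lebesgue_on \<Omega>)"
      unfolding h_def using um by measurable
    then have hm: "(\<lambda>x. h x * indicator \<Omega> x) \<in> borel_measurable lebesgue"
      using \<Omega>(1) by (subst (asm) borel_measurable_restrict_space_iff_ennreal) auto
    have hm': "(\<lambda>x. h x * indicator (N p \<inter> \<Omega>) x) \<in> borel_measurable lebesgue" if "p \<in> D" for p
    proof -
      have [measurable]: "N p \<in> sets lebesgue" using N[of p] D(1) that by auto
      have "(\<lambda>x. h x * indicator \<Omega> x * indicator (N p) x) \<in> borel_measurable lebesgue"
        using hm by measurable
      also have "(\<lambda>x. h x * indicator \<Omega> x * indicator (N p) x) = (\<lambda>x. h x * indicator (N p \<inter> \<Omega>) x)"
        by (auto simp: fun_eq_iff indicator_def)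
      finally show ?thesis .
    qed
    have "neg_power_integral \<Omega> u \<beta> \<le> (\<integral>\<^sup>+x. (\<Sum>p\<in>D. h x * indicator (N p \<inter> \<Omega>) x) \<partial>lebesgue)"
      unfolding neg_power_integral_def h_def[symmetric]
    proof (rule nn_integral_mono)
      fix x
      show "h x * indicator \<Omega> x \<le> (\<Sum>p\<in>D. h x * indicator (N p \<inter> \<Omega>) x)"
      proof (cases "x \<in> \<Omega>")
        case True
        then obtain p where p: "p \<in> D" "x \<in> N p" using D(3) closure_subset by blast
        then have "h x * indicator \<Omega> x \<le> h x * indicator (N p \<inter> \<Omega>) x" by (simp add: True)
        also have "\<dots> \<le> (\<Sum>p\<in>D. h x * indicator (N p \<inter> \<Omega>) x)"
          by (rule member_le_sum) (use p D(2) in auto)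
        finally show ?thesis .
      qed simp
    qed
    also have "\<dots> = (\<Sum>p\<in>D. \<integral>\<^sup>+x. h x * indicator (N p \<inter> \<Omega>) x \<partial>lebesgue)"
      by (rule nn_integral_sum) (rule hm')
    also have "\<dots> = (\<Sum>p\<in>D. neg_power_integral (N p \<inter> \<Omega>) u \<beta>)"
      by (simp add: neg_power_integral_def h_def)
    \<comment> \<open>Absolute values, because \<open>ennreal\<close> truncates negative constants
      to 0 and is additive on nonnegative reals.\<close>
    also have "\<dots> \<le> (\<Sum>p\<in>D. ennreal \<bar>C p\<bar>)"
    proof (rule sum_mono)
      fix p assume "p \<in> D"
      then have "neg_power_integral (N p \<inter> \<Omega>) u \<beta> \<le> ennreal (C p)" using C D(1) u by blast
      also have "\<dots> \<le> ennreal \<bar>C p\<bar>" by (rule ennreal_leI) simp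
      finally show "neg_power_integral (N p \<inter> \<Omega>) u \<beta> \<le> ennreal \<bar>C p\<bar>" .
    qed
    also have "\<dots> = ennreal (\<Sum>p\<in>D. \<bar>C p\<bar>)" by (rule sum_ennreal) simp
    finally show "neg_power_integral \<Omega> u \<beta> \<le> ennreal (\<Sum>p\<in>D. \<bar>C p\<bar>)" .
  qed
qed

text \<open>One profile per cusp is enough, hence the existential form: it serves nonnegative
  exponents, where any profile will do, as well as the planar case with prescribed profiles.\<close>

lemma cusp_domain_bounded:
  fixes \<Omega> :: "('a::euclidean_space \<times> real) set"
  assumes \<Omega>: "domain_with_exterior_cusps \<Omega>" and \<beta>: "0 < \<beta>" "\<beta> < 1"
    and cusps: "\<And>p. p \<in> exterior_cusps \<Omega> \<Longrightarrow> \<exists>\<eta> F. cusp_profile \<Omega> p \<eta> F \<and>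
      (\<integral>\<^sup>+t\<in>{0..\<eta>}. ennreal (F t powr (real DIM('a) - 2 * \<beta>)) \<partial>lborel) < \<infinity>"
  shows "\<exists>C::real. \<forall>u. torsion_function \<Omega> u \<longrightarrow> neg_power_integral \<Omega> u \<beta> \<le> ennreal C"
proof -
  obtain S where op: "open \<Omega>" "bounded \<Omega>" and S: "S \<subseteq> exterior_cusps \<Omega>" "\<And>p. p \<in> frontier \<Omega> - S \<Longrightarrow> C2_boundary_at \<Omega> p"
    using \<Omega> unfolding domain_with_exterior_cusps_def by blast
  show ?thesis
  proof (rule neg_power_integral_bounded[OF op])
    fix p assume "p \<in> closure \<Omega>"
    then consider "p \<in> \<Omega>" | "p \<in> S" | "p \<in> frontier \<Omega>" "p \<in> frontier \<Omega> - S"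
      using op(1) by (auto simp: frontier_def interior_open)
    then show "finite_near \<Omega> \<beta> p"
    proof cases
      case 1
      then show ?thesis by (rule finite_near_interior[OF op \<beta>(1)])
    next
      case 2
      then obtain \<eta> F where "cusp_profile \<Omega> p \<eta> F" 
        "(\<integral>\<^sup>+t\<in>{0..\<eta>}. ennreal (F t powr (real DIM('a) - 2 * \<beta>)) \<partial>lborel) < \<infinity>"
        using S(1) cusps by blast
      then show ?thesis by (rule finite_near_cusp[OF op \<beta>])
    next
      case 3
      then show ?thesis using S(2) by (intro finite_near_C2_boundary[OF op \<beta>]) auto
    qed
  qed
qed

theorem theorem6p4:
  fixes \<Omega> :: "('a::euclidean_space \<times> real) set"
  assumes "domain_with_exterior_cusps \<Omega>"
  shows
    "(3 \<le> DIM('a \<times> real) \<longrightarrow>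
        (\<forall>\<beta>. 0 < \<beta> \<and> \<beta> < 1 \<longrightarrow>
           (\<exists>C::real. \<forall>u. torsion_function \<Omega> u \<longrightarrow> neg_power_integral \<Omega> u \<beta> \<le> ennreal C))) \<and>
     (DIM('a \<times> real) = 2 \<longrightarrow>
        (\<forall>\<beta>. 0 < \<beta> \<and> \<beta> \<le> 1 / 2 \<longrightarrow>
           (\<exists>C::real. \<forall>u. torsion_function \<Omega> u \<longrightarrow> neg_power_integral \<Omega> u \<beta> \<le> ennreal C))) \<and>
     (DIM('a \<times> real) = 2 \<longrightarrow>
        (\<forall>\<beta> u \<eta> F. 1 / 2 < \<beta> \<and> \<beta> < 1 \<and> torsion_function \<Omega> u \<and>
             (\<forall>p\<in>exterior_cusps \<Omega>. cusp_profile \<Omega> p (\<eta> p) (F p)) \<longrightarrow>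
           ((\<exists>C::real. neg_power_integral \<Omega> u \<beta> \<le> ennreal C) \<longleftrightarrow>
            (\<forall>p\<in>exterior_cusps \<Omega>.
               (\<integral>\<^sup>+\<tau>\<in>{0..\<eta> p}. ennreal (F p \<tau> powr (1 - 2 * \<beta>)) \<partial>lborel) < \<infinity>))))"
proof -
  have op: "open \<Omega>" "bounded \<Omega>"
    using assms unfolding domain_with_exterior_cusps_def by blast+
  \<comment> \<open>With slice dimension n - 1, the condition 2 \<beta> \<le> n - 1 covers n \<ge> 3
    with \<beta> < 1 and n = 2 with \<beta> \<le> 1/2 at once.\<close>
  have small: "\<exists>C::real. \<forall>u. torsion_function \<Omega> u \<longrightarrow> neg_power_integral \<Omega> u \<beta> \<le> ennreal C"
    if \<beta>: "0 < \<beta>" "\<beta> < 1" "2 * \<beta> \<le> real DIM('a)" for \<beta>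
  proof (rule cusp_domain_bounded[OF assms \<beta>(1,2)])
    fix p assume "p \<in> exterior_cusps \<Omega>"
    then obtain \<eta> F where "cusp_profile \<Omega> p \<eta> F" unfolding exterior_cusps_def by blast
    then show "\<exists>\<eta> F. cusp_profile \<Omega> p \<eta> F \<and>
      (\<integral>\<^sup>+t\<in>{0..\<eta>}. ennreal (F t powr (real DIM('a) - 2 * \<beta>)) \<partial>lborel) < \<infinity>"
      using cusp_profile_powr_finite[of \<Omega> p \<eta> F "real DIM('a) - 2 * \<beta>"] \<beta>(3) by auto
  qed
  have planar: "(\<exists>C::real. neg_power_integral \<Omega> u \<beta> \<le> ennreal C) \<longleftrightarrow>
            (\<forall>p\<in>exterior_cusps \<Omega>. (\<integral>\<^sup>+\<tau>\<in>{0..\<eta> p}. ennreal (F p \<tau> powr (1 - 2 * \<beta>)) \<partial>lborel) < \<infinity>)"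
    if dim: "DIM('a \<times> real) = 2" and \<beta>: "1 / 2 < \<beta>" "\<beta> < 1" and u: "torsion_function \<Omega> u" 
      and cusp: "\<forall>p\<in>exterior_cusps \<Omega>. cusp_profile \<Omega> p (\<eta> p) (F p)" for \<beta> u \<eta> F
  proof
    have m: "real DIM('a) = 1" using dim by simp
    have \<beta>0: "0 < \<beta>" using \<beta> by simp
    {
      assume "\<exists>C::real. neg_power_integral \<Omega> u \<beta> \<le> ennreal C"
      then have fin: "neg_power_integral \<Omega> u \<beta> < \<infinity>" using ennreal_less_top le_less_trans by fastforce
      show "\<forall>p\<in>exterior_cusps \<Omega>. (\<integral>\<^sup>+\<tau>\<in>{0..\<eta> p}. ennreal (F p \<tau> powr (1 - 2 * \<beta>)) \<partial>lborel) < \<infinity>"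
        using cusp_integral_finite[OF op u \<beta>0 cusp[rule_format] fin] unfolding m by (rule ballI)
    next
      assume "\<forall>p\<in>exterior_cusps \<Omega>. (\<integral>\<^sup>+\<tau>\<in>{0..\<eta> p}. ennreal (F p \<tau> powr (1 - 2 * \<beta>)) \<partial>lborel) < \<infinity>"
      then have "\<exists>\<eta> F. cusp_profile \<Omega> p \<eta> F \<and> (\<integral>\<^sup>+t\<in>{0..\<eta>}. ennreal (F t powr (real DIM('a) - 2 * \<beta>)) \<partial>lborel) < \<infinity>"
        if "p \<in> exterior_cusps \<Omega>" for p
        using cusp that unfolding m by blast
      from cusp_domain_bounded[OF assms \<beta>0 \<beta>(2) this] u
      show "\<exists>C::real. neg_power_integral \<Omega> u \<beta> \<le> ennreal C" by blast
    }
  qed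
  show ?thesis
    by (intro conjI impI allI small planar) auto
qed

end
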